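(* Let $\Sigma$ be a finite alphabet, and let $S \subseteq \Sigma_{io}^*$ and $T \subseteq \Sigma_{io}^*$ be regular languages (given, e.g., by finite automata) with $\mathit{shiftlag}(S) < \infty$ and $\mathit{shiftlag}(T) < \infty$. Then it is decidable whether there exists a language $U \subseteq T$ recognized by a sequential DFA such that $[\![U]\!]$ is a uniformization of $[\![S]\!]$. (That is, the resynchronized uniformization problem restricted to source and target languages of finite shiftlag is decidable.)
   Context: $\Sigma_{io} = \{1,2\}\times\Sigma$, $\Sigma_i = \{1\}\times\Sigma$ (input letters), $\Sigma_o=\{2\}\times\Sigma$ (output letters). The morphisms $\pi_i,\pi_o:\Sigma_{io}^*\to\Sigma^*$ are defined by $\pi_i((1,a))=a$, $\pi_i((2,a))=\varepsilon$, $\pi_o((2,a))=a$, $\pi_o((1,a))=\varepsilon$. For $w\in\Sigma_{io}^*$, $[\![w]\!]=(\pi_i(w),\pi_o(w))$, and for $S\subseteq\Sigma_{io}^*$, $[\![S]\!]=\{[\![w]\!] : w\in S\}\subseteq\Sigma^*\times\Sigma^*$. A uniformization of a relation $R\subseteq\Sigma^*\times\Sigma^*$ is a relation $R_f\subseteq R$ that is (the graph of) a function with $\mathrm{dom}(R_f)=\mathrm{dom}(R)$. Lag/shift notions: for $u\in\{1,2\}^*$ and a position $i\le|u|$, $i$ is $\gamma$-lagged if $|\#_1(u[1,i])-\#_2(u[1,i])|=\gamma$ (and $>\gamma$-lagged, $\le\gamma$-lagged analogously). A shift of $u$ is a position $i\in\{1,\dots,|u|-1\}$ with $u[i]\neq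 u[i+1]$; shifts $i<j$ are consecutive if there is no shift strictly between them. $\mathit{shiftlag}(u)$ is the maximal $n\in\mathbb N$ such that $u$ contains $n$ consecutive shifts all of which are $>n$-lagged. For $w=(i_1,a_1)\cdots(i_m,a_m)\in\Sigma_{io}^*$ these notions are applied to $i_1\cdots i_m$; for a language, $\mathit{shiftlag}(L)=\sup\{\mathit{shiftlag}(w): w\in L\}\in\mathbb N\cup\{\infty\}$. A DFA $\mathcal A=(Q,\Sigma_{io},q_0,\delta,F)$ is sequential (an sDFA) if the set $Q^{i}$ of states with an outgoing transition on a letter of $\Sigma_i$ and the set $Q^{o}$ of states with an outgoing transition on a letter of $\Sigma_o$ form a partition of $Q$, and every state in $Q^o$ has at most one outgoing transition. *)

theory Defs
  imports Main "HOL-Library.Nat_Bijection" "HOL-Library.Extended_Nat"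
begin

datatype recf = RZ | RS | RProj nat | RComp recf "recf list" | RPrim recf recf | RMn recf

inductive rf_eval :: "recf \<Rightarrow> nat list \<Rightarrow> nat \<Rightarrow> bool" where
  zero: "rf_eval RZ xs 0"
| succ: "rf_eval RS [x] (Suc x)"
| proj: "i < length xs \<Longrightarrow> rf_eval (RProj i) xs (xs ! i)"
| comp: "list_all2 (\<lambda>g y. rf_eval g xs y) gs ys \<Longrightarrow> rf_eval f ys z \<Longrightarrow> rf_eval (RComp f gs) xs z"
| prim0: "rf_eval f xs y \<Longrightarrow> rf_eval (RPrim f g) (0 # xs) y"
| primS: "rf_eval (RPrim f g) (x # xs) y \<Longrightarrow> rf_eval g (x # y # xs) z
          \<Longrightarrow> rf_eval (RPrim f g) (Suc x # xs) z"
| mn: "rf_eval f (y # xs) 0 \<Longrightarrow> (\<forall>i<y. \<exists>m. rf_eval f (i # xs) (Suc m))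
          \<Longrightarrow> rf_eval (RMn f) xs y"

definition Sigma :: "nat \<Rightarrow> nat set" where "Sigma k = {0..<k}"
definition Sigma_io :: "nat \<Rightarrow> (nat \<times> nat) set" where "Sigma_io k = {1,2} \<times> Sigma k"
definition Sigma_i :: "nat \<Rightarrow> (nat \<times> nat) set" where "Sigma_i k = {1} \<times> Sigma k"
definition Sigma_o :: "nat \<Rightarrow> (nat \<times> nat) set" where "Sigma_o k = {2} \<times> Sigma k"

definition pi_i :: "(nat \<times> nat) list \<Rightarrow> nat list" where
  "pi_i w = map snd (filter (\<lambda>x. fst x = 1) w)"
definition pi_o :: "(nat \<times> nat) list \<Rightarrow> nat list" where
  "pi_o w = map snd (filter (\<lambda>x. fst x = 2) w)"

definition sem :: "(nat \<times> nat) list \<Rightarrow> nat list \<times> nat list" where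
  "sem w = (pi_i w, pi_o w)"
definition sem_lang :: "(nat \<times> nat) list set \<Rightarrow> (nat list \<times> nat list) set" where
  "sem_lang S = sem ` S"

definition uniformization :: "('a \<times> 'b) set \<Rightarrow> ('a \<times> 'b) set \<Rightarrow> bool" where
  "uniformization Rf R \<longleftrightarrow> Rf \<subseteq> R \<and> single_valued Rf \<and> Domain Rf = Domain R"

section \<open>Lag, shifts, shiftlag (positions are 1-based as in the paper)\<close>

definition lag :: "nat list \<Rightarrow> nat \<Rightarrow> nat" where
  "lag u i = nat \<bar>int (count_list (take i u) 1) - int (count_list (take i u) 2)\<bar>"

definition is_shift :: "nat list \<Rightarrow> nat \<Rightarrow> bool" where
  "is_shift u i \<longleftrightarrow> 1 \<le> i \<and> i \<le> length u - 1 \<and> u ! (i - 1) \<noteq> u ! i"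

definition consecutive_shifts :: "nat list \<Rightarrow> nat \<Rightarrow> nat \<Rightarrow> bool" where
  "consecutive_shifts u i j \<longleftrightarrow> is_shift u i \<and> is_shift u j \<and> i < j \<and>
      \<not> (\<exists>l. i < l \<and> l < j \<and> is_shift u l)"

definition has_shiftlag :: "nat list \<Rightarrow> nat \<Rightarrow> bool" where
  "has_shiftlag u n \<longleftrightarrow> (\<exists>is. length is = n \<and>
      (\<forall>i \<in> set is. is_shift u i \<and> lag u i > n) \<and>
      (\<forall>j. j + 1 < n \<longrightarrow> consecutive_shifts u (is ! j) (is ! (j + 1))))"

definition shiftlag :: "nat list \<Rightarrow> nat" where
  "shiftlag u = (GREATEST n. has_shiftlag u n)"

definition shiftlag_word :: "(nat \<times> nat) list \<Rightarrow> nat" where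
  "shiftlag_word w = shiftlag (map fst w)"

definition shiftlag_lang :: "(nat \<times> nat) list set \<Rightarrow> enat" where
  "shiftlag_lang L = Sup ((\<lambda>w. enat (shiftlag_word w)) ` L)"

definition dfa_run :: "(nat \<Rightarrow> nat \<times> nat \<Rightarrow> nat option) \<Rightarrow> nat \<Rightarrow> (nat \<times> nat) list \<Rightarrow> nat option" where
  "dfa_run \<delta> q w = fold (\<lambda>a qo. Option.bind qo (\<lambda>p. \<delta> p a)) w (Some q)"

definition dfa_lang :: "(nat \<Rightarrow> nat \<times> nat \<Rightarrow> nat option) \<Rightarrow> nat \<Rightarrow> nat set \<Rightarrow> (nat \<times> nat) list set" where
  "dfa_lang \<delta> q0 F = {w. \<exists>q. dfa_run \<delta> q0 w = Some q \<and> q \<in> F}"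

definition is_dfa :: "nat \<Rightarrow> nat set \<Rightarrow> nat \<Rightarrow> (nat \<Rightarrow> nat \<times> nat \<Rightarrow> nat option) \<Rightarrow> nat set \<Rightarrow> bool" where
  "is_dfa k Q q0 \<delta> F \<longleftrightarrow> finite Q \<and> q0 \<in> Q \<and> F \<subseteq> Q \<and>
     (\<forall>q a q'. \<delta> q a = Some q' \<longrightarrow> q \<in> Q \<and> a \<in> Sigma_io k \<and> q' \<in> Q)"

definition Q_in :: "nat \<Rightarrow> nat set \<Rightarrow> (nat \<Rightarrow> nat \<times> nat \<Rightarrow> nat option) \<Rightarrow> nat set" where
  "Q_in k Q \<delta> = {q \<in> Q. \<exists>a \<in> Sigma_i k. \<delta> q a \<noteq> None}"
definition Q_out :: "nat \<Rightarrow> nat set \<Rightarrow> (nat \<Rightarrow> nat \<times> nat \<Rightarrow> nat option) \<Rightarrow> nat set" where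
  "Q_out k Q \<delta> = {q \<in> Q. \<exists>a \<in> Sigma_o k. \<delta> q a \<noteq> None}"

definition is_sdfa :: "nat \<Rightarrow> nat set \<Rightarrow> nat \<Rightarrow> (nat \<Rightarrow> nat \<times> nat \<Rightarrow> nat option) \<Rightarrow> nat set \<Rightarrow> bool" where
  "is_sdfa k Q q0 \<delta> F \<longleftrightarrow> is_dfa k Q q0 \<delta> F \<and>
     Q_in k Q \<delta> \<union> Q_out k Q \<delta> = Q \<and> Q_in k Q \<delta> \<inter> Q_out k Q \<delta> = {} \<and>
     (\<forall>q \<in> Q_out k Q \<delta>. \<forall>a b. \<delta> q a \<noteq> None \<longrightarrow> \<delta> q b \<noteq> None \<longrightarrow> a = b)"

definition resync_unif :: "nat \<Rightarrow> (nat \<times> nat) list set \<Rightarrow> (nat \<times> nat) list set \<Rightarrow> bool" where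
  "resync_unif k S T \<longleftrightarrow> (\<exists>Q q0 \<delta> F. is_sdfa k Q q0 \<delta> F \<and> dfa_lang \<delta> q0 F \<subseteq> T \<and>
      uniformization (sem_lang (dfa_lang \<delta> q0 F)) (sem_lang S))"

text \<open>An NFA is (transitions, initial states, final states); states are naturals.\<close>
type_synonym nfa = "(nat \<times> (nat \<times> nat) \<times> nat) list \<times> nat list \<times> nat list"

fun nfa_reach :: "nfa \<Rightarrow> nat \<Rightarrow> (nat \<times> nat) list \<Rightarrow> nat \<Rightarrow> bool" where
  "nfa_reach A p [] q \<longleftrightarrow> p = q"
| "nfa_reach A p (a # w) q \<longleftrightarrow> (\<exists>p'. (p, a, p') \<in> set (fst A) \<and> nfa_reach A p' w q)"

definition nfa_lang :: "nat \<Rightarrow> nfa \<Rightarrow> (nat \<times> nat) list set" where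
  "nfa_lang k A = {w. w \<in> lists (Sigma_io k) \<and>
      (\<exists>p q. p \<in> set (fst (snd A)) \<and> q \<in> set (snd (snd A)) \<and> nfa_reach A p w q)}"

definition encode_nfa :: "nfa \<Rightarrow> nat" where
  "encode_nfa A = prod_encode
     (list_encode (map (\<lambda>(p, (i, a), q). prod_encode (p, prod_encode (prod_encode (i, a), q))) (fst A)),
      prod_encode (list_encode (fst (snd A)), list_encode (snd (snd A))))"

end

theory Submission
  imports Defs "HOL-Library.Sublist" "HOL-Library.FuncSet" "HOL-Library.Countable"
begin

text \<open>A regular language of finite shiftlag has the following property: once the lag exceeds the number of
  states, only boundedly many shifts follow, since otherwise two loops could be pumped.  Consequently the source
  relation, read synchronously on its two tapes, has finitely many Nerode classes, and a strategy for the
  output player that obeys the target language falls into two phases: a first phase of bounded lag, and a second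
  one with boundedly many output blocks.  The second phase is definable from automatic relations, the total
  length of the output being bounded by the length of one further word.  Pumping that word gives a computable
  bound on the output needed.  What remains is a safety game with finitely many classes of configurations; it
  stabilises after a computable number of rounds, and a positional winning strategy is a sequential DFA.\<close>

section \<open>Computable functions\<close>

text \<open>The obstacle is that a sequential automaton obeys no evident bound: its output blocks
  may be long and the input may run ahead arbitrarily far. While the lag is small, this is met by
  cutting equal segments out of both tapes. Later the number of output blocks is fixed in advance,
  so that the existence of a strategy becomes a formula with boundedly many quantifiers over words.
  Of the automata for such formulas only the numbers of classes are kept, because pumping needs
  nothing else; the automata themselves are never constructed. In the same way the value of the
  shiftlag is never computed: its finiteness, together with a bound on the states, already yields
  explicit constants. The decision procedure does not evaluate the game either. It searches for a
  finite strategy tree below an explicit bound, so that only bounded search and membership of words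
  in the two given languages have to be shown computable.\<close>

definition recfun :: "nat \<Rightarrow> (nat list \<Rightarrow> nat) \<Rightarrow> bool" where
  "recfun a F \<longleftrightarrow> (\<exists>r. \<forall>xs. length xs = a \<longrightarrow> rf_eval r xs (F xs))"

lemma recfun_cong: "recfun a F \<Longrightarrow> (\<And>xs. length xs = a \<Longrightarrow> F xs = G xs) \<Longrightarrow> recfun a G"
  unfolding recfun_def by force

lemma recfun_proj: "i < a \<Longrightarrow> recfun a (\<lambda>xs. xs ! i)"
  unfolding recfun_def by (metis rf_eval.proj)

lemma recfun_comp1:
  assumes "recfun 1 F" "recfun a G"
  shows "recfun a (\<lambda>xs. F [G xs])"
proof -
  from assms obtain f g where
    "\<And>xs. length xs = 1 \<Longrightarrow> rf_eval f xs (F xs)" "\<And>xs. length xs = a \<Longrightarrow> rf_eval g xs (G xs)"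
    unfolding recfun_def by blast
  then show ?thesis
    unfolding recfun_def by (intro exI[of _ "RComp f [g]"] allI impI, rule_tac ys = "[G xs]" in rf_eval.comp) auto
qed

lemma recfun_Suc: "recfun a G \<Longrightarrow> recfun a (\<lambda>xs. Suc (G xs))"
proof -
  have "recfun 1 (\<lambda>xs. Suc (hd xs))"
    unfolding recfun_def by (rule exI[of _ RS]) (auto simp: length_Suc_conv intro: rf_eval.succ)
  from recfun_comp1[OF this] show "recfun a G \<Longrightarrow> ?thesis" by simp
qed

lemma recfun_const: "recfun a (\<lambda>_. c)"
proof (induction c)
  case 0
  show ?case unfolding recfun_def by (rule exI[of _ RZ]) (auto intro: rf_eval.zero)
qed (rule recfun_Suc)

lemma recfun_prim:
  assumes "recfun a F" "recfun (Suc (Suc a)) G"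
  shows "recfun (Suc a) (\<lambda>xs. rec_nat (F (tl xs)) (\<lambda>i r. G (i # r # tl xs)) (hd xs))"
proof -
  from assms obtain f g where
    f: "\<And>xs. length xs = a \<Longrightarrow> rf_eval f xs (F xs)" and
    g: "\<And>xs. length xs = Suc (Suc a) \<Longrightarrow> rf_eval g xs (G xs)"
    unfolding recfun_def by blast
  have "rf_eval (RPrim f g) (n # xs) (rec_nat (F xs) (\<lambda>i r. G (i # r # xs)) n)"
    if "length xs = a" for n xs
    by (induction n) (auto intro!: rf_eval.prim0 rf_eval.primS f g that)
  then show ?thesis
    unfolding recfun_def by (intro exI[of _ "RPrim f g"]) (auto simp: length_Suc_conv)
qed

text \<open>The form in which primitive recursion is used below: the number of iterations is itself
  computed, and the projections hand the unchanged arguments to the step.\<close>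

lemma recfun_rec_nat:
  assumes "recfun a F" "recfun (Suc (Suc a)) (\<lambda>xs. G (xs ! 0) (xs ! 1) (tl (tl xs)))" "recfun a M"
  shows "recfun a (\<lambda>xs. rec_nat (F xs) (\<lambda>i r. G i r xs) (M xs))"
proof -
  from recfun_prim[OF assms(1,2)] obtain r where
    r: "\<And>xs. length xs = Suc a \<Longrightarrow> rf_eval r xs (rec_nat (F (tl xs)) (\<lambda>i r. G i r (tl xs)) (hd xs))"
    unfolding recfun_def by auto
  from assms(3) obtain m where m: "\<And>xs. length xs = a \<Longrightarrow> rf_eval m xs (M xs)"
    unfolding recfun_def by blast
  have "rf_eval (RComp r (m # map RProj [0..<a])) xs (rec_nat (F xs) (\<lambda>i r. G i r xs) (M xs))"
    if len: "length xs = a" for xs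
  proof (rule rf_eval.comp)
    have "list_all2 (\<lambda>g y. rf_eval g xs y) (map RProj [0..<a]) xs"
      using len by (auto simp: list_all2_conv_all_nth intro: rf_eval.proj)
    then show "list_all2 (\<lambda>g y. rf_eval g xs y) (m # map RProj [0..<a]) (M xs # xs)"
      using m[OF len] by simp
    show "rf_eval r (M xs # xs) (rec_nat (F xs) (\<lambda>i r. G i r xs) (M xs))"
      using r[of "M xs # xs"] len by simp
  qed
  then show ?thesis unfolding recfun_def by blast
qed

text \<open>Minimisation enters once, to invert the pairing function. The search must terminate on
  every input, whence the second assumption.\<close>

lemma recfun_Least:
  assumes "recfun (Suc a) (\<lambda>xs. G (hd xs) (tl xs))" and ex: "\<And>xs. length xs = a \<Longrightarrow> \<exists>y. G y xs = 0"
  shows "recfun a (\<lambda>xs. LEAST y. G y xs = 0)"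
proof -
  from assms(1) obtain g where
    g: "\<And>xs. length xs = Suc a \<Longrightarrow> rf_eval g xs (G (hd xs) (tl xs))"
    unfolding recfun_def by blast
  have "rf_eval (RMn g) xs (LEAST y. G y xs = 0)" if len: "length xs = a" for xs
  proof (rule rf_eval.mn)
    show "rf_eval g ((LEAST y. G y xs = 0) # xs) 0"
      using g[of "(LEAST y. G y xs = 0) # xs"] len LeastI_ex[OF ex[OF len]] by simp
    show "\<forall>i<LEAST y. G y xs = 0. \<exists>m. rf_eval g (i # xs) (Suc m)"
    proof (intro allI impI)
      fix i assume "i < (LEAST y. G y xs = 0)"
      then have "G i xs \<noteq> 0" by (rule not_less_Least)
      then show "\<exists>m. rf_eval g (i # xs) (Suc m)"
        using g[of "i # xs"] len by (cases "G i xs") auto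
    qed
  qed
  then show ?thesis unfolding recfun_def by blast
qed

lemma recfun_add: "recfun a F \<Longrightarrow> recfun a G \<Longrightarrow> recfun a (\<lambda>xs. F xs + G xs)"
proof (rule recfun_cong)
  assume F: "recfun a F" and G: "recfun a G"
  show "recfun a (\<lambda>xs. rec_nat (F xs) (\<lambda>i r. Suc r) (G xs))"
    by (rule recfun_rec_nat[OF F _ G]) (auto intro!: recfun_Suc recfun_proj)
  have "rec_nat m (\<lambda>i r. Suc r) n = m + n" for m n by (induction n) auto
  then show "rec_nat (F xs) (\<lambda>i r. Suc r) (G xs) = F xs + G xs" for xs by simp
qed

lemma recfun_pred: "recfun a F \<Longrightarrow> recfun a (\<lambda>xs. F xs - 1)"
proof (rule recfun_cong)
  assume F: "recfun a F"
  show "recfun a (\<lambda>xs. rec_nat 0 (\<lambda>i r. i) (F xs))"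
    by (rule recfun_rec_nat[OF recfun_const _ F]) (auto intro!: recfun_proj)
  have "rec_nat 0 (\<lambda>i r. i) n = n - 1" for n :: nat by (cases n) auto
  then show "rec_nat 0 (\<lambda>i r. i) (F xs) = F xs - 1" for xs by simp
qed

lemma recfun_diff: "recfun a F \<Longrightarrow> recfun a G \<Longrightarrow> recfun a (\<lambda>xs. F xs - G xs)"
proof (rule recfun_cong)
  assume F: "recfun a F" and G: "recfun a G"
  show "recfun a (\<lambda>xs. rec_nat (F xs) (\<lambda>i r. r - 1) (G xs))"
    by (rule recfun_rec_nat[OF F _ G], rule recfun_pred) (auto intro!: recfun_proj)
  have "rec_nat m (\<lambda>i r. r - 1) n = m - n" for m n :: nat by (induction n) auto
  then show "rec_nat (F xs) (\<lambda>i r. r - 1) (G xs) = F xs - G xs" for xs by simp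
qed

lemma recfun_triangle: "recfun a F \<Longrightarrow> recfun a (\<lambda>xs. triangle (F xs))"
proof (rule recfun_cong)
  assume F: "recfun a F"
  show "recfun a (\<lambda>xs. rec_nat 0 (\<lambda>i r. r + Suc i) (F xs))"
    by (rule recfun_rec_nat[OF recfun_const _ F]) (intro recfun_add recfun_Suc recfun_proj; simp)+
  have "rec_nat 0 (\<lambda>i r. r + Suc i) n = triangle n" for n by (induction n) auto
  then show "rec_nat 0 (\<lambda>i r. r + Suc i) (F xs) = triangle (F xs)" for xs by simp
qed

section \<open>Cantor pairing and its inverses\<close>

definition pfst :: "nat \<Rightarrow> nat" where "pfst n = fst (prod_decode n)"
definition psnd :: "nat \<Rightarrow> nat" where "psnd n = snd (prod_decode n)"
definition pair :: "nat \<Rightarrow> nat \<Rightarrow> nat" where "pair a b = prod_encode (a, b)"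

lemma pfst_pair [simp]: "pfst (pair a b) = a" and psnd_pair [simp]: "psnd (pair a b) = b"
  and pair_pfst_psnd [simp]: "pair (pfst n) (psnd n) = n"
  by (simp_all add: pfst_def psnd_def pair_def)

lemma pair_inject [simp]: "pair a b = pair c d \<longleftrightarrow> a = c \<and> b = d"
  by (simp add: pair_def)

lemma pair_eq: "pair a b = triangle (a + b) + a"
  by (simp add: pair_def prod_encode_def)

lemma triangle_mono: "m \<le> n \<Longrightarrow> triangle m \<le> triangle n"
  by (rule lift_Suc_mono_le) auto

lemma pair_mono: "a \<le> c \<Longrightarrow> b \<le> d \<Longrightarrow> pair a b \<le> pair c d"
  unfolding pair_eq by (intro add_mono triangle_mono) auto

lemma le_pair1: "a \<le> pair a b" and le_pair2: "b \<le> pair a b"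
  by (auto simp: pair_def le_prod_encode_1 le_prod_encode_2)

text \<open>\<open>pair a b\<close> lies on the diagonal \<open>a + b\<close>, which occupies the
  codes from \<open>triangle (a + b)\<close> to just below \<open>triangle (Suc (a + b))\<close>. In
  truncated subtraction the condition says that \<open>n\<close> lies before the end of diagonal
  \<open>s\<close>.\<close>

lemma Least_triangle: "(LEAST s. Suc n - triangle (Suc s) = 0) = pfst n + psnd n"
proof -
  have n: "n = triangle (pfst n + psnd n) + pfst n"
    by (metis pair_eq pair_pfst_psnd)
  show ?thesis
  proof (rule Least_equality)
    show "Suc n - triangle (Suc (pfst n + psnd n)) = 0" by (subst n) simp
  next
    fix s assume "Suc n - triangle (Suc s) = 0"
    then have "n < triangle (Suc s)" by simp
    then show "pfst n + psnd n \<le> s"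
      using n triangle_mono[of "Suc s" "pfst n + psnd n"] by (cases "pfst n + psnd n \<le> s") simp_all
  qed
qed

lemma recfun_unpair:
  shows recfun_pfst: "recfun 1 (\<lambda>xs. pfst (xs ! 0))"
    and recfun_psnd: "recfun 1 (\<lambda>xs. psnd (xs ! 0))"
proof -
  have "recfun (Suc 1) (\<lambda>xs. Suc (xs ! 1) - triangle (Suc (xs ! 0)))"
    by (intro recfun_diff recfun_Suc recfun_triangle recfun_proj) auto
  then have "recfun (Suc 1) (\<lambda>xs. Suc (tl xs ! 0) - triangle (Suc (hd xs)))"
    by (rule recfun_cong) (auto simp: length_Suc_conv)
  then have "recfun 1 (\<lambda>xs. LEAST y. Suc (xs ! 0) - triangle (Suc y) = 0)"
  proof (rule recfun_Least[where G = "\<lambda>y xs. Suc (xs ! 0) - triangle (Suc y)"])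
    fix xs :: "nat list"
    have "m \<le> triangle m" for m by (induction m) auto
    from this[of "Suc (xs ! 0)"] show "\<exists>y. Suc (xs ! 0) - triangle (Suc y) = 0"
      by (intro exI[of _ "xs ! 0"]) simp
  qed
  then have s: "recfun 1 (\<lambda>xs. pfst (xs ! 0) + psnd (xs ! 0))"
    unfolding Least_triangle .
  have "recfun 1 (\<lambda>xs. xs ! 0 - triangle (pfst (xs ! 0) + psnd (xs ! 0)))"
    by (intro recfun_diff recfun_triangle recfun_proj s) auto
  then show f: "recfun 1 (\<lambda>xs. pfst (xs ! 0))"
    by (rule recfun_cong) (metis add_diff_cancel_left' pair_eq pair_pfst_psnd)
  from recfun_diff[OF s f] show "recfun 1 (\<lambda>xs. psnd (xs ! 0))" by simp
qed

section \<open>Computable functions of one number, and decidable predicates\<close>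

definition computable :: "(nat \<Rightarrow> nat) \<Rightarrow> bool" where
  "computable f \<longleftrightarrow> recfun 1 (\<lambda>xs. f (xs ! 0))"

definition decidable :: "(nat \<Rightarrow> bool) \<Rightarrow> bool" where
  "decidable P \<longleftrightarrow> computable (\<lambda>n. if P n then 1 else 0)"

text \<open>A single argument carries the whole environment. Rules for binders describe the body on
  a pair whose first part is the old environment and whose second part holds the bound variables;
  \<open>computable_compose\<close> lifts a parameter into the new environment.\<close>

named_theorems computable

lemma computable_recf: "computable f \<Longrightarrow> \<exists>r. \<forall>n. rf_eval r [n] (f n)"
  unfolding computable_def recfun_def by (metis One_nat_def length_Cons list.size(3) nth_Cons_0)

lemma computable_id [computable]: "computable (\<lambda>n. n)"
  unfolding computable_def by (rule recfun_proj) simp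

lemma computable_const [computable]: "computable (\<lambda>n. c)"
  unfolding computable_def by (rule recfun_const)

lemma computable_compose: "computable f \<Longrightarrow> computable g \<Longrightarrow> computable (\<lambda>n. f (g n))"
  unfolding computable_def using recfun_comp1[of "\<lambda>xs. f (xs ! 0)" 1 "\<lambda>xs. g (xs ! 0)"] by simp

lemma computable_Suc [computable]: "computable f \<Longrightarrow> computable (\<lambda>n. Suc (f n))"
  unfolding computable_def by (rule recfun_Suc)

lemma computable_add [computable]: "computable f \<Longrightarrow> computable g \<Longrightarrow> computable (\<lambda>n. f n + g n)"
  unfolding computable_def by (rule recfun_add)

lemma computable_diff [computable]: "computable f \<Longrightarrow> computable g \<Longrightarrow> computable (\<lambda>n. f n - g n)"
  unfolding computable_def by (rule recfun_diff)

lemma computable_pair [computable]: "computable f \<Longrightarrow> computable g \<Longrightarrow> computable (\<lambda>n. pair (f n) (g n))"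
  unfolding computable_def pair_eq by (intro recfun_add recfun_triangle)

lemma computable_pfst [computable]: "computable f \<Longrightarrow> computable (\<lambda>n. pfst (f n))"
  by (rule computable_compose[of pfst]) (use recfun_pfst in \<open>simp add: computable_def\<close>)

lemma computable_psnd [computable]: "computable f \<Longrightarrow> computable (\<lambda>n. psnd (f n))"
  by (rule computable_compose[of psnd]) (use recfun_psnd in \<open>simp add: computable_def\<close>)

lemma computable_rec_nat [computable]:
  assumes a: "computable a" and s: "computable (\<lambda>n. s (pfst n) (pfst (psnd n)) (psnd (psnd n)))"
    and m: "computable m"
  shows "computable (\<lambda>n. rec_nat (a n) (s n) (m n))"
proof -
  have "recfun 3 (\<lambda>xs. pair (xs ! 2) (pair (xs ! 0) (xs ! 1)))"
    unfolding pair_eq by (intro recfun_add recfun_triangle recfun_proj) auto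
  from recfun_comp1[OF s[unfolded computable_def] this]
  have "recfun (Suc (Suc 1)) (\<lambda>xs. s (tl (tl xs) ! 0) (xs ! 0) (xs ! 1))"
    by (simp only: numeral_3_eq_3 One_nat_def, elim recfun_cong) (auto simp: length_Suc_conv numeral_2_eq_2)
  from recfun_rec_nat[where G = "\<lambda>i r xs. s (xs ! 0) i r", OF a[unfolded computable_def] this m[unfolded computable_def]]
  show ?thesis unfolding computable_def by simp
qed

lemma computable_mult [computable]:
  assumes "computable f" "computable g" shows "computable (\<lambda>n. f n * g n)"
proof -
  have "rec_nat 0 (\<lambda>i r. r + m) n = m * n" for m n :: nat by (induction n) auto
  moreover have "computable (\<lambda>n. rec_nat 0 (\<lambda>i r. r + f n) (g n))"
    by (intro computable assms computable_compose[OF assms(1)])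
  ultimately show ?thesis by simp
qed

lemma computable_power [computable]:
  assumes "computable f" "computable g" shows "computable (\<lambda>n. f n ^ g n)"
proof -
  have "rec_nat 1 (\<lambda>i r. r * m) n = m ^ n" for m n :: nat by (induction n) auto
  moreover have "computable (\<lambda>n. rec_nat 1 (\<lambda>i r. r * f n) (g n))"
    by (intro computable assms computable_compose[OF assms(1)])
  ultimately show ?thesis by simp
qed

lemma decidable_compose: "decidable P \<Longrightarrow> computable g \<Longrightarrow> decidable (\<lambda>n. P (g n))"
  unfolding decidable_def by (rule computable_compose)

lemma computable_if [computable]:
  assumes P: "decidable P" and fg: "computable f" "computable g"
  shows "computable (\<lambda>n. if P n then f n else g n)"
proof -
  have "computable (\<lambda>n. (if P n then 1 else 0) * f n + (1 - (if P n then 1 else 0)) * g n)"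
    by (intro computable P[unfolded decidable_def] fg)
  then show ?thesis by (rule back_subst[of computable]) auto
qed

lemma decidable_not [computable]: assumes "decidable P" shows "decidable (\<lambda>n. \<not> P n)"
proof -
  have "computable (\<lambda>n. if P n then 0 else 1)"
    by (intro computable assms)
  then show ?thesis unfolding decidable_def by (rule back_subst[of computable]) auto
qed

lemma decidable_conj [computable]:
  assumes "decidable P" "decidable Q" shows "decidable (\<lambda>n. P n \<and> Q n)"
proof -
  have "computable (\<lambda>n. if P n then (if Q n then 1 else 0) else 0)"
    by (intro computable assms)
  then show ?thesis unfolding decidable_def by (rule back_subst[of computable]) auto
qed

lemma decidable_disj [computable]:
  assumes "decidable P" "decidable Q" shows "decidable (\<lambda>n. P n \<or> Q n)"
  using decidable_not[OF decidable_conj[OF assms[THEN decidable_not]]] by simp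

lemma decidable_imp [computable]:
  assumes "decidable P" "decidable Q" shows "decidable (\<lambda>n. P n \<longrightarrow> Q n)"
  using decidable_disj[OF decidable_not[OF assms(1)] assms(2)] by simp

lemma decidable_le [computable]:
  assumes "computable f" "computable g" shows "decidable (\<lambda>n. f n \<le> g n)"
proof -
  have "computable (\<lambda>n. 1 - (f n - g n))"
    by (intro computable assms)
  then show ?thesis unfolding decidable_def by (rule back_subst[of computable]) auto
qed

lemma decidable_less [computable]:
  "computable f \<Longrightarrow> computable g \<Longrightarrow> decidable (\<lambda>n. f n < g n)"
  unfolding Suc_le_eq[symmetric] by (intro computable)

lemma decidable_eq [computable]:
  assumes "computable f" "computable g" shows "decidable (\<lambda>n. f n = g n)"
proof -
  have "decidable (\<lambda>n. f n \<le> g n \<and> g n \<le> f n)"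
    by (intro computable assms)
  then show ?thesis by (rule back_subst[of decidable]) auto
qed

lemma decidable_ex_less [computable]:
  assumes "computable g" "decidable (\<lambda>n. P (pfst n) (psnd n))"
  shows "decidable (\<lambda>n. \<exists>m<g n. P n m)"
proof -
  have "decidable (\<lambda>n. P (pfst (pair (pfst n) (pfst (psnd n)))) (psnd (pair (pfst n) (pfst (psnd n)))))"
    by (rule decidable_compose[OF assms(2)]) (intro computable)
  then have "computable (\<lambda>n. rec_nat 0 (\<lambda>i r. if P n i then 1 else r) (g n))"
    by (intro computable assms(1)) simp
  moreover have "rec_nat 0 (\<lambda>i r. if Q i then 1 else r) n = (if \<exists>m<n. Q m then 1 else 0 :: nat)" for Q n
    by (induction n) (auto simp: less_Suc_eq)
  ultimately show ?thesis unfolding decidable_def by (simp cong: if_cong)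
qed

section \<open>Lists as codes, and bounded search over lists\<close>

definition computable_list :: "(nat \<Rightarrow> nat list) \<Rightarrow> bool" where
  "computable_list f \<longleftrightarrow> computable (\<lambda>n. list_encode (f n))"

lemma computable_list_encode [computable]: "computable_list f \<Longrightarrow> computable (\<lambda>n. list_encode (f n))"
  by (simp add: computable_list_def)

lemma computable_list_decode [computable]: "computable f \<Longrightarrow> computable_list (\<lambda>n. list_decode (f n))"
  by (simp add: computable_list_def)

lemma computable_list_compose: "computable_list f \<Longrightarrow> computable g \<Longrightarrow> computable_list (\<lambda>n. f (g n))"
  unfolding computable_list_def by (rule computable_compose)

lemma list_encode_Cons: "list_encode (x # xs) = Suc (pair x (list_encode xs))"
  by (simp add: pair_def)

declare list_encode.simps(2) [simp del]

lemma computable_list_const [computable]: "computable_list (\<lambda>n. c)"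
  unfolding computable_list_def by (rule computable_const)

lemma computable_list_Cons [computable]:
  "computable f \<Longrightarrow> computable_list g \<Longrightarrow> computable_list (\<lambda>n. f n # g n)"
  unfolding computable_list_def list_encode_Cons by (intro computable_Suc computable_pair)

lemma length_le_list_encode: "length xs \<le> list_encode xs"
proof (induction xs)
  case (Cons x xs)
  then show ?case using le_pair2[of "list_encode xs" x] by (simp add: list_encode_Cons)
qed simp

lemma le_list_encode: "x \<in> set xs \<Longrightarrow> x \<le> list_encode xs"
proof (induction xs)
  case (Cons y xs)
  then show ?case
    using le_pair1[of y "list_encode xs"] le_pair2[of "list_encode xs" y]
    by (auto simp: list_encode_Cons)
qed simp

text \<open>The fold is an iteration on codes of pairs (remaining list, accumulator).  Since the code of a
  list bounds its length, the iteration count may be the code itself.\<close>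

lemma computable_fold [computable]:
  assumes s: "computable (\<lambda>n. f (pfst n) (pfst (psnd n)) (psnd (psnd n)))"
    and l: "computable_list l" and b: "computable b"
  shows "computable (\<lambda>n. fold (f n) (l n) (b n))"
proof -
  define st where "st n c = (if pfst c = 0 then c else
      pair (psnd (pfst c - 1)) (f n (pfst (pfst c - 1)) (psnd c)))" for n c
  have step: "st n (pair (list_encode xs) r) =
      (case xs of [] \<Rightarrow> pair (list_encode xs) r | y # ys \<Rightarrow> pair (list_encode ys) (f n y r))" for n xs r
    by (cases xs) (auto simp: st_def list_encode_Cons)
  have "psnd (rec_nat (pair (list_encode xs) r) (\<lambda>_. st n) m) = fold (f n) xs r"
    if "length xs \<le> m" for n xs r m
  proof -
    have comm: "rec_nat (st n c) (\<lambda>_. st n) m = st n (rec_nat c (\<lambda>_. st n) m)" for c m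
      by (induction m) auto
    from that show ?thesis
    proof (induction m arbitrary: xs r)
      case (Suc m)
      show ?case
      proof (cases xs)
        case Nil
        then show ?thesis using Suc.IH[of "[]" r] step[of n "[]" r] by (simp add: comm[symmetric])
      next
        case (Cons y ys)
        then show ?thesis using Suc by (simp add: comm[symmetric] step)
      qed
    qed simp
  qed
  note this[OF length_le_list_encode]
  moreover have "computable (\<lambda>n. psnd (rec_nat (pair (list_encode (l n)) (b n)) (\<lambda>_. st n) (list_encode (l n))))"
  proof (intro computable l b)
    have "computable (\<lambda>n. f (pfst n) (pfst (pfst (psnd (psnd n)) - 1)) (psnd (psnd (psnd n))))"
      using computable_compose[OF s, of "\<lambda>n. pair (pfst n) (pair (pfst (pfst (psnd (psnd n)) - 1)) (psnd (psnd (psnd n))))"]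
      by (simp add: computable)
    then show "computable (\<lambda>n. st (pfst n) (psnd (psnd n)))"
      unfolding st_def by (intro computable)
  qed
  ultimately show ?thesis by simp
qed

lemma computable_list_fold [computable]:
  assumes s: "computable_list (\<lambda>n. f (pfst n) (pfst (psnd n)) (list_decode (psnd (psnd n))))"
    and l: "computable_list l" and b: "computable_list b"
  shows "computable_list (\<lambda>n. fold (f n) (l n) (b n))"
proof -
  have "fold (\<lambda>x c. list_encode (f n x (list_decode c))) xs (list_encode ys) = list_encode (fold (f n) xs ys)" for n xs ys
    by (induction xs arbitrary: ys) auto
  moreover have "computable (\<lambda>n. fold (\<lambda>x c. list_encode (f n x (list_decode c))) (l n) (list_encode (b n)))"
    by (intro computable l b s)
  ultimately show ?thesis by (simp add: computable_list_def)
qed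

lemma computable_list_rev [computable]: 
  assumes "computable_list l" shows "computable_list (\<lambda>n. rev (l n))"
proof -
  have "computable_list (\<lambda>n. fold (\<lambda>x r. x # r) (l n) [])"
    by (intro computable assms)
  then show ?thesis by (simp add: fold_Cons_rev)
qed

lemma computable_list_append [computable]:
  assumes "computable_list l" "computable_list g" shows "computable_list (\<lambda>n. l n @ g n)"
proof -
  have "computable_list (\<lambda>n. fold (\<lambda>x r. x # r) (rev (l n)) (g n))"
    by (intro computable assms)
  then show ?thesis by (simp add: fold_Cons_rev)
qed

lemma computable_list_map [computable]:
  assumes "computable_list l" and f: "computable (\<lambda>n. f (pfst n) (psnd n))"
  shows "computable_list (\<lambda>n. map (f n) (l n))"
proof -
  have "computable_list (\<lambda>n. fold (\<lambda>x r. f n x # r) (rev (l n)) [])"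
    using computable_compose[OF f, of "\<lambda>n. pair (pfst n) (pfst (psnd n))"]
    by (intro computable assms) (simp add: computable)
  moreover have "fold (\<lambda>x r. g x # r) xs ys = rev (map g xs) @ ys" for g :: "nat \<Rightarrow> nat" and xs ys
    by (induction xs arbitrary: ys) auto
  ultimately show ?thesis by (simp add: rev_map)
qed

lemma computable_list_filter [computable]:
  assumes "computable_list l" and f: "decidable (\<lambda>n. P (pfst n) (psnd n))"
  shows "computable_list (\<lambda>n. filter (P n) (l n))"
proof -
  have "decidable (\<lambda>n. P (pfst n) (pfst (psnd n)))"
    using decidable_compose[OF f, of "\<lambda>n. pair (pfst n) (pfst (psnd n))"] by (simp add: computable)
  \<comment> \<open>Conditionals are known to be computable for numbers only, so both branches are
    encoded and the result is decoded.\<close>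
  then have "computable_list (\<lambda>n. fold (\<lambda>x r. list_decode (if P n x then list_encode (x # r) else list_encode r)) (rev (l n)) [])"
    by (intro computable assms)
  moreover have "fold (\<lambda>x r. list_decode (if Q x then list_encode (x # r) else list_encode r)) xs ys = rev (filter Q xs) @ ys" for Q xs ys
    by (induction xs arbitrary: ys) auto
  ultimately show ?thesis by (simp add: rev_filter)
qed

lemma computable_length [computable]:
  assumes "computable_list l" shows "computable (\<lambda>n. length (l n))"
proof -
  have "computable (\<lambda>n. fold (\<lambda>x r. Suc r) (l n) 0)"
    by (intro computable assms)
  moreover have "fold (\<lambda>x. Suc) xs r = length xs + r" for xs :: "nat list" and r
    by (induction xs arbitrary: r) auto
  ultimately show ?thesis by simp
qed

lemma decidable_ex_set [computable]:
  assumes "computable_list l" and f: "decidable (\<lambda>n. P (pfst n) (psnd n))"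
  shows "decidable (\<lambda>n. \<exists>x\<in>set (l n). P n x)"
proof -
  have "decidable (\<lambda>n. 0 < length (filter (P n) (l n)))"
    by (intro computable assms)
  then show ?thesis by (simp add: filter_empty_conv)
qed

lemma decidable_ball_set [computable]:
  assumes "computable_list l" and f: "decidable (\<lambda>n. P (pfst n) (psnd n))"
  shows "decidable (\<lambda>n. \<forall>x\<in>set (l n). P n x)"
  using decidable_not[OF decidable_ex_set[OF assms(1) decidable_not[OF assms(2)]]] by simp

lemma decidable_mem [computable]:
  assumes "computable f" "computable_list l" shows "decidable (\<lambda>n. f n \<in> set (l n))"
proof -
  have "decidable (\<lambda>n. \<exists>x\<in>set (l n). x = f n)"
    by (intro computable assms computable_compose[OF assms(1)])
  then show ?thesis by simp
qed

lemma decidable_list_eq [computable]: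
  assumes "computable_list l" "computable_list m" shows "decidable (\<lambda>n. l n = m n)"
proof -
  have "decidable (\<lambda>n. list_encode (l n) = list_encode (m n))"
    by (intro computable assms)
  then show ?thesis by (simp add: list_encode_eq)
qed

lemma decidable_all_less [computable]:
  assumes "computable g" "decidable (\<lambda>n. P (pfst n) (psnd n))"
  shows "decidable (\<lambda>n. \<forall>m<g n. P n m)"
  using decidable_not[OF decidable_ex_less[OF assms(1) decidable_not[OF assms(2)]]] by simp

text \<open>This is the code of \<open>replicate b m\<close>. Since \<open>pair\<close> is monotone,
  no list of at most \<open>b\<close> entries, each at most \<open>m\<close>, has a larger
  code.\<close>

definition list_bound :: "nat \<Rightarrow> nat \<Rightarrow> nat" where
  "list_bound b m = rec_nat 0 (\<lambda>_ r. Suc (pair m r)) b"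

lemma list_encode_le_bound:
  "length xs \<le> b \<Longrightarrow> set xs \<subseteq> {..m} \<Longrightarrow> list_encode xs \<le> list_bound b m"
proof (induction xs arbitrary: b)
  case (Cons x xs)
  then obtain b' where "b = Suc b'" by (cases b) auto
  with Cons show ?case
    by (auto simp: list_bound_def list_encode_Cons intro!: pair_mono)
qed simp

lemma computable_list_bound [computable]:
  assumes "computable f" "computable g" shows "computable (\<lambda>n. list_bound (f n) (g n))"
  unfolding list_bound_def by (intro computable assms computable_compose[OF assms(2)])

text \<open>The search principle of the decision procedure. The quantifiers over words in
  \<open>in_rel\<close>, \<open>in_dom\<close>, \<open>code_legal\<close>,
  \<open>code_continues\<close> and \<open>decide\<close> are written with the two bounds in front
  and the rest in parentheses so as to match it.\<close>

lemma decidable_ex_list [computable]: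
  assumes b: "computable b" and m: "computable m"
    and P: "decidable (\<lambda>n. P (pfst n) (list_decode (psnd n)))"
  shows "decidable (\<lambda>n. \<exists>xs. length xs \<le> b n \<and> set xs \<subseteq> {..m n} \<and> P n xs)"
proof -
  have "decidable (\<lambda>n. \<exists>c<Suc (list_bound (b n) (m n)). length (list_decode c) \<le> b n \<and>
      (\<forall>x\<in>set (list_decode c). x \<le> m n) \<and> P n (list_decode c))"
    by (intro computable b m P computable_compose[OF b] computable_compose[OF m])
  moreover have "(\<exists>c<Suc (list_bound (b n) (m n)). length (list_decode c) \<le> b n \<and>
      (\<forall>x\<in>set (list_decode c). x \<le> m n) \<and> P n (list_decode c)) \<longleftrightarrow>
      (\<exists>xs. length xs \<le> b n \<and> set xs \<subseteq> {..m n} \<and> P n xs)" for n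
  proof
    assume "\<exists>xs. length xs \<le> b n \<and> set xs \<subseteq> {..m n} \<and> P n xs"
    then obtain xs where "length xs \<le> b n" "set xs \<subseteq> {..m n}" "P n xs" by blast
    then show "\<exists>c<Suc (list_bound (b n) (m n)). length (list_decode c) \<le> b n \<and>
      (\<forall>x\<in>set (list_decode c). x \<le> m n) \<and> P n (list_decode c)"
      using list_encode_le_bound[of xs "b n" "m n"] by (intro exI[of _ "list_encode xs"]) auto
  qed auto
  ultimately show ?thesis by simp
qed

section \<open>Runs, projections and shifts\<close>

text \<open>Indexing the projection by the tape lets an argument that is symmetric in input and
  output be given once, for a variable tape.\<close>

definition pr :: "nat \<Rightarrow> (nat \<times> nat) list \<Rightarrow> nat list" where
  "pr d w = map snd (filter (\<lambda>x. fst x = d) w)"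

lemma pr_simps [simp]: "pr d [] = []" "pr d (u @ v) = pr d u @ pr d v"
  "pr d (x # w) = (if fst x = d then snd x # pr d w else pr d w)"
  by (auto simp: pr_def)

lemma sem_pr: "sem w = (pr 1 w, pr 2 w)"
  by (simp add: sem_def pi_i_def pi_o_def pr_def)

lemma pr_map_Pair [simp]: "pr d (map (Pair d) z) = z"
  by (induction z) auto

lemma pr_map_Pair_other: "d \<noteq> e \<Longrightarrow> pr d (map (Pair e) z) = []"
  by (induction z) auto

lemma count_list_fst: "count_list (map fst w) d = length (pr d w)"
  by (induction w) auto

lemma nfa_reach_append:
  "nfa_reach A p (u @ v) q \<longleftrightarrow> (\<exists>r. nfa_reach A p u r \<and> nfa_reach A r v q)"
  by (induction u arbitrary: p) auto

lemma nfa_reach_states: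
  "nfa_reach A p w q \<Longrightarrow> \<exists>st. st 0 = p \<and> st (length w) = q \<and>
     (\<forall>n<length w. (st n, w ! n, st (Suc n)) \<in> set (fst A))"
proof (induction w arbitrary: p)
  case (Cons a w)
  then obtain p' st where "(p, a, p') \<in> set (fst A)" "st 0 = p'" "st (length w) = q"
    "\<forall>n<length w. (st n, w ! n, st (Suc n)) \<in> set (fst A)" by fastforce
  then show ?case
    by (intro exI[of _ "\<lambda>n. case n of 0 \<Rightarrow> p | Suc m \<Rightarrow> st m"])
      (auto simp: nth_Cons split: nat.split)
qed auto

lemma nfa_reach_segment:
  assumes "\<forall>n<length w. (st n, w ! n, st (Suc n)) \<in> set (fst A)" "i \<le> j" "j \<le> length w"
  shows "nfa_reach A (st i) (take (j - i) (drop i w)) (st j)"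
proof -
  have "nfa_reach A (st i) (take n (drop i w)) (st (i + n))" if "i + n \<le> length w" for n
    using that
  proof (induction n)
    case (Suc n)
    then have "take (Suc n) (drop i w) = take n (drop i w) @ [w ! (i + n)]"
      by (simp add: take_Suc_conv_app_nth)
    with Suc show ?case using assms(1) by (auto simp: nfa_reach_append)
  qed simp
  from this[of "j - i"] assms show ?thesis by simp
qed

lemma nfa_reach_power: "nfa_reach A p w p \<Longrightarrow> nfa_reach A p (concat (replicate n w)) p"
  by (induction n) (auto simp: nfa_reach_append)

text \<open>The names of the states are bounded rather than their number, because a bound on the
  names can be read off from the code of the automaton.\<close>

definition states_below :: "nat \<Rightarrow> nfa \<Rightarrow> bool" where
  "states_below N A \<longleftrightarrow> (\<forall>(p, a, q)\<in>set (fst A). p < N \<and> q < N) \<and> (\<forall>p\<in>set (fst (snd A)). p < N)"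

lemma states_below_run:
  assumes "states_below N A" "st 0 < N"
    "\<forall>n<length w. (st n, w ! n, st (Suc n)) \<in> set (fst A)" "n \<le> length w"
  shows "st n < N"
proof (cases n)
  case (Suc m)
  then have "(st m, w ! m, st n) \<in> set (fst A)" using assms(3,4) by auto
  then show ?thesis using assms(1) by (auto simp: states_below_def)
qed (use assms(2) in simp)

lemma states_below_reach:
  assumes "states_below N A" "p < N" "nfa_reach A p w q" shows "q < N"
  using nfa_reach_states[OF assms(3)] states_below_run[OF assms(1), of _ w "length w"] assms(2) by auto

text \<open>Discrete intermediate values: \<open>f\<close> may fall by any amount, but it rises by
  at most one and therefore cannot jump over \<open>c\<close>.\<close>

lemma nat_ivt:
  fixes f :: "nat \<Rightarrow> nat"
  assumes "f 0 = 0" "\<And>n. n < m \<Longrightarrow> f (Suc n) \<le> Suc (f n)" "c \<le> f m"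
  shows "\<exists>n\<le>m. f n = c"
  using assms
proof (induction m)
  case (Suc m)
  then show ?case by (cases "c \<le> f m") (fastforce simp: le_Suc_eq)+
qed auto

text \<open>A quantity that starts at 0 and grows by at most one per letter takes \<open>N + 1\<close> multiples of \<open>c\<close> as
  values, hence two of them in the same state.\<close>

lemma run_loop:
  fixes f :: "nat \<Rightarrow> nat"
  assumes A: "states_below N A" "p < N" "nfa_reach A p w q"
    and f: "f 0 = 0" "\<And>n. n < length w \<Longrightarrow> f (Suc n) \<le> Suc (f n)" "c * N \<le> f (length w)"
    and c: "0 < c"
  obtains a b s where "a < b" "b \<le> length w" "nfa_reach A p (take a w) s"
    "nfa_reach A s (take (b - a) (drop a w)) s" "nfa_reach A s (drop b w) q"
    "f a + c \<le> f b \<or> f b + c \<le> f a"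
proof -
  note result = that
  obtain st where st: "st 0 = p" "st (length w) = q"
    "\<forall>n<length w. (st n, w ! n, st (Suc n)) \<in> set (fst A)"
    using nfa_reach_states[OF A(3)] by blast
  have "\<exists>n\<le>length w. f n = c * i" if "i \<le> N" for i
  proof (rule nat_ivt[OF f(1,2)])
    show "c * i \<le> f (length w)" using that f(3) by (meson le_trans mult_le_mono2)
  qed
  then have "\<forall>i. \<exists>n. i \<le> N \<longrightarrow> n \<le> length w \<and> f n = c * i" by blast
  from choice[OF this] obtain g where g: "\<And>i. i \<le> N \<Longrightarrow> g i \<le> length w \<and> f (g i) = c * i" by blast
  have "\<not> inj_on (\<lambda>i. st (g i)) {..N}"
  proof
    assume "inj_on (\<lambda>i. st (g i)) {..N}"
    moreover have "st (g i) < N" if "i \<le> N" for i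
      by (rule states_below_run[OF A(1) _ st(3)]) (use st(1) A(2) g[OF that] in simp_all)
    then have "(\<lambda>i. st (g i)) ` {..N} \<subseteq> {..<N}" by blast
    ultimately have "card {..N} \<le> card {..<N}" by (rule card_inj_on_le) auto
    then show False by simp
  qed
  then obtain i j where ij: "i \<le> N" "j \<le> N" "i \<noteq> j" "st (g i) = st (g j)"
    unfolding inj_on_def atMost_iff by blast
  have seg: thesis if "i \<le> N" "j \<le> N" "i \<noteq> j" "st (g i) = st (g j)" "g i < g j" for i j
  proof (rule result)
    show "g i < g j" by fact
    show "g j \<le> length w" using g[OF that(2)] by simp
    show "nfa_reach A p (take (g i) w) (st (g i))"
      using nfa_reach_segment[OF st(3), of 0 "g i"] g[OF that(1)] st(1) by simp
    show "nfa_reach A (st (g i)) (take (g j - g i) (drop (g i) w)) (st (g i))"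
      using nfa_reach_segment[OF st(3), of "g i" "g j"] g[OF that(2)] that(4,5) by simp
    show "nfa_reach A (st (g i)) (drop (g j) w) q"
      using nfa_reach_segment[OF st(3), of "g j" "length w"] g[OF that(2)] that(4) st(2) by simp
    \<comment> \<open>The positions are ordered by \<open>g\<close>, the values by the indices; the
      two orders need not agree, whence the disjunction.\<close>
    have "Suc i \<le> j \<or> Suc j \<le> i" using that by auto
    then have "c * Suc i \<le> c * j \<or> c * Suc j \<le> c * i" using mult_le_mono2 by blast
    then show "f (g i) + c \<le> f (g j) \<or> f (g j) + c \<le> f (g i)"
      using g[OF that(1)] g[OF that(2)] by (simp add: add.commute)
  qed
  have "g i \<noteq> g j" using g[OF ij(1)] g[OF ij(2)] ij(3) c by auto
  then consider "g i < g j" | "g j < g i" by linarith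
  then show thesis using seg[OF ij] seg[OF ij(2,1) ij(3)[symmetric] ij(4)[symmetric]] by cases
qed

section \<open>Counting shifts\<close>

fun shifts :: "nat list \<Rightarrow> nat list" where
  "shifts (a # b # l) = (if a \<noteq> b then [1] else []) @ map Suc (shifts (b # l))"
| "shifts _ = []"

definition chg :: "nat list \<Rightarrow> nat" where "chg l = length (shifts l)"

lemma chg_simps [simp]: "chg [] = 0" "chg [a] = 0"
  "chg (a # b # l) = (if a \<noteq> b then Suc (chg (b # l)) else chg (b # l))"
  by (auto simp: chg_def)

lemma chg_Cons: "chg (a # l) = (if l = [] \<or> hd l = a then chg l else Suc (chg l))"
  by (cases l) auto

lemma chg_append: "chg (u @ v) =
    chg u + chg v + (if u \<noteq> [] \<and> v \<noteq> [] \<and> last u \<noteq> hd v then 1 else 0)"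
  by (induction u) (auto simp: chg_Cons)

lemma set_shifts: "set (shifts l) = {i. is_shift l i}"
proof (induction l rule: shifts.induct)
  case (1 a b l)
  have "is_shift (a # b # l) i \<longleftrightarrow> (i = 1 \<and> a \<noteq> b) \<or> (\<exists>j. i = Suc j \<and> is_shift (b # l) j)" for i
    by (cases i; cases "i - 1") (auto simp: is_shift_def)
  then show ?case using 1 by auto
qed (auto simp: is_shift_def)

lemma sorted_shifts: "sorted_wrt (<) (shifts l)"
proof (induction l rule: shifts.induct)
  case (1 a b l)
  have "0 \<notin> set (shifts (b # l))" by (simp add: set_shifts is_shift_def)
  then have "\<forall>x\<in>set (shifts (b # l)). 0 < x" by (metis gr0I)
  then show ?case using 1 by (auto simp: sorted_wrt_append sorted_wrt_map)
qed auto

lemma is_shift_append: "0 < i \<Longrightarrow> is_shift (u @ v) (length u + i) \<longleftrightarrow> is_shift v i"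
  by (cases i) (auto simp: is_shift_def nth_append)

text \<open>Consecutive shifts increase strictly, so the shift with index \<open>j\<close> exceeds
  \<open>j\<close>. This supplies the bound without which the \<open>GREATEST\<close> in
  \<open>shiftlag\<close> would say nothing.\<close>

lemma has_shiftlag_le: "has_shiftlag u n \<Longrightarrow> n \<le> length u"
proof -
  assume "has_shiftlag u n"
  then obtain js where js: "length js = n" "\<forall>i\<in>set js. is_shift u i"
    "\<forall>j. j + 1 < n \<longrightarrow> consecutive_shifts u (js ! j) (js ! (j + 1))"
    unfolding has_shiftlag_def by blast
  have "j < js ! j" if "j < n" for j
    using that
  proof (induction j)
    case 0
    then have "is_shift u (js ! 0)" using js(1,2) by auto
    then show ?case by (auto simp: is_shift_def)
  next
    case (Suc j)
    then show ?case using js(3)[rule_format, of j] by (auto simp: consecutive_shifts_def)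
  qed
  then show ?thesis
  proof (cases n)
    case (Suc m)
    then have "m < js ! m" "is_shift u (js ! m)" using \<open>\<And>j. j < n \<Longrightarrow> j < js ! j\<close> js(1,2) by auto
    then show ?thesis using Suc by (auto simp: is_shift_def)
  qed simp
qed

text \<open>The witness consists of the first \<open>n\<close> shifts of \<open>v\<close>, moved by
  \<open>length u\<close>. As \<open>shifts v\<close> is a sorted list of all shifts of
  \<open>v\<close>, neighbours in it are consecutive shifts.\<close>

lemma has_shiftlag_append:
  assumes "n \<le> chg v" "\<And>i. length u \<le> i \<Longrightarrow> i \<le> length (u @ v) \<Longrightarrow> n < lag (u @ v) i"
  shows "has_shiftlag (u @ v) n"
proof -
  define js where "js = take n (shifts v)"
  have len: "length js = n" using assms(1) by (simp add: js_def chg_def)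
  have sub: "set js \<subseteq> set (shifts v)" by (simp add: js_def set_take_subset)
  have shift: "is_shift (u @ v) (length u + i)" if "i \<in> set (shifts v)" for i
    using that by (subst is_shift_append) (auto simp: set_shifts is_shift_def)
  have cons: "consecutive_shifts (u @ v) (length u + js ! j) (length u + js ! Suc j)" if "Suc j < n" for j
  proof -
    have nth: "js ! j = shifts v ! j" "js ! Suc j = shifts v ! Suc j" "Suc j < length (shifts v)"
      using that len by (auto simp: js_def)
    have False if l: "length u + js ! j < l" "l < length u + js ! Suc j" "is_shift (u @ v) l" for l
    proof -
      define i where "i = l - length u"
      then have i: "l = length u + i" "0 < i" using l(1) by simp_all
      then have "i \<in> set (shifts v)" using l(3) by (simp add: is_shift_append set_shifts)
      then obtain m where m: "m < length (shifts v)" "i = shifts v ! m" by (auto simp: in_set_conv_nth)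
      have "\<not> m \<le> j"
        using sorted_wrt_nth_less[OF sorted_shifts, of m j v] nth l(1) i m by (cases "m = j") auto
      moreover have "\<not> Suc j \<le> m"
        using sorted_wrt_nth_less[OF sorted_shifts, of "Suc j" m v] nth l(2) i m by (cases "m = Suc j") auto
      ultimately show False by simp
    qed
    moreover have "js ! j < js ! Suc j"
      using sorted_wrt_nth_less[OF sorted_shifts, of j "Suc j" v] nth by simp
    moreover have "js ! j \<in> set (shifts v)" "js ! Suc j \<in> set (shifts v)" using nth by auto
    ultimately show ?thesis using shift unfolding consecutive_shifts_def by auto
  qed
  show ?thesis
    unfolding has_shiftlag_def
  proof (intro exI[of _ "map ((+) (length u)) js"] conjI ballI allI impI)
    fix i assume "i \<in> set (map ((+) (length u)) js)"
    then obtain j where j: "i = length u + j" "j \<in> set (shifts v)" using sub by auto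
    then show "is_shift (u @ v) i" using shift by simp
    then show "n < lag (u @ v) i" using j by (intro assms(2)) (auto simp: is_shift_def)
  qed (use len cons in auto)
qed

section \<open>The signed lag, additive under concatenation and hence suited to pumping\<close>

definition balance :: "(nat \<times> nat) list \<Rightarrow> int" where
  "balance w = int (length (pr 1 w)) - int (length (pr 2 w))"

lemma balance_simps [simp]: "balance [] = 0" "balance (u @ v) = balance u + balance v"
  "balance [x] = (if fst x = 1 then 1 else if fst x = 2 then -1 else 0)"
  by (auto simp: balance_def)

lemma balance_power: "balance (concat (replicate n w)) = int n * balance w"
  by (induction n) (auto simp: algebra_simps)

lemma abs_balance_le: "\<bar>balance w\<bar> \<le> int (length w)"
  by (induction w) (auto simp: balance_def)

lemma lag_balance: "lag (map fst w) i = nat \<bar>balance (take i w)\<bar>"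
  by (simp add: lag_def take_map count_list_fst balance_def)

lemma chg_power: "chg (map fst w) \<ge> 1 \<Longrightarrow> n \<le> chg (map fst (concat (replicate n w)))"
  by (induction n) (auto simp: chg_append)

text \<open>Otherwise a loop with nonzero balance makes the lag as large as we please, after which a loop containing
  a shift produces as many shifts as we please.\<close>

lemma shift_bound:
  assumes A: "states_below N A" and fin: "shiftlag_lang (nfa_lang k A) < \<infinity>"
    and uv: "u @ v \<in> nfa_lang k A" and lag: "int N \<le> \<bar>balance u\<bar>"
  shows "chg (map fst v) \<le> 2 * N"
proof (rule ccontr)
  assume "\<not> chg (map fst v) \<le> 2 * N"
  then have chg: "2 * N \<le> chg (map fst v)" by simp
  obtain p q r where run: "p \<in> set (fst (snd A))" "q \<in> set (snd (snd A))"
    "nfa_reach A p u r" "nfa_reach A r v q"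
    using uv by (auto simp: nfa_lang_def nfa_reach_append)
  have p: "p < N" using A run(1) by (auto simp: states_below_def)
  have r: "r < N" using states_below_reach[OF A p run(3)] .
  have step_u: "nat \<bar>balance (take (Suc n) u)\<bar> \<le> Suc (nat \<bar>balance (take n u)\<bar>)" if "n < length u" for n
    using that by (simp add: take_Suc_conv_app_nth) arith
  have step_v: "chg (map fst (take (Suc n) v)) \<le> Suc (chg (map fst (take n v)))" if "n < length v" for n
    using that by (simp add: take_Suc_conv_app_nth chg_append)
  obtain a b s where ab: "a < b" "b \<le> length u" "nfa_reach A p (take a u) s"
    "nfa_reach A s (take (b - a) (drop a u)) s" "nfa_reach A s (drop b u) r"
    "nat \<bar>balance (take a u)\<bar> + 1 \<le> nat \<bar>balance (take b u)\<bar> \<or> nat \<bar>balance (take b u)\<bar> + 1 \<le> nat \<bar>balance (take a u)\<bar>"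
    by (rule run_loop[OF A p run(3), of "\<lambda>n. nat \<bar>balance (take n u)\<bar>" 1]) (use step_u lag in auto)
  \<comment> \<open>Two additional shifts are asked for because one may sit on the border in front
    of the loop; at least one is then left inside it. This is the factor in
    \<open>2 * N\<close>.\<close>
  obtain c d t where cd: "c < d" "d \<le> length v" "nfa_reach A r (take c v) t"
    "nfa_reach A t (take (d - c) (drop c v)) t" "nfa_reach A t (drop d v) q"
    "chg (map fst (take c v)) + 2 \<le> chg (map fst (take d v)) \<or> chg (map fst (take d v)) + 2 \<le> chg (map fst (take c v))"
    by (rule run_loop[OF A r run(4), of "\<lambda>n. chg (map fst (take n v))" 2]) (use step_v chg in auto)
  define u2 where "u2 = take (b - a) (drop a u)"
  define v2 where "v2 = take (d - c) (drop c v)"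
  have u: "take b u = take a u @ u2"
    using ab(1) by (simp add: u2_def flip: take_add)
  have v: "take d v = take c v @ v2"
    using cd(1) by (simp add: v2_def flip: take_add)
  have bal: "balance u2 \<noteq> 0" using ab(6) u by auto
  have chg2: "1 \<le> chg (map fst v2)" using cd(6) v by (auto simp: chg_append split: if_splits)
  have letters: "set u \<subseteq> Sigma_io k" "set v \<subseteq> Sigma_io k" using uv by (auto simp: nfa_lang_def)
  obtain bd where bd: "\<And>w. w \<in> nfa_lang k A \<Longrightarrow> shiftlag_word w \<le> bd"
  proof -
    from fin obtain m where m: "shiftlag_lang (nfa_lang k A) = enat m"
      using less_infinityE by blast
    show ?thesis
    proof (rule that)
      fix w assume "w \<in> nfa_lang k A"
      then have "enat (shiftlag_word w) \<le> shiftlag_lang (nfa_lang k A)"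
        unfolding shiftlag_lang_def by (intro Sup_upper) auto
      then show "shiftlag_word w \<le> m" by (simp add: m)
    qed
  qed
  define n where "n = Suc bd"
  define v' where "v' = take c v @ concat (replicate n v2) @ drop d v"
  \<comment> \<open>After \<open>e\<close> rounds of the first loop the lag is at least
    \<open>e\<close> up to what the rest of \<open>u\<close> can undo, and \<open>v'\<close> changes
    it by at most \<open>length v'\<close>. With this \<open>e\<close> it stays above
    \<open>n\<close> throughout \<open>v'\<close>.\<close>
  define e where "e = n + length u + length v' + 1"
  define u' where "u' = take a u @ concat (replicate e u2) @ drop b u"
  have in_lang: "u' @ v' \<in> nfa_lang k A"
  proof -
    have "nfa_reach A p (u' @ v') q"
      using ab(3,4,5) cd(3,4,5) nfa_reach_power unfolding u'_def v'_def nfa_reach_append u2_def v2_def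
      by blast
    moreover have "set (u' @ v') \<subseteq> Sigma_io k"
      using letters by (auto simp: u'_def v'_def u2_def v2_def dest!: in_set_takeD in_set_dropD)
    ultimately show ?thesis using run(1,2) by (auto simp: nfa_lang_def)
  qed
  have "has_shiftlag (map fst u' @ map fst v') n"
  proof (rule has_shiftlag_append)
    show "n \<le> chg (map fst v')"
      using chg_power[OF chg2, of n] by (simp add: v'_def chg_append)
    fix i assume "length (map fst u') \<le> i"
    then have "take i (u' @ v') = u' @ take (i - length u') v'" by simp
    moreover have "int e * 1 \<le> int e * \<bar>balance u2\<bar>" by (rule mult_left_mono) (use bal in auto)
    then have "int e \<le> \<bar>balance (concat (replicate e u2))\<bar>"
      by (simp add: balance_power abs_mult)
    moreover have "\<bar>balance (take a u)\<bar> \<le> a" "\<bar>balance (drop b u)\<bar> \<le> length u - b"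
      "\<bar>balance (take (i - length u') v')\<bar> \<le> length v'"
      using abs_balance_le[of "take a u"] abs_balance_le[of "drop b u"]
        abs_balance_le[of "take (i - length u') v'"] ab by auto
    ultimately have "int n < \<bar>balance (take i (u' @ v'))\<bar>"
      using ab(1,2) by (simp add: e_def u'_def)
    then show "n < lag (map fst u' @ map fst v') i"
      unfolding map_append[symmetric] lag_balance by simp
  qed
  then have "n \<le> shiftlag (map fst (u' @ v'))"
    unfolding shiftlag_def map_append
    by (rule Greatest_le_nat[where b = "length (map fst u' @ map fst v')"]) (rule has_shiftlag_le)
  then show False using bd[OF in_lang] by (simp add: shiftlag_word_def n_def)
qed

section \<open>Relations of finite rank\<close>

text \<open>A relation on words is given by a predicate on assignments of words to tracks.  Cutting all tracks at
  position \<open>p\<close> splits an assignment into \<open>\<mu>\<close> and \<open>\<nu>\<close>; a word that ends before \<open>p\<close> has an empty second part.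
  The rank bounds the number of classes of first parts, so that relations of finite rank are the ones
  recognised by finite automata reading all tracks synchronously.\<close>

type_synonym asg = "nat \<Rightarrow> nat list"

definition fits :: "nat \<Rightarrow> asg \<Rightarrow> asg \<Rightarrow> bool" where
  "fits p \<mu> \<nu> \<longleftrightarrow> (\<forall>t. length (\<mu> t) \<le> p \<and> (length (\<mu> t) < p \<longrightarrow> \<nu> t = []))"

definition cat :: "asg \<Rightarrow> asg \<Rightarrow> asg" where "cat \<mu> \<nu> = (\<lambda>t. \<mu> t @ \<nu> t)"

text \<open>The two cuts may be at different positions. This is what allows a segment between
  equally classified cuts of the same assignment to be deleted.\<close>

definition classifies :: "(nat \<Rightarrow> asg \<Rightarrow> 'a) \<Rightarrow> (asg \<Rightarrow> bool) \<Rightarrow> bool" where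
  "classifies c \<Phi> \<longleftrightarrow> (\<forall>p \<mu> p' \<mu>' \<nu>. fits p \<mu> \<nu> \<longrightarrow> fits p' \<mu>' \<nu> \<longrightarrow> c p \<mu> = c p' \<mu>' \<longrightarrow>
     \<Phi> (cat \<mu> \<nu>) \<longrightarrow> \<Phi> (cat \<mu>' \<nu>))"

definition rank :: "nat \<Rightarrow> (asg \<Rightarrow> bool) \<Rightarrow> bool" where
  "rank K \<Phi> \<longleftrightarrow> (\<exists>c. (\<forall>p \<mu>. c p \<mu> < K) \<and> classifies c \<Phi>)"

lemma classifiesD:
  "classifies c \<Phi> \<Longrightarrow> fits p \<mu> \<nu> \<Longrightarrow> fits p' \<mu>' \<nu> \<Longrightarrow> c p \<mu> = c p' \<mu>' \<Longrightarrow> \<Phi> (cat \<mu> \<nu>) \<longleftrightarrow> \<Phi> (cat \<mu>' \<nu>)"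
  unfolding classifies_def by metis

lemma rankI:
  assumes B: "finite B" "card B \<le> K" and f: "\<And>p \<mu>. f p \<mu> \<in> B" and c: "classifies f \<Phi>"
  shows "rank K \<Phi>"
proof -
  obtain g where g: "bij_betw g B {0..<card B}" using ex_bij_betw_finite_nat[OF B(1)] by blast
  have "classifies (\<lambda>p \<mu>. g (f p \<mu>)) \<Phi>"
    using c f g unfolding classifies_def by (metis bij_betw_imp_inj_on inj_onD)
  moreover have "g (f p \<mu>) < K" for p \<mu>
    using bij_betwE[OF g] f[of p \<mu>] B(2) by force
  ultimately show ?thesis unfolding rank_def by (intro exI[of _ "\<lambda>p \<mu>. g (f p \<mu>)"]) simp
qed

lemma rank_mono: "rank K \<Phi> \<Longrightarrow> K \<le> L \<Longrightarrow> rank L \<Phi>"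
  unfolding rank_def by (meson less_le_trans)

lemma rank_not: "rank K \<Phi> \<Longrightarrow> rank K (\<lambda>\<rho>. \<not> \<Phi> \<rho>)"
  unfolding rank_def classifies_def by metis

lemma rank_conj:
  assumes "rank K \<Phi>" "rank L \<Psi>" shows "rank (K * L) (\<lambda>\<rho>. \<Phi> \<rho> \<and> \<Psi> \<rho>)"
proof -
  obtain c e where c: "\<forall>p \<mu>. c p \<mu> < K" "classifies c \<Phi>" and e: "\<forall>p \<mu>. e p \<mu> < L" "classifies e \<Psi>"
    using assms unfolding rank_def by blast
  show ?thesis
  proof (rule rankI[where f = "\<lambda>p \<mu>. (c p \<mu>, e p \<mu>)" and B = "{..<K} \<times> {..<L}"])
    show "classifies (\<lambda>p \<mu>. (c p \<mu>, e p \<mu>)) (\<lambda>\<rho>. \<Phi> \<rho> \<and> \<Psi> \<rho>)"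
      unfolding classifies_def
      using classifiesD[OF c(2)] classifiesD[OF e(2)] by blast
  qed (use c e in auto)
qed

lemma rank_disj: "rank K \<Phi> \<Longrightarrow> rank L \<Psi> \<Longrightarrow> rank (K * L) (\<lambda>\<rho>. \<Phi> \<rho> \<or> \<Psi> \<rho>)"
  using rank_not[OF rank_conj[OF rank_not rank_not], of K \<Phi> L \<Psi>] by simp

lemma rank_False: "rank 1 (\<lambda>\<rho>. False)"
  unfolding rank_def classifies_def by auto

lemma rank_ex_less:
  "(\<And>i. i < n \<Longrightarrow> rank K (\<Phi> i)) \<Longrightarrow> rank (K ^ n) (\<lambda>\<rho>. \<exists>i<n. \<Phi> i \<rho>)"
proof (induction n)
  case 0
  show ?case using rank_False by simp
next
  case (Suc n)
  then have "rank (K * K ^ n) (\<lambda>\<rho>. \<Phi> n \<rho> \<or> (\<exists>i<n. \<Phi> i \<rho>))" by (intro rank_disj) auto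
  moreover have "(\<lambda>\<rho>. \<Phi> n \<rho> \<or> (\<exists>i<n. \<Phi> i \<rho>)) = (\<lambda>\<rho>. \<exists>i<Suc n. \<Phi> i \<rho>)"
    by (auto simp: less_Suc_eq)
  ultimately show ?case by simp
qed

lemma rank_subst:
  assumes "rank K \<Phi>" shows "rank K (\<lambda>\<rho>. \<Phi> (\<lambda>t. \<rho> (h t)))"
proof -
  obtain c where c: "\<forall>p \<mu>. c p \<mu> < K" "classifies c \<Phi>"
    using assms unfolding rank_def by blast
  have "fits p \<mu> \<nu> \<Longrightarrow> fits p (\<lambda>t. \<mu> (h t)) (\<lambda>t. \<nu> (h t))" for p \<mu> \<nu> by (auto simp: fits_def)
  then have "classifies (\<lambda>p \<mu>. c p (\<lambda>t. \<mu> (h t))) (\<lambda>\<rho>. \<Phi> (\<lambda>t. \<rho> (h t)))"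
    using c(2) unfolding classifies_def cat_def by blast
  then show ?thesis using c(1) unfolding rank_def by (intro exI[of _ "\<lambda>p \<mu>. c p (\<lambda>t. \<mu> (h t))"]) simp
qed

text \<open>Subset construction: the class of a cut is the set of classes obtained by guessing the
  first part of track \<open>t\<close>. Each guess carries a bit telling whether the guessed word
  has already ended, since only a word of length \<open>p\<close> may be continued. There are
  \<open>2 ^ (2 * K)\<close> such sets.\<close>

lemma rank_ex:
  assumes "rank K \<Phi>" shows "rank (2 ^ (2 * K)) (\<lambda>\<rho>. \<exists>X. \<Phi> (\<rho>(t := X)))"
proof -
  obtain c where c: "\<forall>p \<mu>. c p \<mu> < K" "classifies c \<Phi>"
    using assms unfolding rank_def by blast
  define f where "f p \<mu> = {(c p (\<mu>(t := z)), length z < p) | z. length z \<le> p}" for p \<mu>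
  show ?thesis
  proof (rule rankI)
    show "finite (Pow ({..<K} \<times> (UNIV :: bool set)))" by simp
    show "card (Pow ({..<K} \<times> (UNIV :: bool set))) \<le> 2 ^ (2 * K)"
      by (subst card_Pow) (auto simp: card_cartesian_product mult.commute)
    show "f p \<mu> \<in> Pow ({..<K} \<times> UNIV)" for p \<mu> using c by (auto simp: f_def)
    show "classifies f (\<lambda>\<rho>. \<exists>X. \<Phi> (\<rho>(t := X)))"
      unfolding classifies_def
    proof (intro allI impI)
      fix p \<mu> p' \<mu>' \<nu>
      assume fits: "fits p \<mu> \<nu>" "fits p' \<mu>' \<nu>" and eq: "f p \<mu> = f p' \<mu>'"
        and "\<exists>X. \<Phi> ((cat \<mu> \<nu>)(t := X))"
      then obtain X where X: "\<Phi> ((cat \<mu> \<nu>)(t := X))" by blast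
      have upd: "(cat \<mu> \<nu>)(t := y @ z) = cat (\<mu>(t := y)) (\<nu>(t := z))" for \<mu> \<nu> y z
        by (auto simp: cat_def)
      have "(c p (\<mu>(t := take p X)), length (take p X) < p) \<in> f p \<mu>"
        unfolding f_def by (intro CollectI exI[of _ "take p X"]) simp
      then obtain z where z: "c p (\<mu>(t := take p X)) = c p' (\<mu>'(t := z))"
        "length (take p X) < p \<longleftrightarrow> length z < p'" "length z \<le> p'"
        unfolding eq f_def[of p'] by blast
      have "\<Phi> (cat (\<mu>(t := take p X)) (\<nu>(t := drop p X)))"
        using X unfolding upd[symmetric] by simp
      then have "\<Phi> (cat (\<mu>'(t := z)) (\<nu>(t := drop p X)))"
        by (rule classifiesD[OF c(2) _ _ z(1), THEN iffD1, rotated -1])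
          (use fits z in \<open>auto simp: fits_def\<close>)
      then show "\<exists>X. \<Phi> ((cat \<mu>' \<nu>)(t := X))"
        unfolding upd[symmetric] by blast
    qed
  qed
qed

lemma fits_take_drop:
  assumes "fits p \<mu> \<nu>" shows "take p (\<mu> t @ \<nu> t) = \<mu> t" "drop p (\<mu> t @ \<nu> t) = \<nu> t"
  using assms by (cases "length (\<mu> t) < p"; auto simp: fits_def)+

lemma fits_eq_iff: "fits p \<mu> \<nu> \<Longrightarrow> \<mu> a @ \<nu> a = \<mu> b @ \<nu> b \<longleftrightarrow> \<mu> a = \<mu> b \<and> \<nu> a = \<nu> b"
  by (metis fits_take_drop)

lemma rank_eq: "rank 2 (\<lambda>\<rho>. \<rho> a = \<rho> b)"
proof (rule rankI[where f = "\<lambda>p \<mu>. \<mu> a = \<mu> b" and B = UNIV])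
  show "classifies (\<lambda>p \<mu>. \<mu> a = \<mu> b) (\<lambda>\<rho>. \<rho> a = \<rho> b)"
    unfolding classifies_def cat_def using fits_eq_iff by blast
qed auto

text \<open>At a cut the comparison splits into comparisons of the first and of the second parts: a
  track shorter than the cut has an empty second part, and a track that reaches it is maximal
  there.\<close>

lemma rank_length_le: "rank 2 (\<lambda>\<rho>. length (\<rho> a) \<le> length (\<rho> b))"
proof (rule rankI[where f = "\<lambda>p \<mu>. length (\<mu> a) \<le> length (\<mu> b)" and B = UNIV])
  have "length (\<mu> a @ \<nu> a) \<le> length (\<mu> b @ \<nu> b) \<longleftrightarrow> length (\<mu> a) \<le> length (\<mu> b) \<and> length (\<nu> a) \<le> length (\<nu> b)"
    if "fits p \<mu> \<nu>" for p \<mu> \<nu>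
  proof -
    have "length (\<mu> t) \<le> p \<and> (length (\<mu> t) = p \<or> length (\<nu> t) = 0)" for t
      using that by (auto simp: fits_def le_less)
    from this[of a] this[of b] show ?thesis unfolding length_append by presburger
  qed
  then show "classifies (\<lambda>p \<mu>. length (\<mu> a) \<le> length (\<mu> b)) (\<lambda>\<rho>. length (\<rho> a) \<le> length (\<rho> b))"
    unfolding classifies_def cat_def by blast
qed auto

definition extends :: "nat \<Rightarrow> (nat \<Rightarrow> nat \<Rightarrow> nat) \<Rightarrow> nat \<Rightarrow> nat \<Rightarrow> nat list \<Rightarrow> nat list \<Rightarrow> bool" where
  "extends k d q q' x X \<longleftrightarrow> (\<exists>z. X = x @ z \<and> set z \<subseteq> {..<k} \<and> foldl d q z = q')"

text \<open>The automaton rests in \<open>q\<close> while both tracks run along together and moves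
  only once track \<open>a\<close> has ended. The additional class \<open>None\<close> stands for
  tracks that already disagree or use a forbidden letter.\<close>

lemma rank_extends:
  assumes d: "\<And>q c. q < Q \<Longrightarrow> d q c < Q" and q: "q < Q"
  shows "rank (Suc Q) (\<lambda>\<rho>. extends k d q q' (\<rho> a) (\<rho> b))"
proof -
  define f where "f p \<mu> = (if prefix (\<mu> a) (\<mu> b) \<and> set (drop (length (\<mu> a)) (\<mu> b)) \<subseteq> {..<k}
      then Some (foldl d q (drop (length (\<mu> a)) (\<mu> b))) else None)" for p :: nat and \<mu> :: asg
  have foldl: "foldl d q z < Q" for z
    using q by (induction z rule: rev_induct) (auto simp: d)
  have iff: "extends k d q q' (\<mu> a @ \<nu> a) (\<mu> b @ \<nu> b) \<longleftrightarrow>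
      (\<exists>r. f p \<mu> = Some r \<and> extends k d r q' (\<nu> a) (\<nu> b))" if "fits p \<mu> \<nu>" for p \<mu> \<nu>
  proof
    assume "extends k d q q' (\<mu> a @ \<nu> a) (\<mu> b @ \<nu> b)"
    then obtain z where z: "\<mu> b @ \<nu> b = \<mu> a @ \<nu> a @ z" "set z \<subseteq> {..<k}" "foldl d q z = q'"
      by (auto simp: extends_def)
    have cases: "length (\<mu> a) = p \<or> \<nu> a = []" "length (\<mu> b) = p \<or> \<nu> b = []" "length (\<mu> a) \<le> p" "length (\<mu> b) \<le> p"
      using that by (auto simp: fits_def le_less)
    have "length (\<mu> a) \<le> length (\<mu> b)"
      using cases arg_cong[OF z(1), of length] by auto
    then have "take (length (\<mu> a)) (\<mu> b) = \<mu> a"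
      using arg_cong[OF z(1), of "take (length (\<mu> a))"] by simp
    define z0 where "z0 = drop (length (\<mu> a)) (\<mu> b)"
    have b: "\<mu> b = \<mu> a @ z0"
      using append_take_drop_id[of "length (\<mu> a)" "\<mu> b"] \<open>take _ (\<mu> b) = \<mu> a\<close> by (simp add: z0_def)
    have "z0 @ \<nu> b = \<nu> a @ z" using z(1) unfolding b by simp
    note z0 = b this
    have f: "f p \<mu> = Some (foldl d q z0)" if "set z0 \<subseteq> {..<k}"
      using that unfolding f_def b by simp
    show "\<exists>r. f p \<mu> = Some r \<and> extends k d r q' (\<nu> a) (\<nu> b)"
    proof (cases "\<nu> a = []")
      case True
      then have "z = z0 @ \<nu> b" using z0 by simp
      then have "f p \<mu> = Some (foldl d q z0)" "extends k d (foldl d q z0) q' (\<nu> a) (\<nu> b)"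
        using True z(2,3) by (auto intro!: f simp: extends_def)
      then show ?thesis by blast
    next
      case False
      then have "z0 = []" using cases z0(1) by auto
      then have "f p \<mu> = Some q" "extends k d q q' (\<nu> a) (\<nu> b)"
        using f z(2,3) z0(2) by (auto simp: extends_def)
      then show ?thesis by blast
    qed
  next
    assume "\<exists>r. f p \<mu> = Some r \<and> extends k d r q' (\<nu> a) (\<nu> b)"
    then obtain z0 z where z: "\<mu> b = \<mu> a @ z0" "\<nu> b = \<nu> a @ z" "set z0 \<subseteq> {..<k}" "set z \<subseteq> {..<k}"
      "foldl d (foldl d q z0) z = q'"
      by (auto simp: f_def extends_def prefix_def split: if_splits)
    have "length (\<mu> a) = p \<or> \<nu> a = []" "length (\<mu> b) \<le> p"
      using that by (auto simp: fits_def le_less)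
    \<comment> \<open>One of the two words is empty: either track \<open>a\<close> has ended, or it
      fills the cut and leaves no room for \<open>z0\<close>.\<close>
    then have "z0 @ \<nu> a = \<nu> a @ z0" using z(1) by auto
    then show "extends k d q q' (\<mu> a @ \<nu> a) (\<mu> b @ \<nu> b)"
      unfolding extends_def using z by (intro exI[of _ "z0 @ z"]) auto
  qed
  show ?thesis
  proof (rule rankI)
    show "finite (insert None (Some ` {..<Q}))" by simp
    show "card (insert None (Some ` {..<Q})) \<le> Suc Q" by (simp add: card_insert_if card_image)
    show "f p \<mu> \<in> insert None (Some ` {..<Q})" for p \<mu> using foldl by (auto simp: f_def)
    show "classifies f (\<lambda>\<rho>. extends k d q q' (\<rho> a) (\<rho> b))"
      unfolding classifies_def cat_def using iff by metis
  qed
qed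

text \<open>Pumping on a single track. At the \<open>K + 1\<close> cuts from \<open>m\<close> to
  \<open>m + K\<close> the other tracks have ended, so the segment between two equally classified
  cuts can be deleted from track \<open>t\<close> alone.\<close>

lemma rank_shorten:
  assumes "rank K \<Phi>" "\<Phi> \<rho>" and m: "\<And>s. s \<noteq> t \<Longrightarrow> length (\<rho> s) \<le> m"
  shows "\<exists>z. length z \<le> m + K \<and> set z \<subseteq> set (\<rho> t) \<and> \<Phi> (\<rho>(t := z))"
  using assms(2) m
proof (induction "length (\<rho> t)" arbitrary: \<rho> rule: less_induct)
  case less
  obtain c where c: "\<forall>p \<mu>. c p \<mu> < K" "classifies c \<Phi>"
    using assms(1) unfolding rank_def by blast
  show ?case
  proof (cases "length (\<rho> t) \<le> m + K")
    case True
    then show ?thesis using less.prems by (intro exI[of _ "\<rho> t"]) auto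
  next
    case False
    define \<mu> where "\<mu> i = \<rho>(t := take i (\<rho> t))" for i
    have "\<not> inj_on (\<lambda>i. c i (\<mu> i)) {m..m + K}"
    proof
      assume "inj_on (\<lambda>i. c i (\<mu> i)) {m..m + K}"
      then have "card {m..m + K} \<le> card {..<K}" by (rule card_inj_on_le) (use c in auto)
      then show False by simp
    qed
    then obtain i j where ij: "m \<le> i" "i < j" "j \<le> m + K" "c i (\<mu> i) = c j (\<mu> j)"
      using linorder_inj_onI'[of "{m..m + K}" "\<lambda>i. c i (\<mu> i)"] by (meson atLeastAtMost_iff)
    define \<nu> where "\<nu> = (\<lambda>s. if s = t then drop j (\<rho> t) else [])"
    have "length (\<rho> s) \<le> i \<and> length (\<rho> s) \<le> j" if "s \<noteq> t" for s
      using less.prems(2)[OF that] ij by simp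
    then have fits: "fits i (\<mu> i) \<nu>" "fits j (\<mu> j) \<nu>"
      using False ij by (auto simp: fits_def \<mu>_def \<nu>_def)
    have "cat (\<mu> j) \<nu> = \<rho>" by (auto simp: cat_def \<mu>_def \<nu>_def)
    then have "\<Phi> (cat (\<mu> i) \<nu>)"
      using classifiesD[OF c(2) fits ij(4)] less.prems(1) by simp
    moreover have "cat (\<mu> i) \<nu> = \<rho>(t := take i (\<rho> t) @ drop j (\<rho> t))"
      by (auto simp: cat_def \<mu>_def \<nu>_def)
    ultimately have \<Phi>: "\<Phi> (\<rho>(t := take i (\<rho> t) @ drop j (\<rho> t)))" by simp
    have sub: "set (take i (\<rho> t) @ drop j (\<rho> t)) \<subseteq> set (\<rho> t)"
      by (auto dest: in_set_takeD in_set_dropD)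
    have "\<exists>z. length z \<le> m + K \<and> set z \<subseteq> set ((\<rho>(t := take i (\<rho> t) @ drop j (\<rho> t))) t) \<and>
        \<Phi> (\<rho>(t := take i (\<rho> t) @ drop j (\<rho> t), t := z))"
      by (rule less.hyps[OF _ \<Phi>]) (use False ij less.prems(2) in auto)
    then obtain z where "length z \<le> m + K" "set z \<subseteq> set (take i (\<rho> t) @ drop j (\<rho> t))" "\<Phi> (\<rho>(t := z))"
      by auto
    then show ?thesis using sub by blast
  qed
qed

section \<open>The rank of a relation of finite shiftlag\<close>

text \<open>A transition list may mention letters outside \<open>Sigma_io k\<close>, whereas words
  of \<open>nfa_lang k A\<close> contain none, so runs are restricted accordingly.\<close>

definition reach :: "nat \<Rightarrow> nfa \<Rightarrow> nat \<Rightarrow> (nat \<times> nat) list \<Rightarrow> nat \<Rightarrow> bool" where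
  "reach k A p w q \<longleftrightarrow> nfa_reach A p w q \<and> set w \<subseteq> Sigma_io k"

lemma reach_append: "reach k A p (u @ v) q \<longleftrightarrow> (\<exists>r. reach k A p u r \<and> reach k A r v q)"
  by (auto simp: reach_def nfa_reach_append)

lemma reach_Cons: "reach k A p (x # v) q \<longleftrightarrow> (\<exists>r. reach k A p [x] r \<and> reach k A r v q)"
  using reach_append[of k A p "[x]" v q] by simp

lemma nfa_lang_reach: "w \<in> nfa_lang k A \<longleftrightarrow>
    (\<exists>p\<in>set (fst (snd A)). \<exists>q\<in>set (snd (snd A)). reach k A p w q)"
  by (auto simp: nfa_lang_def reach_def in_lists_conv_set)

definition block_runs :: "nat \<Rightarrow> nfa \<Rightarrow> nat \<Rightarrow> (nat \<times> nat) list \<Rightarrow> nat list list \<Rightarrow> bool" where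
  "block_runs k A d l zs \<longleftrightarrow> list_all2 (\<lambda>(s, t) z. reach k A s (map (Pair d) z) t) l zs"

lemma block_runs_Cons: "block_runs k A d ((s, t) # l) zs \<longleftrightarrow>
    (\<exists>z zs'. zs = z # zs' \<and> reach k A s (map (Pair d) z) t \<and> block_runs k A d l zs')"
  by (auto simp: block_runs_def list_all2_Cons1)

text \<open>The first \<open>r\<close> letters of \<open>v\<close> on tape \<open>d\<close> are
  spread over blocks, and the run sees each block only through its two end states. Any words with
  the same end states can thus replace them while the rest of \<open>v\<close> stays put, so a list
  of state pairs is all that a cut has to remember. Blocks are non-empty and separated by shifts,
  which gives both bounds on their number.\<close>

lemma exchange_blocks:
  assumes A: "states_below N A"
  shows "reach k A p v q \<Longrightarrow> p < N \<Longrightarrow> r \<le> length (pr d v) \<Longrightarrow>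
    \<exists>l zs. block_runs k A d l zs \<and> concat zs = take r (pr d v) \<and> length l \<le> r \<and>
      length l \<le> Suc (chg (map fst v)) \<and> set l \<subseteq> {..<N} \<times> {..<N} \<and>
      (\<forall>zs'. block_runs k A d l zs' \<longrightarrow> (\<exists>v'. reach k A p v' q \<and> pr d v' = concat zs' @ drop r (pr d v) \<and>
         (\<forall>e. e \<noteq> d \<longrightarrow> pr e v' = pr e v)))"
proof (induction "length v" arbitrary: v p r rule: less_induct)
  case less
  show ?case
  proof (cases "r = 0")
    case True
    with less.prems show ?thesis by (intro exI[of _ "[]"]) (auto simp: block_runs_def)
  next
    case False
    with less.prems obtain x v1 where v: "v = x # v1" by (cases v) auto
    show ?thesis
    proof (cases "fst x = d")
      case other: False
      obtain p1 where p1: "reach k A p [x] p1" "reach k A p1 v1 q"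
        using less.prems(1) unfolding v reach_Cons[of k A p x v1] by blast
      have "p1 < N" using states_below_reach[OF A less.prems(2)] p1(1) unfolding reach_def by blast
      from less.hyps[OF _ p1(2) this, of r] less.prems(3) v other
      obtain l zs where l: "block_runs k A d l zs" "concat zs = take r (pr d v)" "length l \<le> r"
        "length l \<le> Suc (chg (map fst v1))" "set l \<subseteq> {..<N} \<times> {..<N}"
        and exch: "\<And>zs'. block_runs k A d l zs' \<Longrightarrow> \<exists>v'. reach k A p1 v' q \<and>
          pr d v' = concat zs' @ drop r (pr d v) \<and> (\<forall>e. e \<noteq> d \<longrightarrow> pr e v' = pr e v1)"
        by auto
      have "\<exists>v'. reach k A p v' q \<and> pr d v' = concat zs' @ drop r (pr d v) \<and>
          (\<forall>e. e \<noteq> d \<longrightarrow> pr e v' = pr e v)" if "block_runs k A d l zs'" for zs'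
      proof -
        from exch[OF that] obtain v' where "reach k A p1 v' q" "pr d v' = concat zs' @ drop r (pr d v)"
          "\<forall>e. e \<noteq> d \<longrightarrow> pr e v' = pr e v1" by blast
        then show ?thesis using p1(1) other v reach_Cons[of k A p x v' q] by (intro exI[of _ "x # v'"]) auto
      qed
      then show ?thesis using l v by (intro exI[of _ l] exI[of _ zs]) (auto simp: chg_Cons)
    next
      case same: True
      define z where "z = map snd (takeWhile (\<lambda>x. fst x = d) v)"
      define C where "C = dropWhile (\<lambda>x. fst x = d) v"
      have "map (Pair d) z = takeWhile (\<lambda>x. fst x = d) v"
        unfolding z_def by (induction v) auto
      then have vz: "v = map (Pair d) z @ C" by (simp add: C_def)
      have z: "z \<noteq> []" using v same by (simp add: z_def)
      have C: "C = [] \<or> fst (hd C) \<noteq> d" using hd_dropWhile[of "\<lambda>x. fst x = d" v] by (auto simp: C_def)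
      have prd: "pr d v = z @ pr d C" by (simp add: vz)
      obtain t where t: "reach k A p (map (Pair d) z) t" "reach k A t C q"
        using less.prems(1) unfolding vz reach_append by blast
      show ?thesis
      proof (cases "r \<le> length z")
        case True
        \<comment> \<open>The cut falls inside this block: its first \<open>r\<close> letters become
          exchangeable, and the remainder stays with the rest of the run.\<close>
        have "reach k A p (map (Pair d) (take r z) @ map (Pair d) (drop r z)) t"
          using t(1) by (simp flip: map_append)
        then obtain s where s: "reach k A p (map (Pair d) (take r z)) s" "reach k A s (map (Pair d) (drop r z)) t"
          unfolding reach_append by blast
        have "s < N" using states_below_reach[OF A less.prems(2)] s(1) unfolding reach_def by blast
        moreover have "\<exists>v'. reach k A p v' q \<and> pr d v' = concat zs' @ drop r (pr d v) \<and>
          (\<forall>e. e \<noteq> d \<longrightarrow> pr e v' = pr e v)" if zs': "block_runs k A d [(p, s)] zs'" for zs'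
        proof -
          obtain z' where z': "zs' = [z']" "reach k A p (map (Pair d) z') s"
            using zs' unfolding block_runs_Cons by (auto simp: block_runs_def)
          show ?thesis
            using z' s t True prd
            by (intro exI[of _ "map (Pair d) z' @ map (Pair d) (drop r z) @ C"])
              (auto simp: reach_append vz pr_map_Pair_other)
        qed
        ultimately show ?thesis using s less.prems(2) False True prd
          by (intro exI[of _ "[(p, s)]"] exI[of _ "[take r z]"]) (auto simp: block_runs_def)
      next
        case False
        then have "C \<noteq> []" using less.prems(3) prd by auto
        then have chg: "chg (map fst v) \<ge> Suc (chg (map fst C))"
          using C z by (auto simp: vz chg_append last_map hd_map)
        have t_less: "t < N" using states_below_reach[OF A less.prems(2)] t(1) unfolding reach_def by blast
        moreover have "length C < length v" "r - length z \<le> length (pr d C)"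
          using z less.prems(3) prd by (auto simp: vz)
        ultimately obtain l zs where l: "block_runs k A d l zs" "concat zs = take (r - length z) (pr d C)"
          "length l \<le> r - length z" "length l \<le> Suc (chg (map fst C))" "set l \<subseteq> {..<N} \<times> {..<N}"
          and exch: "\<And>zs'. block_runs k A d l zs' \<Longrightarrow> \<exists>v'. reach k A t v' q \<and>
            pr d v' = concat zs' @ drop (r - length z) (pr d C) \<and> (\<forall>e. e \<noteq> d \<longrightarrow> pr e v' = pr e C)"
          using less.hyps[OF _ t(2)] by blast
        have "\<exists>v'. reach k A p v' q \<and> pr d v' = concat zs' @ drop r (pr d v) \<and>
          (\<forall>e. e \<noteq> d \<longrightarrow> pr e v' = pr e v)" if zs': "block_runs k A d ((p, t) # l) zs'" for zs'
        proof -
          obtain z' zs'' where z': "zs' = z' # zs''" "reach k A p (map (Pair d) z') t" "block_runs k A d l zs''"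
            using zs' by (auto simp: block_runs_Cons)
          from exch[OF z'(3)] obtain v' where "reach k A t v' q"
            "pr d v' = concat zs'' @ drop (r - length z) (pr d C)" "\<forall>e. e \<noteq> d \<longrightarrow> pr e v' = pr e C" by blast
          then show ?thesis using z' False prd
            by (intro exI[of _ "map (Pair d) z' @ v'"]) (auto simp: reach_append vz pr_map_Pair_other)
        qed
        moreover have "length ((p, t) # l) \<le> r"
          using z l(3) False by (cases z) auto
        ultimately show ?thesis using l t less.prems(2) t_less False prd chg
          by (intro exI[of _ "(p, t) # l"] exI[of _ "z # zs"]) (auto simp: block_runs_Cons)
      qed
    qed
  qed
qed

text \<open>This bounds the number of sets of triples of a tape, a state and a list of at most
  \<open>2 * N + 1\<close> state pairs. The length is one more than the number of shifts that can
  follow a large lag.\<close>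

definition nfa_rank :: "nat \<Rightarrow> nat" where
  "nfa_rank N = 2 ^ (2 * N * ((2 * N + 2) * (N * N) ^ (2 * N + 1)))"

text \<open>The class of a cut records how the part inside the square \<open>[0, p]\<^sup>2\<close> can be traversed: a first run that
  exhausts one tape, followed by boundedly many blocks on the other tape \<open>d\<close>.\<close>

lemma rank_nfa:
  assumes A: "states_below N A" "0 < N" and fin: "shiftlag_lang (nfa_lang k A) < \<infinity>"
  shows "rank (nfa_rank N) (\<lambda>\<rho>. (\<rho> 1, \<rho> 2) \<in> sem_lang (nfa_lang k A))"
proof -
  define LL where "LL = {l. set l \<subseteq> {..<N} \<times> {..<N} \<and> length l \<le> 2 * N + 1}"
  define info where "info p \<mu> = {(d, s, l). d \<in> {1, 2} \<and> s < N \<and> l \<in> LL \<and>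
    (\<exists>i\<in>set (fst (snd A)). \<exists>P zs. reach k A i P s \<and> pr (3 - d) P = \<mu> (3 - d) \<and>
       \<mu> d = pr d P @ concat zs \<and> block_runs k A d l zs)}" for p :: nat and \<mu> :: asg
  have LL: "finite LL" unfolding LL_def by (rule finite_lists_length_le) auto
  have "card LL = (\<Sum>i\<le>2 * N + 1. (N * N) ^ i)"
    unfolding LL_def by (subst card_lists_length_le) (auto simp: card_cartesian_product)
  also have "\<dots> \<le> card {..2 * N + 1} * (N * N) ^ (2 * N + 1)"
    using A(2) sum_bounded_above[of "{..2 * N + 1}" "\<lambda>i. (N * N) ^ i" "(N * N) ^ (2 * N + 1)"]
    by (simp add: power_increasing del: power_Suc)
  finally have card: "card LL \<le> (2 * N + 2) * (N * N) ^ (2 * N + 1)" by simp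
  show ?thesis
  proof (rule rankI)
    show "finite (Pow ({1 :: nat, 2} \<times> {..<N} \<times> LL))" using LL by simp
    show "card (Pow ({1 :: nat, 2} \<times> {..<N} \<times> LL)) \<le> nfa_rank N"
    proof -
      have "card ({1 :: nat, 2} \<times> {..<N} \<times> LL) = 2 * N * card LL" by (simp add: card_cartesian_product)
      also have "\<dots> \<le> 2 * N * ((2 * N + 2) * (N * N) ^ (2 * N + 1))" by (rule mult_le_mono2[OF card])
      finally show ?thesis using LL unfolding nfa_rank_def by (subst card_Pow) (simp_all add: power_increasing)
    qed
    show "info p \<mu> \<in> Pow ({1 :: nat, 2} \<times> {..<N} \<times> LL)" for p \<mu> unfolding info_def by auto
    show "classifies info (\<lambda>\<rho>. (\<rho> 1, \<rho> 2) \<in> sem_lang (nfa_lang k A))"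
      unfolding classifies_def
    proof (intro allI impI)
      fix p \<mu> p' \<mu>' \<nu>
      assume fits: "fits p \<mu> \<nu>" "fits p' \<mu>' \<nu>" and eq: "info p \<mu> = info p' \<mu>'"
        and "(cat \<mu> \<nu> 1, cat \<mu> \<nu> 2) \<in> sem_lang (nfa_lang k A)"
      then obtain w where w: "w \<in> nfa_lang k A" "pr 1 w = \<mu> 1 @ \<nu> 1" "pr 2 w = \<mu> 2 @ \<nu> 2"
        by (auto simp: sem_lang_def sem_pr cat_def)
      have prw: "pr e w = \<mu> e @ \<nu> e" if "e \<in> {1, 2}" for e using w that by auto
      \<comment> \<open>\<open>u\<close> is the longest prefix of \<open>w\<close> inside the
        square. If \<open>w\<close> goes on, its next letter leaves the square, so the tape of that
        letter is exactly full; \<open>d\<close> is the opposite tape, and \<open>3 - d\<close>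
        exchanges 1 and 2.\<close>
      have "\<exists>d u v. d \<in> {1, 2} \<and> w = u @ v \<and> length (pr 1 u) \<le> p \<and> length (pr 2 u) \<le> p \<and>
          (v = [] \<or> length (pr (3 - d) u) = p)"
      proof -
        define inside where "inside u \<longleftrightarrow> length (pr 1 u) \<le> p \<and> length (pr 2 u) \<le> p" for u
        define n where "n = (GREATEST n. n \<le> length w \<and> inside (take n w))"
        have "n \<le> length w \<and> inside (take n w)"
          unfolding n_def by (rule GreatestI_nat[where k = 0 and b = "length w"]) (auto simp: inside_def)
        moreover have "\<not> (Suc n \<le> length w \<and> inside (take (Suc n) w))"
          using Greatest_le_nat[of "\<lambda>n. n \<le> length w \<and> inside (take n w)" "Suc n" "length w"]
          by (auto simp flip: n_def)
        moreover have "fst (w ! n) \<in> {1, 2}" if "n < length w"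
        proof -
          have "w ! n \<in> Sigma_io k" using w(1) nth_mem[OF that] by (auto simp: nfa_lang_def)
          then show ?thesis by (auto simp: Sigma_io_def)
        qed
        ultimately show ?thesis
          by (intro exI[of _ "if n < length w then 3 - fst (w ! n) else 1"] exI[of _ "take n w"] exI[of _ "drop n w"])
            (auto simp: inside_def take_Suc_conv_app_nth split: if_splits)
      qed
      then obtain d u v where d: "d \<in> {1, 2}" and uv: "w = u @ v" "length (pr 1 u) \<le> p" "length (pr 2 u) \<le> p"
        "v = [] \<or> length (pr (3 - d) u) = p" by blast
      have d3: "3 - d \<in> {1, 2}" "3 - d \<noteq> d" using d by auto
      have len: "length (pr e u) \<le> p" if "e \<in> {1, 2}" for e using that uv by auto
      have full: "pr (3 - d) u = \<mu> (3 - d)"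
      proof -
        have "\<mu> (3 - d) = take p (pr (3 - d) w)" using fits_take_drop(1)[OF fits(1)] prw[OF d3(1)] by simp
        then show ?thesis using uv len[OF d3(1)] by auto
      qed
      define r where "r = length (\<mu> d) - length (pr d u)"
      have mud: "\<mu> d = take p (pr d w)" "\<nu> d = drop p (pr d w)"
        using fits_take_drop[OF fits(1)] prw[OF d] by auto
      have r: "\<mu> d = pr d u @ take r (pr d v)" "\<nu> d = drop r (pr d v)" "r \<le> length (pr d v)"
        using mud len[OF d] by (auto simp: r_def uv(1) min_def)
      obtain i qf s where run: "i \<in> set (fst (snd A))" "qf \<in> set (snd (snd A))"
        "reach k A i u s" "reach k A s v qf"
        using w(1) unfolding nfa_lang_reach uv(1) reach_append by blast
      have "i < N" using A(1) run(1) by (auto simp: states_below_def)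
      then have s: "s < N" using states_below_reach[OF A(1)] run(3) unfolding reach_def by blast
      from exchange_blocks[OF A(1) run(4) s r(3)]
      obtain l zs where l: "block_runs k A d l zs" "concat zs = take r (pr d v)" "length l \<le> r"
          "length l \<le> Suc (chg (map fst v))" "set l \<subseteq> {..<N} \<times> {..<N}"
        and exch: "\<And>zs'. block_runs k A d l zs' \<Longrightarrow> \<exists>v'. reach k A s v' qf \<and>
          pr d v' = concat zs' @ drop r (pr d v) \<and> (\<forall>e. e \<noteq> d \<longrightarrow> pr e v' = pr e v)" by blast
      \<comment> \<open>A short remainder on tape \<open>d\<close> has few blocks, because they are
        non-empty. A remainder longer than \<open>N\<close> means that tape \<open>3 - d\<close>
        leads by at least \<open>N\<close> after \<open>u\<close>, and then few shifts
        follow.\<close>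
      have "length l \<le> 2 * N + 1"
      proof (cases "v = [] \<or> r \<le> N")
        case True
        then show ?thesis using l(3,4) by auto
      next
        case False
        then have "N \<le> length (pr (3 - d) u) - length (pr d u)"
          using uv(4) mud(1) by (auto simp: r_def)
        then have "int N \<le> \<bar>balance u\<bar>" using d by (auto simp: balance_def)
        then have "chg (map fst v) \<le> 2 * N" using shift_bound[OF A(1) fin] w(1) uv(1) by blast
        then show ?thesis using l(4) by simp
      qed
      moreover have "\<exists>i\<in>set (fst (snd A)). \<exists>P zs. reach k A i P s \<and> pr (3 - d) P = \<mu> (3 - d) \<and>
          \<mu> d = pr d P @ concat zs \<and> block_runs k A d l zs"
        using run full r l(1,2) by (intro bexI[of _ i] exI[of _ u] exI[of _ zs]) auto
      ultimately have "(d, s, l) \<in> info p \<mu>"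
        unfolding info_def LL_def using d s l(5) by blast
      then obtain i' P zs' where P: "i' \<in> set (fst (snd A))" "reach k A i' P s"
        "pr (3 - d) P = \<mu>' (3 - d)" "\<mu>' d = pr d P @ concat zs'" "block_runs k A d l zs'"
        unfolding eq by (auto simp: info_def)
      from exch[OF P(5)] obtain v' where v': "reach k A s v' qf"
        "pr d v' = concat zs' @ drop r (pr d v)" "\<forall>e. e \<noteq> d \<longrightarrow> pr e v' = pr e v" by blast
      have "P @ v' \<in> nfa_lang k A"
        unfolding nfa_lang_reach reach_append using P(1,2) v'(1) run(2) by blast
      moreover have "pr d (P @ v') = \<mu>' d @ \<nu> d" using P v' r by simp
      moreover have "pr (3 - d) (P @ v') = \<mu>' (3 - d) @ \<nu> (3 - d)"
        using P(3) v'(3) d3 full prw[OF d3(1)] uv(1) by simp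
      ultimately show "(cat \<mu>' \<nu> 1, cat \<mu>' \<nu> 2) \<in> sem_lang (nfa_lang k A)"
        unfolding sem_lang_def sem_pr cat_def using d by (auto intro!: image_eqI[of _ _ "P @ v'"])
    qed
  qed
qed

section \<open>The game\<close>

text \<open>The constants live in a locale without assumptions, so that the decision procedure can
  evaluate them from numbers alone. \<open>k\<close> is the size of the alphabet, \<open>N\<close>
  the lag at which the phases change, \<open>Q\<close> the number of states of a deterministic
  automaton for the target, and \<open>KR\<close> the rank of the source relation.\<close>

locale game_bounds =
  fixes k N Q KR :: nat
begin

text \<open>The ranks from here to \<open>await_rank\<close> mirror, connective by connective, the
  formulas in \<open>rank_emit\<close> and \<open>rank_await\<close>: a product for a conjunction or
  disjunction, a power \<open>Q\<close> for the choice of a state, \<open>2 ^ (2 * _)\<close> for a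
  quantified track, and a leading 2 for the comparison of lengths.\<close>

definition KD :: nat where "KD = 2 ^ (2 * KR)"
definition KX :: nat where "KX = Suc Q ^ Q"

definition emit_rank :: "nat \<Rightarrow> nat" where
  "emit_rank e = 2 * 2 ^ (2 * ((Suc Q * e) ^ Q * (KD * 2 ^ (2 * (2 * (KX * KR))))))"

primrec await_rank :: "nat \<Rightarrow> nat" where
  "await_rank 0 = 2 * 2 ^ (2 * (KX * (2 * KD)))"
| "await_rank (Suc j) = 2 * 2 ^ (2 * (KX * (2 * (KD * ((KR * KX) *
     2 ^ (2 * (2 * (2 * (Suc Q * emit_rank (await_rank j)) ^ Q))))))))"

text \<open>Pairs of a class for \<open>R\<close> and a class for \<open>dm\<close>: the pigeonholes
  of \<open>cut_both\<close>.\<close>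

definition KP :: nat where "KP = KR * KD"

text \<open>The pigeonholes of \<open>cut_input\<close>: a class for \<open>dm\<close>, and a class
  for \<open>R\<close> with each of the at most \<open>Suc b * k ^ b\<close> continuations of the
  output by at most \<open>b\<close> letters.\<close>

definition KB :: "nat \<Rightarrow> nat" where "KB b = KD * KR ^ (Suc b * k ^ b)"

text \<open>The budget for output once the lag has reached \<open>N\<close>.\<close>

definition b0 :: nat where "b0 = KP + N + emit_rank (await_rank (2 * N + 1))"

definition short_len :: nat where "short_len = KP + N + b0 + KB b0"

text \<open>A bound on the number of positions, each being a budget up to \<open>Suc b0\<close>, two
  words of length at most \<open>short_len\<close>, and a state. A decreasing chain of sets of
  positions is stable after so many steps.\<close>

definition rounds :: nat where
  "rounds = Suc (Suc b0) * ((Suc short_len * k ^ short_len) * ((Suc short_len * k ^ short_len) * Q))"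

text \<open>Under a budget a block has at most \<open>b0\<close> letters. In the initial phase it
  may exceed the current input by less than \<open>N\<close>, and within the game that input is
  shorter than \<open>rounds\<close>.\<close>

definition block_len :: nat where "block_len = b0 + N + rounds"
definition word_len :: nat where "word_len = rounds * Suc block_len"

end

text \<open>Finite shiftlag enters only through \<open>rank_S\<close> for the source and
  \<open>few_shifts\<close> for the target. The target is given by a complete deterministic
  automaton, so that the word produced so far determines one state.\<close>

locale game = game_bounds k N Q KR for k N Q KR :: nat +
  fixes q0 :: nat and S T :: "(nat \<times> nat) list set"
    and d :: "nat \<Rightarrow> nat \<times> nat \<Rightarrow> nat" and FT :: "nat set"
  assumes d_less: "\<And>q a. q < Q \<Longrightarrow> d q a < Q" and q0_less: "q0 < Q" and k_pos: "0 < k"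
    and S_letters: "\<And>w. w \<in> S \<Longrightarrow> set w \<subseteq> Sigma_io k" and T_letters: "\<And>w. w \<in> T \<Longrightarrow> set w \<subseteq> Sigma_io k"
    and T_iff: "\<And>w. set w \<subseteq> Sigma_io k \<Longrightarrow> w \<in> T \<longleftrightarrow> foldl d q0 w \<in> FT"
    and rank_S: "rank KR (\<lambda>\<rho>. (\<rho> 1, \<rho> 2) \<in> sem_lang S)"
    and few_shifts: "\<And>u v. u @ v \<in> T \<Longrightarrow> int N \<le> \<bar>balance u\<bar> \<Longrightarrow> chg (map fst v) \<le> 2 * N"
begin

definition R :: "nat list \<Rightarrow> nat list \<Rightarrow> bool" where "R x y \<longleftrightarrow> (x, y) \<in> sem_lang S"
definition dm :: "nat list \<Rightarrow> bool" where "dm x \<longleftrightarrow> (\<exists>y. R x y)"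

abbreviation words :: "nat list set" where "words \<equiv> {x. set x \<subseteq> {..<k}}"
abbreviation after :: "nat \<Rightarrow> nat \<Rightarrow> nat list \<Rightarrow> nat" where "after e q z \<equiv> foldl d q (map (Pair e) z)"

lemma set_pr: "set w \<subseteq> Sigma_io k \<Longrightarrow> set (pr e w) \<subseteq> {..<k}"
  by (auto simp: pr_def Sigma_io_def Sigma_def)

lemma set_Pair: "e \<in> {1, 2} \<Longrightarrow> set z \<subseteq> {..<k} \<Longrightarrow> set (map (Pair e) z) \<subseteq> Sigma_io k"
  by (auto simp: Sigma_io_def Sigma_def)

lemma R_letters: "R x y \<Longrightarrow> set x \<subseteq> {..<k} \<and> set y \<subseteq> {..<k}"
  using S_letters set_pr by (fastforce simp: R_def sem_lang_def sem_pr)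

lemma dm_letters: "dm x \<Longrightarrow> set x \<subseteq> {..<k}"
  using R_letters by (auto simp: dm_def)

lemma foldl_less: "q < Q \<Longrightarrow> foldl d q w < Q"
  by (induction w arbitrary: q) (auto simp: d_less)

text \<open>A configuration \<open>(x, y, q)\<close> consists of the input read, the output produced and the state of \<open>T\<close>.  The
  output block \<open>z\<close> must contain the point of acceptance if the input may end here.\<close>

definition accepts :: "nat list \<Rightarrow> nat list \<Rightarrow> nat \<Rightarrow> nat list \<Rightarrow> bool" where
  "accepts x y q z \<longleftrightarrow> (dm x \<longrightarrow> (\<exists>z1. prefix z1 z \<and> R x (y @ z1) \<and> after 2 q z1 \<in> FT))"

definition emit :: "(nat \<Rightarrow> nat list \<Rightarrow> nat list \<Rightarrow> nat \<Rightarrow> bool) \<Rightarrow> nat \<Rightarrow> nat list \<Rightarrow> nat list \<Rightarrow> nat \<Rightarrow> bool" where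
  "emit e b x y q \<longleftrightarrow> (\<exists>z\<in>words. length z \<le> b \<and> accepts x y q z \<and> e (b - length z) x (y @ z) (after 2 q z))"

text \<open>\<open>await j b\<close>: while reading input, at most \<open>j\<close> further output blocks of total length at most \<open>b\<close> suffice.\<close>

primrec await :: "nat \<Rightarrow> nat \<Rightarrow> nat list \<Rightarrow> nat list \<Rightarrow> nat \<Rightarrow> bool" where
  "await 0 = (\<lambda>b x y q. \<forall>s. s \<noteq> [] \<longrightarrow> \<not> dm (x @ s))"
| "await (Suc j) = (\<lambda>b x y q. \<forall>s. s \<noteq> [] \<and> dm (x @ s) \<longrightarrow>
     (R (x @ s) y \<and> after 1 q s \<in> FT) \<or>
     (\<exists>s1. s1 \<noteq> [] \<and> prefix s1 s \<and> emit (await j) b (x @ s1) y (after 1 q s1)))"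

lemma emit_mono:
  assumes "emit e b x y q" "b \<le> b'" "\<And>b x y q b'. e b x y q \<Longrightarrow> b \<le> b' \<Longrightarrow> e b' x y q"
  shows "emit e b' x y q"
proof -
  obtain z where z: "z \<in> words" "length z \<le> b" "accepts x y q z" "e (b - length z) x (y @ z) (after 2 q z)"
    using assms(1) unfolding emit_def by blast
  then have "e (b' - length z) x (y @ z) (after 2 q z)"
    by (intro assms(3)[OF z(4)] diff_le_mono assms(2))
  then show ?thesis using z assms(2) unfolding emit_def by (intro bexI[of _ z]) auto
qed

lemma await_mono: "await j b x y q \<Longrightarrow> b \<le> b' \<Longrightarrow> await j b' x y q"
proof (induction j arbitrary: b x y q b')
  case (Suc j)
  have "emit (await j) b x y q \<Longrightarrow> emit (await j) b' x y q" for x y q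
    by (rule emit_mono[OF _ Suc.prems(2)]) (auto intro: Suc.IH)
  then show ?case using Suc.prems(1) unfolding await.simps by blast
qed simp

subsection \<open>The waiting game has finite rank\<close>

text \<open>Track 1 is the input and track 2 the output. Track 0 holds the budget by its length
  alone, as a bound on old and new output together; hence the same track remains correct after track
  2 has been prolonged.\<close>

definition await_rel :: "nat \<Rightarrow> nat \<Rightarrow> asg \<Rightarrow> bool" where
  "await_rel j q \<rho> \<longleftrightarrow> length (\<rho> 2) \<le> length (\<rho> 0) \<and> await j (length (\<rho> 0) - length (\<rho> 2)) (\<rho> 1) (\<rho> 2) q"

definition emit_rel :: "nat \<Rightarrow> nat \<Rightarrow> asg \<Rightarrow> bool" where
  "emit_rel j q \<rho> \<longleftrightarrow> length (\<rho> 2) \<le> length (\<rho> 0) \<and>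
     emit (await j) (length (\<rho> 0) - length (\<rho> 2)) (\<rho> 1) (\<rho> 2) q"

lemma rank_R: "rank KR (\<lambda>\<rho>. R (\<rho> a) (\<rho> b))"
  using rank_subst[OF rank_S, of "\<lambda>t. if t = 1 then a else b"] by (simp add: R_def)

lemma rank_dm: "rank KD (\<lambda>\<rho>. dm (\<rho> a))"
  using rank_subst[OF rank_ex[OF rank_R[of 1 2], of 2], of "\<lambda>t. a"] by (simp add: dm_def KD_def)

lemma KR_pos: "0 < KR" and KD_pos: "0 < KD"
  using rank_S unfolding rank_def by (auto simp: KD_def intro: gr0I)

abbreviation step :: "nat \<Rightarrow> nat \<Rightarrow> nat \<Rightarrow> nat" where "step e \<equiv> \<lambda>q c. d q (e, c)"

lemma extends_step: "extends k (step e) q q' x X \<longleftrightarrow> (\<exists>z\<in>words. X = x @ z \<and> after e q z = q')"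
  by (auto simp: extends_def foldl_map)

lemma extends_trivial: "extends k (\<lambda>_ _. 0) 0 0 x X \<longleftrightarrow> (\<exists>z\<in>words. X = x @ z)"
proof -
  have "foldl (\<lambda>_ _. 0) 0 z = (0 :: nat)" for z :: "nat list" by (induction z) auto
  then show ?thesis by (auto simp: extends_def)
qed

lemma rank_step: "q < Q \<Longrightarrow> rank (Suc Q) (\<lambda>\<rho>. extends k (step e) q q' (\<rho> a) (\<rho> b))"
  by (rule rank_extends) (auto simp: d_less)

lemma rank_trivial: "rank 2 (\<lambda>\<rho>. extends k (\<lambda>_ _. 0) 0 0 (\<rho> a) (\<rho> b))"
  using rank_extends[of 1 "\<lambda>_ _. 0" 0] by (simp add: numeral_2_eq_2)

lemma rank_steps_in: "q < Q \<Longrightarrow> rank KX (\<lambda>\<rho>. \<exists>q'<Q. q' \<in> F \<and> extends k (step e) q q' (\<rho> a) (\<rho> b))"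
  unfolding KX_def
proof (rule rank_ex_less)
  fix q' assume "q < Q"
  then show "rank (Suc Q) (\<lambda>\<rho>. q' \<in> F \<and> extends k (step e) q q' (\<rho> a) (\<rho> b))"
    using rank_step rank_mono[OF rank_False] by (cases "q' \<in> F") auto
qed

lemma steps_in: "q < Q \<Longrightarrow> (\<exists>q'<Q. q' \<in> F \<and> extends k (step e) q q' x X) \<longleftrightarrow>
    (\<exists>z\<in>words. X = x @ z \<and> after e q z \<in> F)"
  unfolding extends_step using foldl_less by blast

text \<open>\<open>emit\<close> as a formula on tracks: track 3 is the output after the block, track
  4 the output at the point of acceptance. The continuation is read with track 3 in the place of
  track 2.\<close>

lemma rank_emit:
  assumes "\<And>q. q < Q \<Longrightarrow> rank e (await_rel j q)" and q: "q < Q"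
  shows "rank (emit_rank e) (emit_rel j q)"
proof -
  define \<Theta> where "\<Theta> \<rho> \<longleftrightarrow> extends k (\<lambda>_ _. 0) 0 0 (\<rho> 4) (\<rho> 3) \<and>
    (\<exists>q'<Q. q' \<in> FT \<and> extends k (step 2) q q' (\<rho> 2) (\<rho> 4)) \<and> R (\<rho> 1) (\<rho> 4)" for \<rho> :: asg
  define \<Psi> where "\<Psi> \<rho> \<longleftrightarrow> (\<exists>q'<Q. extends k (step 2) q q' (\<rho> 2) (\<rho> 3) \<and>
      await_rel j q' (\<lambda>t. \<rho> (if t = 2 then 3 else t))) \<and>
    (\<not> dm (\<rho> 1) \<or> (\<exists>Y. \<Theta> (\<rho>(4 := Y))))" for \<rho> :: asg
  have \<Theta>: "rank (2 * (KX * KR)) \<Theta>"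
    unfolding \<Theta>_def by (intro rank_conj rank_trivial rank_steps_in rank_R q)
  have sub: "rank e (\<lambda>\<rho>. await_rel j q' (\<lambda>t. \<rho> (if t = 2 then 3 else t)))" if "q' < Q" for q'
    by (rule rank_subst[OF assms(1)[OF that]])
  have "rank ((Suc Q * e) ^ Q * (KD * 2 ^ (2 * (2 * (KX * KR))))) \<Psi>"
    unfolding \<Psi>_def
    by (intro rank_conj rank_disj rank_not rank_dm rank_ex[OF \<Theta>] rank_ex_less rank_step q sub)
  from rank_ex[OF this, of 3]
  have "rank (emit_rank e) (\<lambda>\<rho>. length (\<rho> 2) \<le> length (\<rho> 0) \<and> (\<exists>X. \<Psi> (\<rho>(3 := X))))"
    unfolding emit_rank_def by (intro rank_conj rank_length_le)
  moreover have "(\<exists>X. \<Psi> (\<rho>(3 := X))) \<longleftrightarrow> emit (await j) (length (\<rho> 0) - length (\<rho> 2)) (\<rho> 1) (\<rho> 2) q"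
    if len: "length (\<rho> 2) \<le> length (\<rho> 0)" for \<rho>
  proof -
    have \<Theta>_iff: "(\<exists>Y. \<Theta> (\<rho>(3 := \<rho> 2 @ z, 4 := Y))) \<longleftrightarrow>
        (\<exists>z1. prefix z1 z \<and> R (\<rho> 1) (\<rho> 2 @ z1) \<and> after 2 q z1 \<in> FT)" if "z \<in> words" for z
    proof -
      have pre: "(\<exists>zs\<in>words. \<rho> 2 @ z = (\<rho> 2 @ z1) @ zs) \<longleftrightarrow> prefix z1 z" for z1
        using that by (auto simp: prefix_def)
      have \<Theta>: "\<Theta> (\<rho>(3 := \<rho> 2 @ z, 4 := Y)) \<longleftrightarrow> (\<exists>zs\<in>words. \<rho> 2 @ z = Y @ zs) \<and>
          (\<exists>z1\<in>words. Y = \<rho> 2 @ z1 \<and> after 2 q z1 \<in> FT) \<and> R (\<rho> 1) Y" for Y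
        unfolding \<Theta>_def extends_trivial steps_in[OF q] by simp
      have "(\<exists>Y. \<Theta> (\<rho>(3 := \<rho> 2 @ z, 4 := Y))) \<longleftrightarrow>
          (\<exists>z1\<in>words. prefix z1 z \<and> after 2 q z1 \<in> FT \<and> R (\<rho> 1) (\<rho> 2 @ z1))"
      proof
        assume "\<exists>Y. \<Theta> (\<rho>(3 := \<rho> 2 @ z, 4 := Y))"
        then obtain Y z1 where "\<exists>zs\<in>words. \<rho> 2 @ z = Y @ zs" "z1 \<in> words" "Y = \<rho> 2 @ z1"
          "after 2 q z1 \<in> FT" "R (\<rho> 1) Y" unfolding \<Theta> by blast
        then show "\<exists>z1\<in>words. prefix z1 z \<and> after 2 q z1 \<in> FT \<and> R (\<rho> 1) (\<rho> 2 @ z1)"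
          unfolding pre[symmetric] by (intro bexI[of _ z1]) simp_all
      next
        assume "\<exists>z1\<in>words. prefix z1 z \<and> after 2 q z1 \<in> FT \<and> R (\<rho> 1) (\<rho> 2 @ z1)"
        then obtain z1 where "z1 \<in> words" "prefix z1 z" "after 2 q z1 \<in> FT" "R (\<rho> 1) (\<rho> 2 @ z1)" by blast
        then show "\<exists>Y. \<Theta> (\<rho>(3 := \<rho> 2 @ z, 4 := Y))"
          unfolding \<Theta> pre[symmetric] by (intro exI[of _ "\<rho> 2 @ z1"]) simp
      qed
      then show ?thesis using that set_mono_prefix[of _ z] by blast
    qed
    have "(\<exists>X. \<Psi> (\<rho>(3 := X))) \<longleftrightarrow> (\<exists>z\<in>words. \<Psi> (\<rho>(3 := \<rho> 2 @ z)))"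
      unfolding \<Psi>_def extends_step by auto
    also have "\<dots> \<longleftrightarrow> emit (await j) (length (\<rho> 0) - length (\<rho> 2)) (\<rho> 1) (\<rho> 2) q"
      unfolding emit_def
    proof (intro bex_cong refl)
      fix z assume z: "z \<in> words"
      have "(\<exists>q'<Q. extends k (step 2) q q' (\<rho> 2) (\<rho> 2 @ z) \<and> await_rel j q' (\<lambda>t. (\<rho>(3 := \<rho> 2 @ z)) (if t = 2 then 3 else t)))
          \<longleftrightarrow> await_rel j (after 2 q z) (\<lambda>t. (\<rho>(3 := \<rho> 2 @ z)) (if t = 2 then 3 else t))"
        unfolding extends_step using z foldl_less[OF q] by auto
      also have "\<dots> \<longleftrightarrow> length z \<le> length (\<rho> 0) - length (\<rho> 2) \<and>
          await j (length (\<rho> 0) - length (\<rho> 2) - length z) (\<rho> 1) (\<rho> 2 @ z) (after 2 q z)"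
        using len unfolding await_rel_def by auto
      finally show "\<Psi> (\<rho>(3 := \<rho> 2 @ z)) \<longleftrightarrow> length z \<le> length (\<rho> 0) - length (\<rho> 2) \<and> accepts (\<rho> 1) (\<rho> 2) q z \<and>
          await j (length (\<rho> 0) - length (\<rho> 2) - length z) (\<rho> 1) (\<rho> 2 @ z) (after 2 q z)"
        using \<Theta>_iff[OF z] unfolding \<Psi>_def accepts_def by auto
    qed
    finally show ?thesis .
  qed
  ultimately show ?thesis unfolding emit_rel_def by (simp cong: conj_cong)
qed

text \<open>The formula is the negation: \<open>\<Psi>\<close> describes an input that defeats the
  output player. Track 3 is that input, and for \<open>Suc j\<close> track 4 is the part of it after
  which a block might have been emitted.\<close>

lemma rank_await: "q < Q \<Longrightarrow> rank (await_rank j) (await_rel j q)"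
proof (induction j arbitrary: q)
  case 0
  define \<Psi> where "\<Psi> \<rho> \<longleftrightarrow> (\<exists>q'<Q. q' \<in> UNIV \<and> extends k (step 1) q q' (\<rho> 1) (\<rho> 3)) \<and> \<rho> 3 \<noteq> \<rho> 1 \<and> dm (\<rho> 3)"
    for \<rho> :: asg
  have "rank (KX * (2 * KD)) \<Psi>"
    unfolding \<Psi>_def by (intro rank_conj rank_not rank_steps_in rank_dm rank_eq 0)
  from rank_ex[OF this, of 3]
  have "rank (await_rank 0) (\<lambda>\<rho>. length (\<rho> 2) \<le> length (\<rho> 0) \<and> \<not> (\<exists>X. \<Psi> (\<rho>(3 := X))))"
    unfolding await_rank.simps by (intro rank_conj rank_not rank_length_le)
  moreover have "\<not> (\<exists>X. \<Psi> (\<rho>(3 := X))) \<longleftrightarrow> await 0 b (\<rho> 1) (\<rho> 2) q" for b \<rho>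
  proof -
    have \<Psi>: "\<Psi> (\<rho>(3 := X)) \<longleftrightarrow> (\<exists>s\<in>words. X = \<rho> 1 @ s) \<and> X \<noteq> \<rho> 1 \<and> dm X" for X
      unfolding \<Psi>_def steps_in[OF 0] by simp
    show ?thesis
    proof
      assume no: "\<not> (\<exists>X. \<Psi> (\<rho>(3 := X)))"
      show "await 0 b (\<rho> 1) (\<rho> 2) q"
        unfolding await.simps
      proof (intro allI impI notI)
        fix s assume s: "s \<noteq> []" "dm (\<rho> 1 @ s)"
        then have "\<Psi> (\<rho>(3 := \<rho> 1 @ s))"
          unfolding \<Psi> using dm_letters[OF s(2)] by simp
        with no show False by blast
      qed
    next
      assume no: "await 0 b (\<rho> 1) (\<rho> 2) q"
      show "\<not> (\<exists>X. \<Psi> (\<rho>(3 := X)))"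
      proof
        assume "\<exists>X. \<Psi> (\<rho>(3 := X))"
        then obtain X s where "X = \<rho> 1 @ s" "X \<noteq> \<rho> 1" "dm X" unfolding \<Psi> by blast
        with no show False by simp
      qed
    qed
  qed
  ultimately show ?case unfolding await_rel_def by simp
next
  case (Suc j)
  define \<Theta> where "\<Theta> \<rho> \<longleftrightarrow> \<rho> 4 \<noteq> \<rho> 1 \<and> extends k (\<lambda>_ _. 0) 0 0 (\<rho> 4) (\<rho> 3) \<and>
    (\<exists>q'<Q. extends k (step 1) q q' (\<rho> 1) (\<rho> 4) \<and> emit_rel j q' (\<lambda>t. \<rho> (if t = 1 then 4 else t)))" for \<rho> :: asg
  define \<Psi> where "\<Psi> \<rho> \<longleftrightarrow> (\<exists>q'<Q. q' \<in> UNIV \<and> extends k (step 1) q q' (\<rho> 1) (\<rho> 3)) \<and> \<rho> 3 \<noteq> \<rho> 1 \<and> dm (\<rho> 3) \<and>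
    \<not> (R (\<rho> 3) (\<rho> 2) \<and> (\<exists>q'<Q. q' \<in> FT \<and> extends k (step 1) q q' (\<rho> 1) (\<rho> 3))) \<and>
    \<not> (\<exists>Y. \<Theta> (\<rho>(4 := Y)))" for \<rho> :: asg
  have sub: "rank (emit_rank (await_rank j)) (\<lambda>\<rho>. emit_rel j q' (\<lambda>t. \<rho> (if t = 1 then 4 else t)))" if "q' < Q" for q'
    by (rule rank_subst[OF rank_emit[OF Suc.IH that]])
  have \<Theta>: "rank (2 * (2 * (Suc Q * emit_rank (await_rank j)) ^ Q)) \<Theta>"
    unfolding \<Theta>_def
    by (intro rank_conj rank_not rank_eq rank_trivial rank_ex_less rank_step Suc.prems sub)
  have "rank (KX * (2 * (KD * ((KR * KX) * 2 ^ (2 * (2 * (2 * (Suc Q * emit_rank (await_rank j)) ^ Q))))))) \<Psi>"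
    unfolding \<Psi>_def
    by (intro rank_conj rank_not rank_steps_in rank_eq rank_dm rank_R rank_ex[OF \<Theta>] Suc.prems)
  from rank_ex[OF this, of 3]
  have "rank (await_rank (Suc j)) (\<lambda>\<rho>. length (\<rho> 2) \<le> length (\<rho> 0) \<and> \<not> (\<exists>X. \<Psi> (\<rho>(3 := X))))"
    unfolding await_rank.simps by (intro rank_conj rank_not rank_length_le)
  moreover have "\<not> (\<exists>X. \<Psi> (\<rho>(3 := X))) \<longleftrightarrow> await (Suc j) (length (\<rho> 0) - length (\<rho> 2)) (\<rho> 1) (\<rho> 2) q"
    if len: "length (\<rho> 2) \<le> length (\<rho> 0)" for \<rho>
  proof -
    have \<Theta>_iff: "(\<exists>Y. \<Theta> (\<rho>(3 := \<rho> 1 @ s, 4 := Y))) \<longleftrightarrow> (\<exists>s1. s1 \<noteq> [] \<and> prefix s1 s \<and>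
        emit (await j) (length (\<rho> 0) - length (\<rho> 2)) (\<rho> 1 @ s1) (\<rho> 2) (after 1 q s1))" if s: "s \<in> words" for s
    proof -
      have "(\<exists>Y. \<Theta> (\<rho>(3 := \<rho> 1 @ s, 4 := Y))) \<longleftrightarrow> (\<exists>s1\<in>words. \<Theta> (\<rho>(3 := \<rho> 1 @ s, 4 := \<rho> 1 @ s1)))"
        unfolding \<Theta>_def extends_step by auto
      also have "\<dots> \<longleftrightarrow> (\<exists>s1\<in>words. s1 \<noteq> [] \<and> prefix s1 s \<and>
          emit (await j) (length (\<rho> 0) - length (\<rho> 2)) (\<rho> 1 @ s1) (\<rho> 2) (after 1 q s1))"
      proof (intro bex_cong refl)
        fix s1 assume s1: "s1 \<in> words"
        have "(\<exists>q'<Q. extends k (step 1) q q' (\<rho> 1) (\<rho> 1 @ s1) \<and> emit_rel j q' (\<rho>(1 := \<rho> 1 @ s1)))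
            \<longleftrightarrow> emit_rel j (after 1 q s1) (\<rho>(1 := \<rho> 1 @ s1))"
          unfolding extends_step using s1 foldl_less[OF Suc.prems] by auto
        moreover have "emit_rel j q' (\<lambda>t. (\<rho>(3 := \<rho> 1 @ s, 4 := \<rho> 1 @ s1)) (if t = 1 then 4 else t)) \<longleftrightarrow>
            emit_rel j q' (\<rho>(1 := \<rho> 1 @ s1))" for q'
          unfolding emit_rel_def by simp
        moreover have "(\<exists>z\<in>words. \<rho> 1 @ s = (\<rho> 1 @ s1) @ z) \<longleftrightarrow> prefix s1 s"
          using s by (auto simp: prefix_def)
        ultimately show "\<Theta> (\<rho>(3 := \<rho> 1 @ s, 4 := \<rho> 1 @ s1)) \<longleftrightarrow> s1 \<noteq> [] \<and> prefix s1 s \<and>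
            emit (await j) (length (\<rho> 0) - length (\<rho> 2)) (\<rho> 1 @ s1) (\<rho> 2) (after 1 q s1)"
          unfolding \<Theta>_def extends_trivial emit_rel_def using len by simp
      qed
      also have "\<dots> \<longleftrightarrow> (\<exists>s1. s1 \<noteq> [] \<and> prefix s1 s \<and>
          emit (await j) (length (\<rho> 0) - length (\<rho> 2)) (\<rho> 1 @ s1) (\<rho> 2) (after 1 q s1))"
      proof -
        have gen: "(\<exists>s1\<in>words. C s1 \<and> D s1 \<and> A s1) = (\<exists>s1. C s1 \<and> D s1 \<and> A s1)"
          if "\<And>s1. D s1 \<Longrightarrow> s1 \<in> words" for A C D using that by blast
        show ?thesis by (rule gen) (use s set_mono_prefix in blast)
      qed
      finally show ?thesis .
    qed
    have "(\<exists>X. \<Psi> (\<rho>(3 := X))) \<longleftrightarrow> (\<exists>s\<in>words. \<Psi> (\<rho>(3 := \<rho> 1 @ s)))"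
      unfolding \<Psi>_def steps_in[OF Suc.prems] by auto
    also have "\<dots> \<longleftrightarrow> (\<exists>s\<in>words. s \<noteq> [] \<and> dm (\<rho> 1 @ s) \<and> \<not> (R (\<rho> 1 @ s) (\<rho> 2) \<and> after 1 q s \<in> FT) \<and>
        \<not> (\<exists>s1. s1 \<noteq> [] \<and> prefix s1 s \<and>
        emit (await j) (length (\<rho> 0) - length (\<rho> 2)) (\<rho> 1 @ s1) (\<rho> 2) (after 1 q s1)))"
      by (intro bex_cong refl) (unfold \<Psi>_def steps_in[OF Suc.prems], use \<Theta>_iff in auto)
    finally have iff: "(\<exists>X. \<Psi> (\<rho>(3 := X))) \<longleftrightarrow> (\<exists>s\<in>words. s \<noteq> [] \<and> dm (\<rho> 1 @ s) \<and>
        \<not> (R (\<rho> 1 @ s) (\<rho> 2) \<and> after 1 q s \<in> FT) \<and> \<not> (\<exists>s1. s1 \<noteq> [] \<and> prefix s1 s \<and>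
        emit (await j) (length (\<rho> 0) - length (\<rho> 2)) (\<rho> 1 @ s1) (\<rho> 2) (after 1 q s1)))" .
    have gen: "\<not> (\<exists>s\<in>words. C s \<and> D s \<and> \<not> A s \<and> \<not> B s) \<longleftrightarrow> (\<forall>s. C s \<and> D s \<longrightarrow> A s \<or> B s)"
      if "\<And>s. D s \<Longrightarrow> s \<in> words" for A B C D using that by blast
    have "s \<in> words" if "dm (\<rho> 1 @ s)" for s using dm_letters[OF that] by simp
    then show ?thesis unfolding iff await.simps by (rule gen)
  qed
  ultimately show ?case unfolding await_rel_def by (simp cong: conj_cong)
qed

text \<open>Shortening track 0 with \<open>rank_shorten\<close> lowers the budget, so whenever some
  budget suffices, one bounded by the lengths and the rank does.\<close>

lemma emit_threshold:
  assumes q: "q < Q" and e: "emit (await j) b x y q" and m: "length x \<le> m" "length y \<le> m"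
  shows "emit (await j) (m + emit_rank (await_rank j)) x y q"
proof -
  \<comment> \<open>The length \<open>length y + b\<close> leaves exactly \<open>b\<close> letters
    for new output.\<close>
  define \<rho> where "\<rho> = (\<lambda>t::nat. if t = 0 then replicate (length y + b) 0 else if t = 1 then x else if t = 2 then y else [])"
  have "emit_rel j q \<rho>" using e by (simp add: emit_rel_def \<rho>_def)
  moreover have "length (\<rho> s) \<le> m" if "s \<noteq> 0" for s using m that by (simp add: \<rho>_def)
  ultimately obtain z where z: "length z \<le> m + emit_rank (await_rank j)" "emit_rel j q (\<rho>(0 := z))"
    using rank_shorten[OF rank_emit[OF rank_await q], of j \<rho> 0 m] by blast
  then have "emit (await j) (length z - length y) x y q"
    by (simp add: emit_rel_def \<rho>_def)
  then show ?thesis by (rule emit_mono) (use z in \<open>auto intro: await_mono\<close>)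
qed

subsection \<open>Equivalent configurations\<close>

text \<open>Nerode equivalence of pairs, truncated on the output side: with \<open>b\<close> letters
  of output left, longer continuations of \<open>y\<close> cannot occur. The input side is
  unrestricted.\<close>

definition sim :: "nat \<Rightarrow> nat list \<Rightarrow> nat list \<Rightarrow> nat list \<Rightarrow> nat list \<Rightarrow> bool" where
  "sim b x y x' y' \<longleftrightarrow> (\<forall>s t. length t \<le> b \<longrightarrow> R (x @ s) (y @ t) = R (x' @ s) (y' @ t)) \<and>
     (\<forall>s. dm (x @ s) = dm (x' @ s))"

lemma sim_refl [simp]: "sim b x y x y"
  by (simp add: sim_def)

lemma sim_trans: "sim b x y x' y' \<Longrightarrow> sim b x' y' x'' y'' \<Longrightarrow> sim b x y x'' y''"
  by (simp add: sim_def)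

lemma sim_sym: "sim b x y x' y' \<Longrightarrow> sim b x' y' x y"
  by (simp add: sim_def)

lemma sim_le: "sim b x y x' y' \<Longrightarrow> b' \<le> b \<Longrightarrow> sim b' x y x' y'"
  by (auto simp: sim_def)

lemma sim_append:
  assumes "sim b x y x' y'" "length z + b' \<le> b"
  shows "sim b' (x @ s) (y @ z) (x' @ s) (y' @ z)"
  using assms by (auto simp: sim_def)

lemma accepts_sim:
  assumes "sim b x y x' y'" "length z \<le> b" shows "accepts x y q z \<longleftrightarrow> accepts x' y' q z"
proof -
  have "R x (y @ t) = R x' (y' @ t)" if "length t \<le> b" for t
    using assms(1) that unfolding sim_def by (metis append_Nil2)
  moreover have "dm x = dm x'" using assms(1) unfolding sim_def by (metis append_Nil2)
  moreover have "length z1 \<le> b" if "prefix z1 z" for z1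
    using prefix_length_le[OF that] assms(2) by simp
  ultimately show ?thesis unfolding accepts_def by blast
qed

lemma emit_sim:
  assumes "\<And>b x y x' y' q. sim b x y x' y' \<Longrightarrow> e b x y q \<longleftrightarrow> e b x' y' q" and s: "sim b x y x' y'"
  shows "emit e b x y q \<longleftrightarrow> emit e b x' y' q"
  unfolding emit_def
proof (intro bex_cong refl conj_cong)
  fix z :: "nat list" assume z: "length z \<le> b"
  show "accepts x y q z = accepts x' y' q z" by (rule accepts_sim[OF s z])
  show "e (b - length z) x (y @ z) (after 2 q z) = e (b - length z) x' (y' @ z) (after 2 q z)"
    using sim_append[OF s, of z "b - length z" "[]"] z by (intro assms(1)) simp
qed

lemma await_sim: "sim b x y x' y' \<Longrightarrow> await j b x y q \<longleftrightarrow> await j b x' y' q"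
proof (induction j arbitrary: b x y x' y' q)
  case 0
  then show ?case by (simp add: sim_def)
next
  case (Suc j)
  have "emit (await j) b (x @ s) y q = emit (await j) b (x' @ s) y' q" for s q
    by (rule emit_sim[OF Suc.IH]) (use sim_append[OF Suc.prems, of "[]" b s] in auto)
  moreover have "dm (x @ s) = dm (x' @ s)" "R (x @ s) y = R (x' @ s) y'" for s
    using Suc.prems unfolding sim_def by (blast, metis append_Nil2 le0 list.size(3))
  ultimately show ?case by simp
qed

text \<open>Among the \<open>KP + 1\<close> cuts up to \<open>KP\<close> two have the same classes
  for \<open>R\<close> and \<open>dm\<close>. Both words reach beyond them, so the segment in
  between is deleted from both and the lag is preserved.\<close>

lemma cut_both:
  assumes "KP < length x" "KP < length y"
  shows "\<exists>x' y'. length x' < length x \<and> set x' \<subseteq> set x \<and> set y' \<subseteq> set y \<and>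
    int (length x) - int (length y) = int (length x') - int (length y') \<and> (\<forall>b. sim b x y x' y')"
proof -
  obtain c where c: "\<forall>p \<mu>. c p \<mu> < KR" "classifies c (\<lambda>\<rho>. R (\<rho> 1) (\<rho> 2))"
    using rank_R[of 1 2] unfolding rank_def by blast
  obtain e where e: "\<forall>p \<mu>. e p \<mu> < KD" "classifies e (\<lambda>\<rho>. dm (\<rho> 1))"
    using rank_dm[of 1] unfolding rank_def by blast
  define \<mu> where "\<mu> i = (\<lambda>t::nat. if t = 1 then take i x else if t = 2 then take i y else [])" for i
  have "\<not> inj_on (\<lambda>i. (c i (\<mu> i), e i (\<mu> i))) {..KP}"
  proof
    assume "inj_on (\<lambda>i. (c i (\<mu> i), e i (\<mu> i))) {..KP}"
    then have "card {..KP} \<le> card ({..<KR} \<times> {..<KD})" by (rule card_inj_on_le) (use c e in auto)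
    then show False by (simp add: KP_def card_cartesian_product)
  qed
  then obtain i j where ij: "j \<le> KP" "i < j" "c i (\<mu> i) = c j (\<mu> j)" "e i (\<mu> i) = e j (\<mu> j)"
    using linorder_inj_onI'[of "{..KP}" "\<lambda>i. (c i (\<mu> i), e i (\<mu> i))"] by (meson atMost_iff prod.inject)
  define \<nu> where "\<nu> s t' = (\<lambda>t::nat. if t = 1 then drop j x @ s else if t = 2 then drop j y @ t' else [])" for s t'
  have fits: "fits i (\<mu> i) (\<nu> s t')" "fits j (\<mu> j) (\<nu> s t')" for s t'
    using ij assms by (auto simp: fits_def \<mu>_def \<nu>_def)
  define x' where "x' = take i x @ drop j x"
  define y' where "y' = take i y @ drop j y"
  have "cat (\<mu> j) (\<nu> s t') 1 = x @ s" "cat (\<mu> j) (\<nu> s t') 2 = y @ t'"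
    "cat (\<mu> i) (\<nu> s t') 1 = x' @ s" "cat (\<mu> i) (\<nu> s t') 2 = y' @ t'" for s t'
    by (simp_all add: cat_def \<mu>_def \<nu>_def x'_def y'_def flip: append_assoc)
  then have "sim b x y x' y'" for b
    using classifiesD[OF c(2) fits ij(3)] classifiesD[OF e(2) fits ij(4)] unfolding sim_def by metis
  then show ?thesis
    using ij assms by (rule_tac x = x' in exI, rule_tac x = y' in exI)
      (auto simp: x'_def y'_def dest: in_set_takeD in_set_dropD)
qed

lemma card_words:
  shows "finite {t. set t \<subseteq> {..<k} \<and> length t \<le> b}"
    and "card {t. set t \<subseteq> {..<k} \<and> length t \<le> b} \<le> Suc b * k ^ b"
proof -
  show "finite {t. set t \<subseteq> {..<k} \<and> length t \<le> b}" by (rule finite_lists_length_le) simp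
  have "card {t. set t \<subseteq> {..<k} \<and> length t \<le> b} = (\<Sum>i\<le>b. k ^ i)"
    by (subst card_lists_length_le) auto
  also have "\<dots> \<le> card {..b} * k ^ b"
    using k_pos sum_bounded_above[of "{..b}" "\<lambda>i. k ^ i" "k ^ b"] by (simp add: power_increasing)
  finally show "card {t. set t \<subseteq> {..<k} \<and> length t \<le> b} \<le> Suc b * k ^ b" by simp
qed

text \<open>When the input is far ahead, the cuts are made beyond the point
  \<open>length y + b\<close> that the output can still reach. There the output track has ended for
  every admissible continuation, and the input can be shortened alone.\<close>

lemma cut_input:
  assumes "length y + b + KB b < length x"
  shows "\<exists>x'. length x' < length x \<and> set x' \<subseteq> set x \<and> length y + b \<le> length x' \<and> sim b x y x' y"
proof -
  obtain c where c: "\<forall>p \<mu>. c p \<mu> < KR" "classifies c (\<lambda>\<rho>. R (\<rho> 1) (\<rho> 2))"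
    using rank_R[of 1 2] unfolding rank_def by blast
  obtain e where e: "\<forall>p \<mu>. e p \<mu> < KD" "classifies e (\<lambda>\<rho>. dm (\<rho> 1))"
    using rank_dm[of 1] unfolding rank_def by blast
  define W where "W = {t. set t \<subseteq> {..<k} \<and> length t \<le> b}"
  note W = card_words[of b, folded W_def]
  define \<mu> where "\<mu> t' i = (\<lambda>t::nat. if t = 1 then take i x else if t = 2 then y @ t' else [])" for t' i
  define f where "f i = (e i (\<mu> [] i), restrict (\<lambda>t'. c i (\<mu> t' i)) W)" for i
  define I where "I = {length y + b..length y + b + KB b}"
  have "\<not> inj_on f I"
  proof
    assume "inj_on f I"
    then have "card I \<le> card ({..<KD} \<times> (W \<rightarrow>\<^sub>E {..<KR}))"
      by (rule card_inj_on_le) (use c e W(1) in \<open>auto simp: f_def intro!: finite_PiE\<close>)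
    also have "\<dots> = KD * KR ^ card W" using W(1) by (simp add: card_cartesian_product card_PiE)
    also have "\<dots> \<le> KB b" unfolding KB_def using W(2) KR_pos
      by (intro mult_le_mono2 power_increasing) auto
    finally show False by (simp add: I_def)
  qed
  then obtain i j where ij: "length y + b \<le> i" "j \<le> length y + b + KB b" "i < j" "f i = f j"
    using linorder_inj_onI'[of I f] unfolding I_def by (meson atLeastAtMost_iff)
  define \<nu> where "\<nu> s = (\<lambda>t::nat. if t = 1 then drop j x @ s else [])" for s
  have fits: "fits i (\<mu> t i) (\<nu> s)" "fits j (\<mu> t j) (\<nu> s)" if "length t \<le> b" for s t
    using ij assms that by (auto simp: fits_def \<mu>_def \<nu>_def)
  define x' where "x' = take i x @ drop j x"
  have cat: "cat (\<mu> t j) (\<nu> s) 1 = x @ s" "cat (\<mu> t j) (\<nu> s) 2 = y @ t"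
    "cat (\<mu> t i) (\<nu> s) 1 = x' @ s" "cat (\<mu> t i) (\<nu> s) 2 = y @ t" for s t
    by (simp_all add: cat_def \<mu>_def \<nu>_def x'_def flip: append_assoc)
  have "R (x @ s) (y @ t) = R (x' @ s) (y @ t)" if t: "length t \<le> b" for s t
  proof (cases "t \<in> W")
    case True
    have "restrict (\<lambda>t'. c i (\<mu> t' i)) W t = restrict (\<lambda>t'. c j (\<mu> t' j)) W t"
      using ij(4) unfolding f_def prod.inject by (elim conjE) (rule fun_cong)
    then have "c i (\<mu> t i) = c j (\<mu> t j)" using True by simp
    from classifiesD[OF c(2) fits[OF t, of s] this] show ?thesis unfolding cat by (rule sym)
  next
    case False
    then have "\<not> R u (y @ t)" for u using R_letters[of u "y @ t"] t unfolding W_def by auto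
    then show ?thesis by simp
  qed
  moreover have "dm (x @ s) = dm (x' @ s)" for s
  proof -
    have "e i (\<mu> [] i) = e j (\<mu> [] j)" using ij(4) by (simp add: f_def)
    from classifiesD[OF e(2) fits[of "[]" s] this] show ?thesis unfolding cat by simp
  qed
  ultimately show ?thesis
    using ij assms by (intro exI[of _ x'])
      (auto simp: x'_def sim_def dest: in_set_takeD in_set_dropD)
qed

text \<open>\<open>cut_both\<close> applies until one of the words has length at most
  \<open>KP\<close>; the unchanged lag then bounds the other.\<close>

lemma short_bounded_lag:
  assumes "\<bar>int (length x) - int (length y)\<bar> \<le> int n"
  shows "\<exists>x' y'. length x' \<le> KP + n \<and> length y' \<le> KP + n \<and> set x' \<subseteq> set x \<and> set y' \<subseteq> set y \<and>
    int (length x) - int (length y) = int (length x') - int (length y') \<and> (\<forall>b. sim b x y x' y')"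
  using assms
proof (induction "length x" arbitrary: x y rule: less_induct)
  case less
  show ?case
  proof (cases "KP < length x \<and> KP < length y")
    case True
    then obtain x1 y1 where 1: "length x1 < length x" "set x1 \<subseteq> set x" "set y1 \<subseteq> set y"
      "int (length x) - int (length y) = int (length x1) - int (length y1)" "\<And>b. sim b x y x1 y1"
      using cut_both[of x y] by blast
    have "\<bar>int (length x1) - int (length y1)\<bar> \<le> int n" using 1(4) less.prems by simp
    from less.hyps[OF 1(1) this] obtain x' y' where
      "length x' \<le> KP + n" "length y' \<le> KP + n" "set x' \<subseteq> set x1" "set y' \<subseteq> set y1"
      "int (length x1) - int (length y1) = int (length x') - int (length y')" "\<And>b. sim b x1 y1 x' y'" by blast
    moreover have "sim b x y x' y'" for b by (rule sim_trans) fact+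
    ultimately show ?thesis using 1(2,3,4)
      by (rule_tac x = x' in exI, rule_tac x = y' in exI) auto
  next
    case False
    then show ?thesis using less.prems by (rule_tac x = x in exI, rule_tac x = y in exI) auto
  qed
qed

text \<open>The threshold of \<open>emit_threshold\<close> grows with the words, so the
  configuration is first replaced by an equivalent one of length at most \<open>KP + N\<close>. This
  makes the budget uniform and explains the value of \<open>b0\<close>.\<close>

lemma emit_b0:
  assumes "q < Q" "\<bar>int (length x) - int (length y)\<bar> \<le> int N" "emit (await (2 * N + 1)) b x y q"
  shows "emit (await (2 * N + 1)) b0 x y q"
proof -
  obtain x' y' where short: "length x' \<le> KP + N" "length y' \<le> KP + N" and sim: "\<And>b. sim b x y x' y'"
    using short_bounded_lag[OF assms(2)] by blast
  have "emit (await (2 * N + 1)) b x y q = emit (await (2 * N + 1)) b x' y' q" for b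
    by (rule emit_sim[OF await_sim sim])
  then show ?thesis using assms(3) emit_threshold[OF assms(1) _ short] unfolding b0_def by blast
qed

subsection \<open>The safety game\<close>

text \<open>Budget \<open>Suc b0\<close> stands for the initial phase, in which the lag stays below \<open>N\<close> after every output
  block; it may be left at any time with budget \<open>b0\<close>.\<close>

definition move :: "nat \<Rightarrow> nat list \<Rightarrow> nat list \<Rightarrow> nat list \<Rightarrow> nat \<Rightarrow> bool" where
  "move b x y z b' \<longleftrightarrow> (b \<le> b0 \<and> length z + b' = b) \<or> (b = Suc b0 \<and> length z + b' = b0) \<or>
     (b = Suc b0 \<and> b' = Suc b0 \<and> \<bar>int (length x) - int (length (y @ z))\<bar> < int N)"

definition next_state :: "nat \<Rightarrow> nat list \<Rightarrow> nat \<Rightarrow> nat" where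
  "next_state q z a = foldl d q (map (Pair 2) z @ [(1, a)])"

text \<open>Acceptance is tested in every round, so the output player wins by never getting stuck.
  This justifies approximating the game by the number of rounds.\<close>

primrec safe :: "nat \<Rightarrow> nat \<Rightarrow> nat list \<Rightarrow> nat list \<Rightarrow> nat \<Rightarrow> bool" where
  "safe 0 b x y q = True"
| "safe (Suc L) b x y q = (\<exists>z\<in>words. \<exists>b'. move b x y z b' \<and> accepts x y q z \<and>
     (\<forall>a<k. safe L b' (x @ [a]) (y @ z) (next_state q z a)))"

text \<open>What a sequential automaton provides: an invariant under which blocks of length at most
  \<open>M\<close> can be produced forever. \<open>M\<close> depends on the automaton and no budget
  is imposed; the passage to the game with budgets is made in \<open>plays_safe\<close>.\<close>

definition plays :: "nat \<Rightarrow> nat list \<Rightarrow> nat list \<Rightarrow> nat \<Rightarrow> bool" where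
  "plays M x y q \<longleftrightarrow> (\<exists>I. I x y q \<and> (\<forall>x y q. I x y q \<longrightarrow> (\<exists>z\<in>words. length z \<le> M \<and> accepts x y q z \<and>
     (\<forall>a<k. I (x @ [a]) (y @ z) (next_state q z a)))))"

definition waits :: "nat \<Rightarrow> nat list \<Rightarrow> nat list \<Rightarrow> nat \<Rightarrow> bool" where
  "waits M x y q \<longleftrightarrow> (\<forall>a<k. plays M (x @ [a]) y (d q (1, a)))"

lemma plays_step:
  assumes "plays M x y q"
  obtains z where "z \<in> words" "length z \<le> M" "accepts x y q z" "waits M x (y @ z) (after 2 q z)"
proof -
  obtain I where I: "I x y q" "\<And>x y q. I x y q \<Longrightarrow> \<exists>z\<in>words. length z \<le> M \<and> accepts x y q z \<and>
     (\<forall>a<k. I (x @ [a]) (y @ z) (next_state q z a))"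
    using assms unfolding plays_def by blast
  then obtain z where z: "z \<in> words" "length z \<le> M" "accepts x y q z"
    "\<forall>a<k. I (x @ [a]) (y @ z) (next_state q z a)" by blast
  moreover have "plays M (x @ [a]) (y @ z) (next_state q z a)" if "a < k" for a
    unfolding plays_def using I(2) z(4) that by (intro exI[of _ I]) blast
  ultimately show ?thesis using that by (simp add: waits_def next_state_def)
qed

text \<open>Following the strategy along \<open>s\<close> produces a word accepted from
  \<open>q\<close>. This settles the base case of \<open>waits_await\<close>: where nothing can be
  accepted, no continuation of the input lies in the domain.\<close>

lemma waits_alive:
  "waits M x y q \<Longrightarrow> s \<noteq> [] \<Longrightarrow> dm (x @ s) \<Longrightarrow> \<exists>v. set v \<subseteq> Sigma_io k \<and> foldl d q v \<in> FT"
proof (induction s arbitrary: x y q)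
  case (Cons a s)
  have a: "a < k" using dm_letters[OF Cons.prems(3)] by simp
  then have a': "(1, a) \<in> Sigma_io k" by (simp add: Sigma_io_def Sigma_def)
  from Cons.prems(1) a have "plays M (x @ [a]) y (d q (1, a))" by (simp add: waits_def)
  then obtain z where z: "z \<in> words" "accepts (x @ [a]) y (d q (1, a)) z"
    "waits M (x @ [a]) (y @ z) (after 2 (d q (1, a)) z)" by (rule plays_step)
  show ?case
  proof (cases "s = []")
    case True
    then obtain z1 where "prefix z1 z" "after 2 (d q (1, a)) z1 \<in> FT"
      using z(2) Cons.prems(3) by (auto simp: accepts_def)
    then show ?thesis using a' z(1) set_Pair[of 2 z1] set_mono_prefix[of z1 z]
      by (intro exI[of _ "(1, a) # map (Pair 2) z1"]) auto
  next
    case False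
    from Cons.IH[OF z(3) this] Cons.prems(3) obtain v where
      "set v \<subseteq> Sigma_io k" "foldl d (after 2 (d q (1, a)) z) v \<in> FT" by auto
    then show ?thesis using a' z(1) set_Pair[of 2 z]
      by (intro exI[of _ "(1, a) # map (Pair 2) z @ v"]) auto
  qed
qed simp

text \<open>The strategy is followed along \<open>s\<close> up to its first non-empty block. If it
  stays silent to the end, its last, empty block must accept.\<close>

lemma waits_path:
  "waits M x y q \<Longrightarrow> s \<noteq> [] \<Longrightarrow> dm (x @ s) \<Longrightarrow>
    R (x @ s) y \<and> after 1 q s \<in> FT \<or>
    (\<exists>s1 z. s1 \<noteq> [] \<and> prefix s1 s \<and> z \<noteq> [] \<and> z \<in> words \<and> length z \<le> M \<and>
       accepts (x @ s1) y (after 1 q s1) z \<and> waits M (x @ s1) (y @ z) (after 2 (after 1 q s1) z))"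
proof (induction s arbitrary: x q)
  case (Cons a s)
  have a: "a < k" using dm_letters[OF Cons.prems(3)] by simp
  from Cons.prems(1) a have "plays M (x @ [a]) y (d q (1, a))" by (simp add: waits_def)
  then obtain z where z: "z \<in> words" "length z \<le> M" "accepts (x @ [a]) y (d q (1, a)) z"
    "waits M (x @ [a]) (y @ z) (after 2 (d q (1, a)) z)" by (rule plays_step)
  show ?case
  proof (cases "z = []")
    case False
    then show ?thesis using z by (intro disjI2, rule_tac x = "[a]" in exI, rule_tac x = z in exI) auto
  next
    case z_empty: True
    show ?thesis
    proof (cases "s = []")
      case True
      then show ?thesis using z(3) z_empty Cons.prems(3) by (auto simp: accepts_def)
    next
      case False
      have "waits M (x @ [a]) y (d q (1, a))" using z(4) z_empty by simp
      from Cons.IH[OF this False] Cons.prems(3)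
      consider "R (x @ a # s) y" "after 1 (d q (1, a)) s \<in> FT"
        | s1 z where "s1 \<noteq> []" "prefix s1 s" "z \<noteq> []" "z \<in> words" "length z \<le> M"
          "accepts (x @ a # s1) y (after 1 (d q (1, a)) s1) z"
          "waits M (x @ a # s1) (y @ z) (after 2 (after 1 (d q (1, a)) s1) z)" by auto
      then show ?thesis
      proof cases
        case 2
        then show ?thesis by (intro disjI2, rule_tac x = "a # s1" in exI, rule_tac x = z in exI) auto
      qed auto
    qed
  qed
qed simp

text \<open>A non-empty block after some input costs the target word a shift, of which fewer than
  \<open>j\<close> remain. Each block has at most \<open>M\<close> letters, which gives the budget
  \<open>j * M\<close>; as \<open>M\<close> is unknown, this budget is afterwards replaced by
  \<open>b0\<close>.\<close>

lemma waits_await: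
  "waits M x y q \<Longrightarrow> (\<And>v. set v \<subseteq> Sigma_io k \<Longrightarrow> foldl d q v \<in> FT \<Longrightarrow> chg (map fst v) < j) \<Longrightarrow>
    await j (j * M) x y q"
proof (induction j arbitrary: x y q)
  case 0
  show ?case
    unfolding await.simps
  proof (intro allI impI notI)
    fix s assume "s \<noteq> []" "dm (x @ s)"
    from waits_alive[OF "0.prems"(1) this] obtain v where "set v \<subseteq> Sigma_io k" "foldl d q v \<in> FT" by blast
    from "0.prems"(2)[OF this] show False by simp
  qed
next
  case (Suc j)
  show ?case
    unfolding await.simps
  proof (intro allI impI, elim conjE)
    fix s assume s: "s \<noteq> []" "dm (x @ s)"
    from waits_path[OF Suc.prems(1) s]
    show "R (x @ s) y \<and> after 1 q s \<in> FT \<or>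
      (\<exists>s1. s1 \<noteq> [] \<and> prefix s1 s \<and> emit (await j) (Suc j * M) (x @ s1) y (after 1 q s1))"
    proof
      assume "\<exists>s1 z. s1 \<noteq> [] \<and> prefix s1 s \<and> z \<noteq> [] \<and> z \<in> words \<and> length z \<le> M \<and>
       accepts (x @ s1) y (after 1 q s1) z \<and> waits M (x @ s1) (y @ z) (after 2 (after 1 q s1) z)"
      then obtain s1 z where *: "s1 \<noteq> []" "prefix s1 s" "z \<noteq> []" "z \<in> words" "length z \<le> M"
       "accepts (x @ s1) y (after 1 q s1) z" "waits M (x @ s1) (y @ z) (after 2 (after 1 q s1) z)" by blast
      have s1: "set s1 \<subseteq> {..<k}"
        using dm_letters[OF s(2)] set_mono_prefix[OF *(2)] by auto
      have "await j (j * M) (x @ s1) (y @ z) (after 2 (after 1 q s1) z)"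
      proof (rule Suc.IH[OF *(7)])
        fix v assume v: "set v \<subseteq> Sigma_io k" "foldl d (after 2 (after 1 q s1) z) v \<in> FT"
        have "chg (map fst (map (Pair 1) s1 @ map (Pair 2) z @ v)) < Suc j"
          by (rule Suc.prems(2)) (use v set_Pair[of 1 s1] set_Pair[of 2 z] s1 *(4) in auto)
        then show "chg (map fst v) < j"
          using *(1,3) by (simp add: chg_append last_map hd_map)
      qed
      then have "await j (Suc j * M - length z) (x @ s1) (y @ z) (after 2 (after 1 q s1) z)"
        by (rule await_mono) (use *(5) in simp)
      then show ?thesis using * unfolding emit_def by (intro disjI2 exI[of _ s1] conjI bexI[of _ z]) auto
    qed simp
  qed
qed

text \<open>Strategy: emit at the first opportunity. In \<open>await\<close> the place of the next
  block may depend on the future input, but whether emission is possible depends only on the input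
  read. Hence, if it is impossible now, the waiting condition passes to the present
  configuration.\<close>

lemma await_safe:
  "b \<le> b0 \<Longrightarrow> await j b x y q \<Longrightarrow> a < k \<Longrightarrow> safe L b (x @ [a]) y (d q (1, a))"
proof (induction L arbitrary: j b x y q a)
  case (Suc L)
  show ?case
  proof (cases "\<exists>i. j = Suc i \<and> emit (await i) b (x @ [a]) y (d q (1, a))")
    case True
    then obtain i z where z: "j = Suc i" "z \<in> words" "length z \<le> b" "accepts (x @ [a]) y (d q (1, a)) z"
      "await i (b - length z) (x @ [a]) (y @ z) (after 2 (d q (1, a)) z)" unfolding emit_def by blast
    show ?thesis unfolding safe.simps
    proof (intro bexI[of _ z] exI[of _ "b - length z"] conjI allI impI)
      fix a' assume "a' < k"
      then show "safe L (b - length z) ((x @ [a]) @ [a']) (y @ z) (next_state (d q (1, a)) z a')"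
        using Suc.IH[OF _ z(5), of a'] Suc.prems(1) by (simp add: next_state_def)
    qed (use z Suc.prems(1) in \<open>auto simp: move_def\<close>)
  next
    case False
    have "accepts (x @ [a]) y (d q (1, a)) [] \<and> await j b (x @ [a]) y (d q (1, a))"
    proof (cases j)
      case 0
      have no: "\<not> dm (x @ a # s)" for s using Suc.prems(2) 0 by simp
      show ?thesis using no[of "[]"] no 0 by (auto simp: accepts_def)
    next
      case (Suc i)
      have *: "R (x @ a # s) y \<and> after 1 q (a # s) \<in> FT \<or>
        (\<exists>s1. s1 \<noteq> [] \<and> prefix s1 s \<and> emit (await i) b (x @ a # s1) y (after 1 q (a # s1)))" if dm: "dm (x @ a # s)" for s
      proof -
        have "R (x @ a # s) y \<and> after 1 q (a # s) \<in> FT \<or>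
          (\<exists>s1. s1 \<noteq> [] \<and> prefix s1 (a # s) \<and> emit (await i) b (x @ s1) y (after 1 q s1))"
          using Suc.prems(2)[unfolded Suc await.simps, rule_format, of "a # s"] dm by blast
        then show ?thesis
        proof
          assume "\<exists>s1. s1 \<noteq> [] \<and> prefix s1 (a # s) \<and> emit (await i) b (x @ s1) y (after 1 q s1)"
          then obtain s1 where "prefix s1 s" "emit (await i) b (x @ a # s1) y (after 1 q (a # s1))"
            by (auto simp: prefix_Cons)
          then show ?thesis using False Suc by (intro disjI2 exI[of _ s1]) auto
        qed simp
      qed
      show ?thesis
      proof
        show "accepts (x @ [a]) y (d q (1, a)) []" using *[of "[]"] by (auto simp: accepts_def)
        show "await j b (x @ [a]) y (d q (1, a))" unfolding Suc await.simps using * by simp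
      qed
    qed
    then show ?thesis unfolding safe.simps
      using Suc.IH[of b j "x @ [a]" y "d q (1, a)"] Suc.prems(1)
      by (intro bexI[of _ "[]"] exI[of _ b]) (auto simp: move_def next_state_def)
  qed
qed simp

lemma emit_safe:
  assumes b: "b \<le> b0" and e: "emit (await j) b x y q" shows "safe L b x y q"
proof (cases L)
  case (Suc L')
  obtain z where z: "z \<in> words" "length z \<le> b" "accepts x y q z" "await j (b - length z) x (y @ z) (after 2 q z)"
    using e unfolding emit_def by blast
  show ?thesis unfolding Suc safe.simps
  proof (intro bexI[of _ z] exI[of _ "b - length z"] conjI allI impI)
    fix a assume "a < k"
    then show "safe L' (b - length z) (x @ [a]) (y @ z) (next_state q z a)"
      using await_safe[OF _ z(4), of a L'] b by (simp add: next_state_def)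
  qed (use z b in \<open>auto simp: move_def\<close>)
qed simp

text \<open>\<open>few_shifts\<close> speaks of words of \<open>T\<close>, so a configuration has to
  come from an actual word.\<close>

definition reachable :: "nat list \<Rightarrow> nat list \<Rightarrow> nat \<Rightarrow> bool" where
  "reachable x y q \<longleftrightarrow> (\<exists>w. set w \<subseteq> Sigma_io k \<and> pr 1 w = x \<and> pr 2 w = y \<and> foldl d q0 w = q)"

lemma reachable_output:
  assumes "reachable x y q" "z \<in> words" shows "reachable x (y @ z) (after 2 q z)"
proof -
  obtain w where "set w \<subseteq> Sigma_io k" "pr 1 w = x" "pr 2 w = y" "foldl d q0 w = q"
    using assms(1) unfolding reachable_def by blast
  then show ?thesis unfolding reachable_def using set_Pair[of 2 z] assms(2)
    by (intro exI[of _ "w @ map (Pair 2) z"]) (auto simp: pr_map_Pair_other)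
qed

lemma reachable_input:
  assumes "reachable x y q" "a < k" shows "reachable (x @ [a]) y (d q (1, a))"
proof -
  obtain w where "set w \<subseteq> Sigma_io k" "pr 1 w = x" "pr 2 w = y" "foldl d q0 w = q"
    using assms(1) unfolding reachable_def by blast
  then show ?thesis unfolding reachable_def using assms(2)
    by (intro exI[of _ "w @ [(1, a)]"]) (auto simp: Sigma_io_def Sigma_def)
qed

text \<open>The phase changes before the block that raises the lag to \<open>N\<close>. At that
  moment the lag is at most \<open>N\<close>, being below \<open>N\<close> after the previous block
  and changed by one input letter, so \<open>emit_b0\<close> applies. The target allows at most
  \<open>2 * N\<close> shifts after the block, hence \<open>await (2 * N + 1)\<close>.\<close>

lemma plays_safe:
  "plays M x y q \<Longrightarrow> reachable x y q \<Longrightarrow> \<bar>int (length x) - int (length y)\<bar> \<le> int N \<Longrightarrow>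
    safe L (Suc b0) x y q"
proof (induction L arbitrary: x y q)
  case (Suc L)
  obtain z where z: "z \<in> words" "length z \<le> M" "accepts x y q z" "waits M x (y @ z) (after 2 q z)"
    using plays_step[OF Suc.prems(1)] .
  have reach: "reachable x (y @ z) (after 2 q z)" by (rule reachable_output[OF Suc.prems(2) z(1)])
  show ?case
  proof (cases "\<bar>int (length x) - int (length (y @ z))\<bar> < int N")
    case True
    show ?thesis unfolding safe.simps
    proof (intro bexI[of _ z] exI[of _ "Suc b0"] conjI allI impI)
      fix a assume a: "a < k"
      then have "plays M (x @ [a]) (y @ z) (next_state q z a)"
        using z(4) by (simp add: waits_def next_state_def)
      moreover have "reachable (x @ [a]) (y @ z) (next_state q z a)"
        using reachable_input[OF reach a] by (simp add: next_state_def)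
      ultimately show "safe L (Suc b0) (x @ [a]) (y @ z) (next_state q z a)"
        by (rule Suc.IH) (use True in simp)
    qed (use z True in \<open>auto simp: move_def\<close>)
  next
    case False
    obtain w where w: "set w \<subseteq> Sigma_io k" "pr 1 w = x" "pr 2 w = y @ z" "foldl d q0 w = after 2 q z"
      using reach unfolding reachable_def by blast
    have "await (2 * N + 1) ((2 * N + 1) * M) x (y @ z) (after 2 q z)"
    proof (rule waits_await[OF z(4)])
      fix v assume v: "set v \<subseteq> Sigma_io k" "foldl d (after 2 q z) v \<in> FT"
      then have "w @ v \<in> T" using w T_iff[of "w @ v"] by simp
      then have "chg (map fst v) \<le> 2 * N"
        by (rule few_shifts) (use False w(2,3) in \<open>simp add: balance_def\<close>)
      then show "chg (map fst v) < 2 * N + 1" by simp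
    qed
    then have "emit (await (2 * N + 1)) ((2 * N + 1) * M + length z) x y q"
      unfolding emit_def using z by (intro bexI[of _ z]) auto
    moreover have "q < Q" using Suc.prems(2) foldl_less[OF q0_less] unfolding reachable_def by blast
    ultimately have "safe (Suc L) b0 x y q"
      using emit_safe emit_b0 Suc.prems(3) by blast
    \<comment> \<open>Every first move under budget \<open>b0\<close> is also a first move under
      \<open>Suc b0\<close>, by the second clause of \<open>move\<close>.\<close>
    then show ?thesis unfolding safe.simps by (auto simp: move_def)
  qed
qed simp

end

lemma dfa_run_append: "dfa_run \<delta> q (u @ v) = Option.bind (dfa_run \<delta> q u) (\<lambda>p. dfa_run \<delta> p v)"
proof -
  have "fold (\<lambda>a qo. Option.bind qo (\<lambda>p. \<delta> p a)) v None = None" for v by (induction v) auto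
  then show ?thesis by (cases "dfa_run \<delta> q u") (auto simp: dfa_run_def)
qed

lemma dfa_run_Nil [simp]: "dfa_run \<delta> q [] = Some q"
  by (simp add: dfa_run_def)

lemma dfa_run_single [simp]: "dfa_run \<delta> q [a] = \<delta> q a"
  by (simp add: dfa_run_def)

lemma dfa_run_Cons: "dfa_run \<delta> q (a # v) = Option.bind (\<delta> q a) (\<lambda>p. dfa_run \<delta> p v)"
  using dfa_run_append[of \<delta> q "[a]" v] by simp

context game
begin

subsection \<open>Finitely many positions suffice\<close>

text \<open>In the initial phase output is not limited by a budget and \<open>move\<close> inspects
  the lag, so equivalence for all lengths and equality of the lag are required.\<close>

definition similar :: "nat \<Rightarrow> nat list \<Rightarrow> nat list \<Rightarrow> nat list \<Rightarrow> nat list \<Rightarrow> bool" where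
  "similar b x y x' y' \<longleftrightarrow> (if b \<le> b0 then sim b x y x' y' else
     (\<forall>b. sim b x y x' y') \<and> int (length x) - int (length y) = int (length x') - int (length y'))"

lemma similar_refl [simp]: "similar b x y x y"
  by (simp add: similar_def)

lemma similar_sym: "similar b x y x' y' \<Longrightarrow> similar b x' y' x y"
  unfolding similar_def using sim_sym by (auto split: if_splits)

lemma similar_trans: "similar b x y x' y' \<Longrightarrow> similar b x' y' x'' y'' \<Longrightarrow> similar b x y x'' y''"
  unfolding similar_def by (auto split: if_splits intro: sim_trans)

lemma similar_dm: "similar b x y x' y' \<Longrightarrow> dm (x @ s) = dm (x' @ s)"
  unfolding similar_def sim_def by (auto split: if_splits)

lemma similar_move:
  assumes "similar b x y x' y'" "move b x y z b'"
  shows "move b x' y' z b'" "b' \<le> Suc b0" "accepts x y q z = accepts x' y' q z"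
    "prefix z1 z \<Longrightarrow> R x (y @ z1) = R x' (y' @ z1)"
    "similar b' (x @ [a]) (y @ z) (x' @ [a]) (y' @ z)"
proof -
  \<comment> \<open>The number \<open>n\<close> is free because a move that stays in the initial
    phase must preserve equivalence for every length.\<close>
  have sim: "sim (length z + (if b' \<le> b0 then b' else n)) x y x' y'" for n
  proof (cases "b \<le> b0")
    case True
    then show ?thesis using assms by (auto simp: similar_def move_def)
  next
    case False
    then show ?thesis using assms(1) by (simp add: similar_def)
  qed
  have len: "int (length x) - int (length y) = int (length x') - int (length y')" if "\<not> b' \<le> b0"
    using that assms by (auto simp: similar_def move_def split: if_splits)
  show "move b x' y' z b'"
    using assms len by (auto simp: move_def)
  show "b' \<le> Suc b0" using assms(2) by (auto simp: move_def)
  have sim0: "sim (length z) x y x' y'" using sim_le[OF sim[of 0], of "length z"] by simp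
  then show "accepts x y q z = accepts x' y' q z" by (rule accepts_sim) simp
  show "R x (y @ z1) = R x' (y' @ z1)" if "prefix z1 z"
  proof -
    have "R (x @ []) (y @ z1) = R (x' @ []) (y' @ z1)"
      using sim0 prefix_length_le[OF that] unfolding sim_def by blast
    then show ?thesis by simp
  qed
  show "similar b' (x @ [a]) (y @ z) (x' @ [a]) (y' @ z)"
  proof (cases "b' \<le> b0")
    case True
    then show ?thesis using sim_append[OF sim[of 0], of z b' "[a]"] by (simp add: similar_def)
  next
    case False
    then have "sim n (x @ [a]) (y @ z) (x' @ [a]) (y' @ z)" for n
      using sim_append[OF sim[of n], of z n "[a]"] by simp
    then show ?thesis using False len by (simp add: similar_def)
  qed
qed

lemma safe_similar: "similar b x y x' y' \<Longrightarrow> safe L b x y q \<Longrightarrow> safe L b x' y' q"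
proof (induction L arbitrary: b x y x' y' q)
  case (Suc L)
  then obtain z b' where z: "z \<in> words" "move b x y z b'" "accepts x y q z"
    "\<forall>a<k. safe L b' (x @ [a]) (y @ z) (next_state q z a)" by auto
  have "accepts x' y' q z"
    using z(3) similar_move(3)[OF Suc.prems(1) z(2)] by simp
  moreover have "\<forall>a<k. safe L b' (x' @ [a]) (y' @ z) (next_state q z a)"
    using Suc.IH[OF similar_move(5)[OF Suc.prems(1) z(2)]] z(4) by blast
  ultimately show ?case
    using z(1) similar_move(1)[OF Suc.prems(1) z(2)] by auto
qed simp

text \<open>An invariant of the moves that limits how far the output can run ahead: by
  \<open>N\<close> when the initial phase is left, and afterwards by the \<open>b0\<close> letters
  still to be spent.\<close>

definition feasible :: "nat \<Rightarrow> nat list \<Rightarrow> nat list \<Rightarrow> bool" where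
  "feasible b x y \<longleftrightarrow> b \<le> Suc b0 \<and> x \<in> words \<and> y \<in> words \<and>
     (if b \<le> b0 then length y + b \<le> length x + N + b0 else \<bar>int (length x) - int (length y)\<bar> \<le> int N)"

lemma feasible_move:
  assumes "feasible b x y" "move b x y z b'" "z \<in> words" "a < k"
  shows "feasible b' (x @ [a]) (y @ z)"
  using assms unfolding feasible_def move_def by (auto split: if_splits)

text \<open>If both words are longer than \<open>KP\<close>, both are cut. Otherwise a short input
  forces a short output by \<open>feasible\<close>, while a short output with a long input leaves
  room for \<open>cut_input\<close>.\<close>

lemma short_similar:
  "feasible b x y \<Longrightarrow> \<exists>x' y'. length x' \<le> short_len \<and> length y' \<le> short_len \<and> feasible b x' y' \<and> similar b x y x' y'"
proof (induction "length x" arbitrary: x y rule: less_induct)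
  case less
  show ?case
  proof (cases "b \<le> b0")
    case False
    then have "\<bar>int (length x) - int (length y)\<bar> \<le> int N" using less.prems by (simp add: feasible_def)
    from short_bounded_lag[OF this] obtain x' y' where
      "length x' \<le> KP + N" "length y' \<le> KP + N" "set x' \<subseteq> set x" "set y' \<subseteq> set y"
      "int (length x) - int (length y) = int (length x') - int (length y')" "\<And>b. sim b x y x' y'" by blast
    then show ?thesis using less.prems False
      by (rule_tac x = x' in exI, rule_tac x = y' in exI) (auto simp: feasible_def similar_def short_len_def)
  next
    case b: True
    show ?thesis
    proof (cases "length x \<le> short_len \<and> length y \<le> short_len")
      case True
      then show ?thesis using less.prems by (rule_tac x = x in exI, rule_tac x = y in exI) auto
    next
      case long: False
      have "\<exists>x1 y1. length x1 < length x \<and> feasible b x1 y1 \<and> sim b x y x1 y1"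
      proof (cases "KP < length x \<and> KP < length y")
        case True
        then obtain x1 y1 where "length x1 < length x" "set x1 \<subseteq> set x" "set y1 \<subseteq> set y"
          "int (length x) - int (length y) = int (length x1) - int (length y1)" "\<And>b. sim b x y x1 y1"
          using cut_both[of x y] by blast
        then show ?thesis using less.prems b
          by (rule_tac x = x1 in exI, rule_tac x = y1 in exI) (auto simp: feasible_def)
      next
        case False
        then have "length y + b0 + KB b0 < length x"
          using long less.prems b by (auto simp: feasible_def short_len_def)
        from cut_input[OF this] obtain x1 where
          "length x1 < length x" "set x1 \<subseteq> set x" "length y + b0 \<le> length x1" "sim b0 x y x1 y" by blast
        then show ?thesis using less.prems b sim_le[of b0 x y x1 y b]
          by (rule_tac x = x1 in exI, rule_tac x = y in exI) (auto simp: feasible_def)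
      qed
      then obtain x1 y1 where 1: "length x1 < length x" "feasible b x1 y1" "sim b x y x1 y1" by blast
      from less.hyps[OF 1(1,2)] obtain x' y' where
        2: "length x' \<le> short_len" "length y' \<le> short_len" "feasible b x' y'" "similar b x1 y1 x' y'" by blast
      have "similar b x y x1 y1" using b 1(3) by (simp add: similar_def)
      from similar_trans[OF this 2(4)] 2(1,2,3) show ?thesis by blast
    qed
  qed
qed

type_synonym position = "nat \<times> nat list \<times> nat list \<times> nat"

definition positions :: "position set" where
  "positions = {(b, x, y, q). feasible b x y \<and> length x \<le> short_len \<and> length y \<le> short_len \<and> q < Q}"

lemma positions_card: "finite positions" "card positions \<le> rounds"
proof -
  define W where "W = {t. set t \<subseteq> {..<k} \<and> length t \<le> short_len}"
  note W = card_words[of short_len, folded W_def]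
  have sub: "positions \<subseteq> {..Suc b0} \<times> W \<times> W \<times> {..<Q}"
    by (auto simp: positions_def feasible_def W_def)
  show "finite positions" by (rule finite_subset[OF sub]) (use W in simp)
  have "card positions \<le> card ({..Suc b0} \<times> W \<times> W \<times> {..<Q})"
    by (rule card_mono[OF _ sub]) (use W in simp)
  also have "\<dots> = Suc (Suc b0) * (card W * (card W * Q))" by (simp add: card_cartesian_product)
  also have "\<dots> \<le> rounds" unfolding rounds_def using W(2) by (intro mult_le_mono le_refl)
  finally show "card positions \<le> rounds" .
qed

definition alive :: "nat \<Rightarrow> position set" where
  "alive L = {(b, x, y, q) \<in> positions. safe L b x y q}"

text \<open>The true successors of a position may be too long to be positions; \<open>nx a\<close>
  is a similar position that takes the place of the successor under \<open>a\<close>.\<close>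

definition good_move :: "position set \<Rightarrow> position \<Rightarrow> nat list \<Rightarrow> (nat \<Rightarrow> position) \<Rightarrow> bool" where
  "good_move P \<pi> z nx \<longleftrightarrow> (case \<pi> of (b, x, y, q) \<Rightarrow> z \<in> words \<and> accepts x y q z \<and>
     (\<exists>b'. move b x y z b' \<and> (\<forall>a<k. \<exists>x' y'. nx a = (b', x', y', next_state q z a) \<and> nx a \<in> P \<and>
        similar b' (x @ [a]) (y @ z) x' y')))"

lemma next_state_less: "q < Q \<Longrightarrow> next_state q z a < Q"
  unfolding next_state_def by (rule foldl_less)

text \<open>The next set depends on the previous one only. Hence one coincidence of neighbours makes
  the chain constant from there on, although \<open>safe\<close> itself ranges over infinitely many
  configurations.\<close>

lemma alive_Suc: "alive (Suc L) = {\<pi> \<in> positions. \<exists>z nx. good_move (alive L) \<pi> z nx}"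
proof (intro set_eqI)
  fix \<pi> :: position
  obtain b x y q where \<pi>: "\<pi> = (b, x, y, q)" by (cases \<pi>)
  have "safe (Suc L) b x y q \<longleftrightarrow> (\<exists>z nx. good_move (alive L) \<pi> z nx)" if "\<pi> \<in> positions"
  proof
    assume "safe (Suc L) b x y q"
    then obtain z b' where z: "z \<in> words" "move b x y z b'" "accepts x y q z"
      "\<And>a. a < k \<Longrightarrow> safe L b' (x @ [a]) (y @ z) (next_state q z a)" unfolding safe.simps by blast
    have "\<forall>a. \<exists>\<pi>'. a < k \<longrightarrow> (\<exists>x' y'. \<pi>' = (b', x', y', next_state q z a) \<and> \<pi>' \<in> alive L \<and>
        similar b' (x @ [a]) (y @ z) x' y')"
    proof
      fix a
      show "\<exists>\<pi>'. a < k \<longrightarrow> (\<exists>x' y'. \<pi>' = (b', x', y', next_state q z a) \<and> \<pi>' \<in> alive L \<and>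
        similar b' (x @ [a]) (y @ z) x' y')"
      proof (cases "a < k")
      case True
      have "feasible b' (x @ [a]) (y @ z)"
        using feasible_move[OF _ z(2,1) True] that by (simp add: positions_def \<pi>)
      from short_similar[OF this] obtain x' y' where s: "length x' \<le> short_len" "length y' \<le> short_len"
        "feasible b' x' y'" "similar b' (x @ [a]) (y @ z) x' y'" by blast
      have "next_state q z a < Q" using that next_state_less by (simp add: positions_def \<pi>)
      then have "(b', x', y', next_state q z a) \<in> alive L"
        using safe_similar[OF s(4) z(4)[OF True]] s(1,2,3) by (simp add: alive_def positions_def)
      then show ?thesis using s(4) by blast
      qed blast
    qed
    from choice[OF this] obtain nx where nx: "\<forall>a. a < k \<longrightarrow> (\<exists>x' y'. nx a = (b', x', y', next_state q z a) \<and>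
        nx a \<in> alive L \<and> similar b' (x @ [a]) (y @ z) x' y')" by (elim exE)
    have "good_move (alive L) \<pi> z nx"
      unfolding good_move_def \<pi> prod.case by (intro conjI exI[of _ b'] z(1,2,3) nx)
    then show "\<exists>z nx. good_move (alive L) \<pi> z nx" by blast
  next
    assume "\<exists>z nx. good_move (alive L) \<pi> z nx"
    then obtain z nx where "good_move (alive L) \<pi> z nx" by blast
    note good = this[unfolded good_move_def \<pi> prod.case]
    then obtain b' where z: "z \<in> words" "accepts x y q z" "move b x y z b'"
      and nx: "\<forall>a<k. \<exists>x' y'. nx a = (b', x', y', next_state q z a) \<and> nx a \<in> alive L \<and>
        similar b' (x @ [a]) (y @ z) x' y'"
      by (elim conjE exE)
    have "safe L b' (x @ [a]) (y @ z) (next_state q z a)" if a: "a < k" for a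
    proof -
      obtain x' y' where "nx a = (b', x', y', next_state q z a)" "nx a \<in> alive L"
        "similar b' (x @ [a]) (y @ z) x' y'" using nx a by blast
      then have "safe L b' x' y' (next_state q z a)" "similar b' x' y' (x @ [a]) (y @ z)"
        by (auto simp: alive_def intro: similar_sym)
      then show ?thesis using safe_similar by blast
    qed
    then show "safe (Suc L) b x y q" unfolding safe.simps using z(1,2,3) by blast
  qed
  moreover have "\<pi> \<in> alive (Suc L) \<longleftrightarrow> \<pi> \<in> positions \<and> safe (Suc L) b x y q"
    unfolding alive_def \<pi> by blast
  ultimately show "\<pi> \<in> alive (Suc L) \<longleftrightarrow> \<pi> \<in> {\<pi> \<in> positions. \<exists>z nx. good_move (alive L) \<pi> z nx}"
    by blast
qed

lemma safe_antimono: "safe (Suc L) b x y q \<Longrightarrow> safe L b x y q"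
proof (induction L arbitrary: b x y q)
  case (Suc L)
  from Suc.prems show ?case using Suc.IH by (subst safe.simps(2)) (subst (asm) safe.simps(2), blast)
qed simp

lemma alive_stable: "alive (Suc rounds) = alive rounds"
proof -
  \<comment> \<open>The complements increase, which is the direction of the lemmas about finite
    chains used below.\<close>
  define D where "D L = positions - alive L" for L
  have sub: "D L \<subseteq> positions" "alive L \<subseteq> positions" for L by (auto simp: D_def alive_def)
  have "alive (Suc L) \<subseteq> alive L" for L using safe_antimono by (auto simp: alive_def simp del: safe.simps)
  then have "D L \<subseteq> D (Suc L)" for L by (auto simp: D_def)
  then have mono: "mono D" by (rule monoI[OF lift_Suc_mono_le])
  have eq: "alive L = positions - D L" for L using sub(2)[of L] by (auto simp: D_def)
  have "\<exists>M. (\<forall>n\<le>M. \<forall>m\<le>M. m < n \<longrightarrow> D m \<subset> D n) \<and> (\<forall>n\<ge>M. D M = D n)"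
  proof (rule finite_mono_remains_stable_implies_strict_prefix[OF _ mono])
    show "finite (range D)"
      by (rule finite_subset[of _ "Pow positions"]) (use sub positions_card in auto)
    show "\<forall>n. D n = D (Suc n) \<longrightarrow> D (Suc n) = D (Suc (Suc n))"
    proof (intro allI impI)
      fix n assume "D n = D (Suc n)"
      then have "alive n = alive (Suc n)" unfolding eq by simp
      then have "alive (Suc n) = alive (Suc (Suc n))" unfolding alive_Suc by simp
      then show "D (Suc n) = D (Suc (Suc n))" by (simp add: D_def)
    qed
  qed
  from finite_mono_strict_prefix_implies_finite_fixpoint[OF sub(1) positions_card(1) this]
  have "D (card positions) = (\<Union>n. D n)" .
  moreover have "D (card positions) \<subseteq> D L" if "card positions \<le> L" for L
    using mono that by (simp add: monoD)
  ultimately have "D L = (\<Union>n. D n)" if "card positions \<le> L" for L using that by blast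
  then have "D rounds = D (Suc rounds)" using positions_card(2) by simp
  then show ?thesis unfolding eq by simp
qed

subsection \<open>From a positional strategy to a sequential automaton\<close>

text \<open>A state of the automaton is a position together with the number of letters of its block
  already written. After the whole block it reads a letter and passes to the chosen similar
  position. Stability of \<open>alive\<close> at \<open>rounds\<close> keeps these successors alive,
  so the play never runs out of rounds.\<close>

lemma safe_resync:
  assumes "safe rounds (Suc b0) [] [] q0"
  shows "resync_unif k S T"
proof -
  note split_paired_Ex [simp del] split_paired_All [simp del]
  define P where "P = alive rounds"
  define \<pi>0 :: position where "\<pi>0 = (Suc b0, [], [], q0)"
  have \<pi>0: "\<pi>0 \<in> P"
    using assms q0_less by (simp add: P_def alive_def positions_def feasible_def \<pi>0_def)
  have P_sub: "P \<subseteq> positions" by (auto simp: P_def alive_def)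
  have "\<forall>\<pi>. \<exists>g. \<pi> \<in> P \<longrightarrow> good_move P \<pi> (fst g) (snd g)"
  proof
    fix \<pi>
    have "\<exists>z nx. good_move P \<pi> z nx" if "\<pi> \<in> P"
      using that alive_stable alive_Suc[of rounds] unfolding P_def by blast
    then have "\<pi> \<in> P \<Longrightarrow> \<exists>z nx. good_move P \<pi> (fst (z, nx)) (snd (z, nx))" by simp
    then show "\<exists>g. \<pi> \<in> P \<longrightarrow> good_move P \<pi> (fst g) (snd g)" by blast
  qed
  from choice[OF this] obtain g where
    g: "\<forall>\<pi>. \<pi> \<in> P \<longrightarrow> good_move P \<pi> (fst (g \<pi>)) (snd (g \<pi>))" by (elim exE)
  define zz where "zz \<pi> = fst (g \<pi>)" for \<pi>
  define nx where "nx \<pi> = snd (g \<pi>)" for \<pi>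
  have good: "\<And>\<pi>. \<pi> \<in> P \<Longrightarrow> good_move P \<pi> (zz \<pi>) (nx \<pi>)"
    unfolding zz_def nx_def using g by blast
  define stop where "stop \<pi> i \<longleftrightarrow> (case \<pi> of (b, x, y, q) \<Rightarrow> i \<le> length (zz \<pi>) \<and>
    R x (y @ take i (zz \<pi>)) \<and> after 2 q (take i (zz \<pi>)) \<in> FT)" for \<pi> :: position and i
  \<comment> \<open>The point of acceptance within the block is fixed once and for all. It is
    meaningful only if the input of the position lies in the domain, and \<open>F\<close> tests
    this.\<close>
  define m where "m \<pi> = (SOME i. stop \<pi> i)" for \<pi>
  have stop_m: "stop (b, x, y, q) (m (b, x, y, q))" if "(b, x, y, q) \<in> P" "dm x" for b x y q
  proof -
    have "accepts x y q (zz (b, x, y, q))" using good[OF that(1)] by (simp add: good_move_def)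
    with that(2) obtain z1 where z1: "prefix z1 (zz (b, x, y, q))" "R x (y @ z1)" "after 2 q z1 \<in> FT"
      unfolding accepts_def by blast
    then have "z1 = take (length z1) (zz (b, x, y, q))" "length z1 \<le> length (zz (b, x, y, q))"
      by (auto simp: prefix_def)
    then have "stop (b, x, y, q) (length z1)" using z1 unfolding stop_def by simp
    then show ?thesis unfolding m_def by (rule someI)
  qed
  define code :: "position \<Rightarrow> nat \<Rightarrow> nat" where "code \<pi> i = to_nat (\<pi>, i)" for \<pi> i
  have code: "from_nat (code \<pi> i) = (\<pi>, i)" for \<pi> i by (simp add: code_def)
  have code_eq: "code \<pi> i = code \<pi>' i' \<longleftrightarrow> \<pi> = \<pi>' \<and> i = i'" for \<pi> i \<pi>' i' by (simp add: code_def)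
  \<comment> \<open>\<open>from_nat\<close> decodes every number; the tests
    \<open>n = code \<pi> i\<close> exclude numbers that are no codes.\<close>
  define \<delta> where "\<delta> n a = (case from_nat n of (\<pi>, i) \<Rightarrow>
      if n = code \<pi> i \<and> \<pi> \<in> P \<and> i < length (zz \<pi>) \<and> a = (2, zz \<pi> ! i) then Some (code \<pi> (Suc i))
      else if n = code \<pi> i \<and> \<pi> \<in> P \<and> i = length (zz \<pi>) \<and> fst a = 1 \<and> snd a < k then Some (code (nx \<pi> (snd a)) 0)
      else None)" for n :: nat and a :: "nat \<times> nat"
  define Qs where "Qs = {code \<pi> i | \<pi> i. \<pi> \<in> P \<and> i \<le> length (zz \<pi>)}"
  \<comment> \<open>A position has at most one accepting point, even where its block would permit
    several; this makes the recognized relation single-valued.\<close>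
  define F where "F = {code \<pi> i | \<pi> i. \<pi> \<in> P \<and> dm (fst (snd \<pi>)) \<and> i = m \<pi>}"
  have nx_P: "nx \<pi> a \<in> P" if "\<pi> \<in> P" "a < k" for \<pi> a
    using good[OF that(1)] that(2) by (auto simp: good_move_def split: prod.splits)
  have zz_words: "set (zz \<pi>) \<subseteq> {..<k}" if "\<pi> \<in> P" for \<pi>
    using good[OF that(1)] by (auto simp: good_move_def split: prod.splits)
  have \<delta>_out: "\<delta> (code \<pi> i) a = (if a = (2, zz \<pi> ! i) then Some (code \<pi> (Suc i)) else None)"
    if "\<pi> \<in> P" "i < length (zz \<pi>)" for \<pi> i a
    using that by (simp add: \<delta>_def code)
  have \<delta>_in: "\<delta> (code \<pi> (length (zz \<pi>))) a = (if fst a = 1 \<and> snd a < k then Some (code (nx \<pi> (snd a)) 0) else None)"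
    if "\<pi> \<in> P" for \<pi> a
    using that by (simp add: \<delta>_def code)
  have \<delta>_cases: "(\<exists>\<pi> i. n = code \<pi> i \<and> \<pi> \<in> P \<and> i < length (zz \<pi>) \<and> a = (2, zz \<pi> ! i) \<and> n' = code \<pi> (Suc i)) \<or>
      (\<exists>\<pi>. n = code \<pi> (length (zz \<pi>)) \<and> \<pi> \<in> P \<and> fst a = 1 \<and> snd a < k \<and> n' = code (nx \<pi> (snd a)) 0)"
    if step: "\<delta> n a = Some n'" for n a n'
  proof -
    obtain \<pi> i where n: "(from_nat n :: position \<times> nat) = (\<pi>, i)" by (rule prod.exhaust)
    show ?thesis
    proof (cases "n = code \<pi> i \<and> \<pi> \<in> P \<and> i < length (zz \<pi>) \<and> a = (2, zz \<pi> ! i)")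
      case True
      then have "n' = code \<pi> (Suc i)" using step unfolding \<delta>_def n prod.case by simp
      then show ?thesis using True by blast
    next
      case no: False
      show ?thesis
      proof (cases "n = code \<pi> i \<and> \<pi> \<in> P \<and> i = length (zz \<pi>) \<and> fst a = 1 \<and> snd a < k")
        case True
        then have "n' = code (nx \<pi> (snd a)) 0" using step no unfolding \<delta>_def n prod.case by simp
        then show ?thesis using True by blast
      next
        case False
        then have "\<delta> n a = None" using no unfolding \<delta>_def n prod.case by (simp only: if_False)
        then show ?thesis using step by simp
      qed
    qed
  qed
  have in_states: "Q_in k Qs \<delta> = {code \<pi> (length (zz \<pi>)) | \<pi>. \<pi> \<in> P}"
  proof (intro equalityI subsetI)
    fix n assume "n \<in> Q_in k Qs \<delta>"
    then obtain a n' where a: "a \<in> Sigma_i k" "\<delta> n a = Some n'" by (auto simp: Q_in_def)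
    from \<delta>_cases[OF a(2)] a(1) show "n \<in> {code \<pi> (length (zz \<pi>)) | \<pi>. \<pi> \<in> P}"
      by (auto simp: Sigma_i_def)
  next
    fix n assume "n \<in> {code \<pi> (length (zz \<pi>)) | \<pi>. \<pi> \<in> P}"
    then obtain \<pi> where \<pi>: "n = code \<pi> (length (zz \<pi>))" "\<pi> \<in> P" by blast
    then have "\<delta> n (1, 0) \<noteq> None" using \<delta>_in k_pos by simp
    moreover have "n \<in> Qs" unfolding Qs_def using \<pi> by blast
    ultimately show "n \<in> Q_in k Qs \<delta>"
      unfolding Q_in_def using k_pos by (auto intro!: bexI[of _ "(1, 0)"] simp: Sigma_i_def Sigma_def)
  qed
  have out_states: "Q_out k Qs \<delta> = {code \<pi> i | \<pi> i. \<pi> \<in> P \<and> i < length (zz \<pi>)}"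
  proof (intro equalityI subsetI)
    fix n assume "n \<in> Q_out k Qs \<delta>"
    then obtain a n' where a: "a \<in> Sigma_o k" "\<delta> n a = Some n'" by (auto simp: Q_out_def)
    from \<delta>_cases[OF a(2)] a(1) show "n \<in> {code \<pi> i | \<pi> i. \<pi> \<in> P \<and> i < length (zz \<pi>)}"
      by (auto simp: Sigma_o_def)
  next
    fix n assume "n \<in> {code \<pi> i | \<pi> i. \<pi> \<in> P \<and> i < length (zz \<pi>)}"
    then obtain \<pi> i where \<pi>: "n = code \<pi> i" "\<pi> \<in> P" "i < length (zz \<pi>)" by blast
    then have "\<delta> n (2, zz \<pi> ! i) \<noteq> None" using \<delta>_out by simp
    moreover have "zz \<pi> ! i < k" using zz_words[OF \<pi>(2)] \<pi>(3) by (meson lessThan_iff nth_mem subsetD)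
    moreover have "n \<in> Qs" unfolding Qs_def using \<pi> less_imp_le by blast
    ultimately show "n \<in> Q_out k Qs \<delta>"
      unfolding Q_out_def by (auto intro!: bexI[of _ "(2, zz \<pi> ! i)"] simp: Sigma_o_def Sigma_def)
  qed
  have "finite Qs"
  proof (rule finite_subset)
    show "Qs \<subseteq> (\<Union>\<pi>\<in>P. code \<pi> ` {..length (zz \<pi>)})" by (auto simp: Qs_def)
    show "finite (\<Union>\<pi>\<in>P. code \<pi> ` {..length (zz \<pi>)})"
      using finite_subset[OF P_sub positions_card(1)] by simp
  qed
  have m_le: "m \<pi> \<le> length (zz \<pi>)" if "\<pi> \<in> P" "dm (fst (snd \<pi>))" for \<pi>
    using stop_m that by (cases \<pi>) (auto simp: stop_def)
  have dfa: "is_dfa k Qs (code \<pi>0 0) \<delta> F"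
    unfolding is_dfa_def
  proof (intro conjI allI impI)
    show "finite Qs" by fact
    show "code \<pi>0 0 \<in> Qs" using \<pi>0 unfolding Qs_def by blast
    show "F \<subseteq> Qs" unfolding F_def Qs_def using m_le by blast
    fix n a n' assume "\<delta> n a = Some n'"
    note cases = \<delta>_cases[OF this]
    show "n \<in> Qs" using cases less_imp_le unfolding Qs_def by blast
    show "n' \<in> Qs" using cases nx_P Suc_leI unfolding Qs_def by blast
    show "a \<in> Sigma_io k" using cases
    proof
      assume "\<exists>\<pi> i. n = code \<pi> i \<and> \<pi> \<in> P \<and> i < length (zz \<pi>) \<and> a = (2, zz \<pi> ! i) \<and> n' = code \<pi> (Suc i)"
      then obtain \<pi> i where *: "\<pi> \<in> P" "i < length (zz \<pi>)" "a = (2, zz \<pi> ! i)" by blast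
      then have "zz \<pi> ! i < k" using zz_words[OF *(1)] by (meson lessThan_iff nth_mem subsetD)
      then show ?thesis using * by (simp add: Sigma_io_def Sigma_def)
    qed (cases a, auto simp: Sigma_io_def Sigma_def)
  qed
  have sdfa: "is_sdfa k Qs (code \<pi>0 0) \<delta> F"
    unfolding is_sdfa_def
  proof (intro conjI dfa ballI allI impI)
    show "Q_in k Qs \<delta> \<union> Q_out k Qs \<delta> = Qs"
      unfolding in_states out_states unfolding Qs_def le_less by blast
    show "Q_in k Qs \<delta> \<inter> Q_out k Qs \<delta> = {}"
      unfolding in_states out_states by (auto simp: code_eq)
    fix n a b assume "n \<in> Q_out k Qs \<delta>" and ab: "\<delta> n a \<noteq> None" "\<delta> n b \<noteq> None"
    then obtain \<pi> i where "n = code \<pi> i" "\<pi> \<in> P" "i < length (zz \<pi>)" unfolding out_states by blast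
    then show "a = b" using ab \<delta>_out by (auto split: if_splits)
  qed
  \<comment> \<open>The position reached on \<open>x\<close> stores only similar words, so the
    output written before its block is recorded separately.\<close>
  define tr where "tr x = foldl (\<lambda>(\<pi>, y) a. (nx \<pi> a, y @ zz \<pi>)) (\<pi>0, []) x" for x
  have tr_Nil: "tr [] = (\<pi>0, [])" by (simp add: tr_def)
  have tr_snoc: "tr (x @ [a]) = (nx (fst (tr x)) a, snd (tr x) @ zz (fst (tr x)))" for x a
    by (simp add: tr_def case_prod_beta)
  have tracks: "fst (tr x) \<in> P \<and> (case fst (tr x) of (b, x', y', q) \<Rightarrow> similar b x (snd (tr x)) x' y')"
    if "x \<in> words" for x
    using that
  proof (induction x rule: rev_induct)
    case Nil
    then show ?case using \<pi>0 by (simp add: tr_Nil \<pi>0_def)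
  next
    case (snoc a x)
    then have a: "a < k" and x: "x \<in> words" by auto
    obtain b x' y' q where \<pi>: "fst (tr x) = (b, x', y', q)" by (cases "fst (tr x)")
    from snoc.IH[OF x] have IH: "(b, x', y', q) \<in> P" "similar b x (snd (tr x)) x' y'" by (auto simp: \<pi>)
    obtain b' x1 y1 where 1: "move b x' y' (zz (b, x', y', q)) b'"
      "nx (b, x', y', q) a = (b', x1, y1, next_state q (zz (b, x', y', q)) a)"
      "nx (b, x', y', q) a \<in> P" "similar b' (x' @ [a]) (y' @ zz (b, x', y', q)) x1 y1"
      using good[OF IH(1)] a unfolding good_move_def by auto
    have "similar b' (x @ [a]) (snd (tr x) @ zz (b, x', y', q)) (x' @ [a]) (y' @ zz (b, x', y', q))"
      using similar_move(5)[OF similar_sym[OF IH(2)] 1(1)] by (rule similar_sym)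
    from similar_trans[OF this 1(4)] show ?case
      using 1(2,3) by (simp add: tr_snoc \<pi>)
  qed
  have state: "\<exists>i. s = code (fst (tr (pr 1 w))) i \<and> i \<le> length (zz (fst (tr (pr 1 w)))) \<and>
      pr 2 w = snd (tr (pr 1 w)) @ take i (zz (fst (tr (pr 1 w)))) \<and> set w \<subseteq> Sigma_io k \<and>
      foldl d q0 w = after 2 (snd (snd (snd (fst (tr (pr 1 w)))))) (take i (zz (fst (tr (pr 1 w)))))"
    if "dfa_run \<delta> (code \<pi>0 0) w = Some s" for w s
    using that
  proof (induction w arbitrary: s rule: rev_induct)
    case Nil
    then show ?case by (auto simp: tr_Nil \<pi>0_def)
  next
    case (snoc l w)
    then obtain s' where s': "dfa_run \<delta> (code \<pi>0 0) w = Some s'" "\<delta> s' l = Some s"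
      by (auto simp: dfa_run_append bind_eq_Some_conv)
    define \<pi> where "\<pi> = fst (tr (pr 1 w))"
    from snoc.IH[OF s'(1)] obtain i where i: "s' = code \<pi> i" "i \<le> length (zz \<pi>)"
      "pr 2 w = snd (tr (pr 1 w)) @ take i (zz \<pi>)" "set w \<subseteq> Sigma_io k"
      "foldl d q0 w = after 2 (snd (snd (snd \<pi>))) (take i (zz \<pi>))" unfolding \<pi>_def by blast
    have l: "l \<in> Sigma_io k" using dfa s'(2) unfolding is_dfa_def by blast
    from \<delta>_cases[OF s'(2)] show ?case
    proof
      assume "\<exists>\<pi> i. s' = code \<pi> i \<and> \<pi> \<in> P \<and> i < length (zz \<pi>) \<and> l = (2, zz \<pi> ! i) \<and> s = code \<pi> (Suc i)"
      then have *: "i < length (zz \<pi>)" "l = (2, zz \<pi> ! i)" "s = code \<pi> (Suc i)" by (auto simp: i(1) code_eq)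
      have tr: "fst (tr (pr 1 (w @ [l]))) = \<pi>" using *(2) by (simp add: \<pi>_def)
      show ?case
        unfolding tr using * i l by (intro exI[of _ "Suc i"]) (simp add: take_Suc_conv_app_nth)
    next
      assume "\<exists>\<pi>. s' = code \<pi> (length (zz \<pi>)) \<and> \<pi> \<in> P \<and> fst l = 1 \<and> snd l < k \<and> s = code (nx \<pi> (snd l)) 0"
      then have *: "i = length (zz \<pi>)" "\<pi> \<in> P" "l = (1, snd l)" "snd l < k" "s = code (nx \<pi> (snd l)) 0"
        by (cases l; auto simp: i(1) code_eq)+
      define a where "a = snd l"
      have l: "l = (1, a)" "a < k" using *(3,4) by (simp_all add: a_def)
      have "snd (snd (snd (nx \<pi> a))) = next_state (snd (snd (snd \<pi>))) (zz \<pi>) a"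
        using good[OF *(2)] l(2) unfolding good_move_def by (auto split: prod.splits)
      moreover have tr: "fst (tr (pr 1 (w @ [l]))) = nx \<pi> a" "snd (tr (pr 1 (w @ [l]))) = snd (tr (pr 1 w)) @ zz \<pi>"
        using l by (simp_all add: tr_snoc \<pi>_def)
      ultimately show ?case
        unfolding tr using i * l by (intro exI[of _ 0]) (simp add: next_state_def Sigma_io_def Sigma_def)
    qed
  qed
  have run: "\<exists>w. dfa_run \<delta> (code \<pi>0 0) w = Some (code (fst (tr x)) i) \<and> pr 1 w = x"
    if "x \<in> words" "i \<le> length (zz (fst (tr x)))" for x i
    using that
  proof (induction x arbitrary: i rule: rev_induct)
    case Nil
    then show ?case
    proof (induction i)
      case 0
      show ?case by (intro exI[of _ "[]"]) (simp add: tr_Nil)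
    next
      case (Suc i)
      then obtain w where "dfa_run \<delta> (code \<pi>0 0) w = Some (code (fst (tr [])) i)" "pr 1 w = []" by auto
      then show ?case using Suc.prems \<pi>0 \<delta>_out
        by (intro exI[of _ "w @ [(2, zz \<pi>0 ! i)]"]) (auto simp: dfa_run_append tr_Nil)
    qed
  next
    case (snoc a x)
    then have a: "a < k" and x: "x \<in> words" by auto
    define \<pi> where "\<pi> = fst (tr x)"
    have \<pi>: "\<pi> \<in> P" using tracks[OF x] by (simp add: \<pi>_def)
    have nx: "fst (tr (x @ [a])) = nx \<pi> a" by (simp add: tr_snoc \<pi>_def)
    have "i \<le> length (zz (nx \<pi> a)) \<Longrightarrow> \<exists>w. dfa_run \<delta> (code \<pi>0 0) w = Some (code (nx \<pi> a) i) \<and> pr 1 w = x @ [a]" for i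
    proof (induction i)
      case 0
      obtain w where "dfa_run \<delta> (code \<pi>0 0) w = Some (code \<pi> (length (zz \<pi>)))" "pr 1 w = x"
        using snoc.IH[OF x, of "length (zz \<pi>)"] by (auto simp: \<pi>_def)
      then show ?case using \<pi> a \<delta>_in
        by (intro exI[of _ "w @ [(1, a)]"]) (auto simp: dfa_run_append)
    next
      case (Suc i)
      then obtain w where "dfa_run \<delta> (code \<pi>0 0) w = Some (code (nx \<pi> a) i)" "pr 1 w = x @ [a]" by auto
      then show ?case using Suc.prems nx_P[OF \<pi> a] \<delta>_out
        by (intro exI[of _ "w @ [(2, zz (nx \<pi> a) ! i)]"]) (auto simp: dfa_run_append)
    qed
    then show ?case using snoc.prems nx by simp
  qed
  have accepted: "pr 2 w = snd (tr (pr 1 w)) @ take (m (fst (tr (pr 1 w)))) (zz (fst (tr (pr 1 w)))) \<and> w \<in> T \<and> R (pr 1 w) (pr 2 w)"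
    if "w \<in> dfa_lang \<delta> (code \<pi>0 0) F" for w
  proof -
    from that obtain s where s: "dfa_run \<delta> (code \<pi>0 0) w = Some s" "s \<in> F" by (auto simp: dfa_lang_def)
    from state[OF s(1)] obtain i where i: "s = code (fst (tr (pr 1 w))) i"
      "pr 2 w = snd (tr (pr 1 w)) @ take i (zz (fst (tr (pr 1 w))))" "set w \<subseteq> Sigma_io k"
      "foldl d q0 w = after 2 (snd (snd (snd (fst (tr (pr 1 w)))))) (take i (zz (fst (tr (pr 1 w)))))" by blast
    obtain b x' y' q where \<pi>: "fst (tr (pr 1 w)) = (b, x', y', q)" by (cases "fst (tr (pr 1 w))")
    note i = i[unfolded \<pi> snd_conv]
    have "pr 1 w \<in> words" using set_pr[OF i(3)] by simp
    from tracks[OF this, unfolded \<pi> prod.case]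
    have t: "(b, x', y', q) \<in> P" "similar b (pr 1 w) (snd (tr (pr 1 w))) x' y'" by blast+
    have F: "dm x'" "i = m (b, x', y', q)" using s(2) unfolding i(1) F_def by (auto simp: code_eq)
    from stop_m[OF t(1) F(1)] have stop: "R x' (y' @ take i (zz (b, x', y', q)))"
      "after 2 q (take i (zz (b, x', y', q))) \<in> FT" by (auto simp: stop_def F(2))
    obtain b' where "move b x' y' (zz (b, x', y', q)) b'"
      using good[OF t(1)] by (auto simp: good_move_def)
    from similar_move(4)[OF similar_sym[OF t(2)] this take_is_prefix, of i]
    have "R (pr 1 w) (pr 2 w)" using stop(1) unfolding i(2) by simp
    moreover have "w \<in> T" using T_iff[OF i(3)] stop(2) unfolding i(4) by simp
    ultimately show ?thesis using i(2) F(2) unfolding \<pi> by simp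
  qed
  have "uniformization (sem_lang (dfa_lang \<delta> (code \<pi>0 0) F)) (sem_lang S)"
    unfolding uniformization_def
  proof (intro conjI equalityI)
    show sub: "sem_lang (dfa_lang \<delta> (code \<pi>0 0) F) \<subseteq> sem_lang S"
    proof
      fix p assume "p \<in> sem_lang (dfa_lang \<delta> (code \<pi>0 0) F)"
      then obtain w where w: "w \<in> dfa_lang \<delta> (code \<pi>0 0) F" "p = (pr 1 w, pr 2 w)"
        unfolding sem_lang_def sem_pr by blast
      show "p \<in> sem_lang S" using accepted[OF w(1)] unfolding w(2) R_def by blast
    qed
    then show "Domain (sem_lang (dfa_lang \<delta> (code \<pi>0 0) F)) \<subseteq> Domain (sem_lang S)" by blast
    show "single_valued (sem_lang (dfa_lang \<delta> (code \<pi>0 0) F))"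
    proof (rule single_valuedI)
      fix x y y' assume "(x, y) \<in> sem_lang (dfa_lang \<delta> (code \<pi>0 0) F)" "(x, y') \<in> sem_lang (dfa_lang \<delta> (code \<pi>0 0) F)"
      then obtain w w' where "w \<in> dfa_lang \<delta> (code \<pi>0 0) F" "w' \<in> dfa_lang \<delta> (code \<pi>0 0) F"
        "x = pr 1 w" "y = pr 2 w" "x = pr 1 w'" "y' = pr 2 w'" by (auto simp: sem_lang_def sem_pr)
      then show "y = y'" using accepted[of w] accepted[of w'] by simp
    qed
    show "Domain (sem_lang S) \<subseteq> Domain (sem_lang (dfa_lang \<delta> (code \<pi>0 0) F))"
    proof
      fix x assume "x \<in> Domain (sem_lang S)"
      then have dm: "dm x" by (auto simp: dm_def R_def)
      then have x: "x \<in> words" using dm_letters by simp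
      obtain b x' y' q where \<pi>: "fst (tr x) = (b, x', y', q)" by (cases "fst (tr x)")
      from tracks[OF x, unfolded \<pi> prod.case] have t: "(b, x', y', q) \<in> P" "similar b x (snd (tr x)) x' y'" by blast+
      have "dm x'" using dm similar_dm[OF t(2), of "[]"] by simp
      then have F: "code (b, x', y', q) (m (b, x', y', q)) \<in> F" using t(1) by (auto simp: F_def)
      have "m (b, x', y', q) \<le> length (zz (b, x', y', q))" using m_le t(1) \<open>dm x'\<close> by simp
      then obtain w where "dfa_run \<delta> (code \<pi>0 0) w = Some (code (b, x', y', q) (m (b, x', y', q)))" "pr 1 w = x"
        using run[OF x, of "m (b, x', y', q)"] by (auto simp: \<pi>)
      then have "w \<in> dfa_lang \<delta> (code \<pi>0 0) F" "pr 1 w = x" using F by (auto simp: dfa_lang_def)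
      then show "x \<in> Domain (sem_lang (dfa_lang \<delta> (code \<pi>0 0) F))"
        unfolding sem_lang_def sem_pr by blast
    qed
  qed
  moreover have "dfa_lang \<delta> (code \<pi>0 0) F \<subseteq> T" using accepted by blast
  ultimately show ?thesis unfolding resync_unif_def using sdfa by blast
qed

end

subsection \<open>From a sequential automaton to a strategy\<close>

text \<open>Two runs from one state can part only in an input state, by reading different letters,
  and this is excluded as long as the inputs agree. So they part only when one word ends or when the
  input of \<open>u\<close> is used up.\<close>

lemma sdfa_comparable:
  assumes "is_sdfa k Qs s0 \<delta> F" "dfa_run \<delta> s u \<noteq> None" "dfa_run \<delta> s v \<noteq> None" "prefix (pr 1 u) (pr 1 v)"
  shows "prefix u v \<or> (\<exists>z. u = v @ map (Pair 2) z)"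
  using assms(2-)
proof (induction u arbitrary: s v)
  case (Cons a u)
  have dfa: "is_dfa k Qs s0 \<delta> F" and disj: "Q_in k Qs \<delta> \<inter> Q_out k Qs \<delta> = {}"
    and out: "\<And>q a b. q \<in> Q_out k Qs \<delta> \<Longrightarrow> \<delta> q a \<noteq> None \<Longrightarrow> \<delta> q b \<noteq> None \<Longrightarrow> a = b"
    using assms(1) unfolding is_sdfa_def by blast+
  have letter: "c \<in> Sigma_io k" "s \<in> Qs" if "\<delta> s c \<noteq> None" for s c
    using dfa that unfolding is_dfa_def by blast+
  have in_out: "s \<in> Q_in k Qs \<delta> \<and> fst c = 1 \<or> s \<in> Q_out k Qs \<delta> \<and> fst c = 2" if "\<delta> s c \<noteq> None" for s c
    using letter[OF that] that
    by (cases c) (auto simp: Q_in_def Q_out_def Sigma_io_def Sigma_i_def Sigma_o_def)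
  show ?case
  proof (cases v)
    case Nil
    have "\<exists>z. a # u = map (Pair 2) z"
    proof -
      have "fst c = 2" if c: "c \<in> set (a # u)" for c
      proof -
        obtain u1 u2 where u: "a # u = u1 @ c # u2" using split_list[OF c] by blast
        then obtain s' where "\<delta> s' c \<noteq> None"
          using Cons.prems(1) by (auto simp: u dfa_run_append dfa_run_Cons bind_eq_Some_conv)
        moreover have "fst c \<noteq> 1"
          using Cons.prems(3) Nil u by (auto simp: pr_def filter_empty_conv)
        ultimately show ?thesis using in_out by blast
      qed
      then have "map (\<lambda>c. (2, snd c)) (a # u) = map id (a # u)" by (intro map_cong refl) (auto simp: prod_eq_iff)
      then show ?thesis by (intro exI[of _ "map snd (a # u)"]) (simp add: comp_def)
    qed
    then show ?thesis unfolding Nil append_Nil by (rule disjI2)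
  next
    case (Cons b v')
    obtain t t' where t: "\<delta> s a = Some t" "dfa_run \<delta> t u \<noteq> None" "\<delta> s b = Some t'" "dfa_run \<delta> t' v' \<noteq> None"
      using Cons.prems(1,2) Cons by (auto simp: dfa_run_Cons bind_eq_Some_conv)
    have ab: "a = b"
    proof (cases "s \<in> Q_out k Qs \<delta>")
      case True
      then show ?thesis using out t(1,3) by blast
    next
      case False
      then have "fst a = 1" "fst b = 1" using in_out[of s a] in_out[of s b] t by auto
      then show ?thesis using Cons.prems(3) Cons by (auto simp: prod_eq_iff)
    qed
    have "prefix (pr 1 u) (pr 1 v')" using Cons.prems(3) Cons ab by (auto split: if_splits)
    from Cons.IH[OF t(2) _ this] t ab show ?thesis using Cons by auto
  qed
qed simp

lemma split_first_input:
  assumes "set v \<subseteq> Sigma_io k" "pr 1 v = a # x"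
  obtains z v' where "v = map (Pair 2) z @ (1, a) # v'"
  using assms
proof (induction v arbitrary: thesis)
  case (Cons c v)
  show ?case
  proof (cases "fst c = 1")
    case True
    then have "c = (1, a)" using Cons.prems(3) by (cases c) auto
    then show ?thesis using Cons.prems(1)[of "[]" v] by simp
  next
    case False
    then have c: "c = (2, snd c)" using Cons.prems(2) by (cases c) (auto simp: Sigma_io_def)
    obtain z v' where "v = map (Pair 2) z @ (1, a) # v'"
      using Cons.IH[of thesis] Cons.prems(2,3) False by auto
    then show ?thesis using Cons.prems(1)[of "snd c # z" v'] c by simp
  qed
qed simp

context game
begin

text \<open>The block emitted from a state depends on that state alone, so the finitely many states
  give the bound \<open>M\<close>.\<close>

lemma resync_plays:
  assumes "resync_unif k S T"
  shows "\<exists>M. plays M [] [] q0"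
proof -
  obtain Qs s0 \<delta> F where sdfa: "is_sdfa k Qs s0 \<delta> F" and U_T: "dfa_lang \<delta> s0 F \<subseteq> T"
    and unif: "uniformization (sem_lang (dfa_lang \<delta> s0 F)) (sem_lang S)"
    using assms unfolding resync_unif_def by blast
  define U where "U = dfa_lang \<delta> s0 F"
  have fin: "finite Qs" and s0: "s0 \<in> Qs" and disj: "Q_in k Qs \<delta> \<inter> Q_out k Qs \<delta> = {}"
    and \<delta>: "\<And>q a q'. \<delta> q a = Some q' \<Longrightarrow> q \<in> Qs \<and> a \<in> Sigma_io k \<and> q' \<in> Qs"
    using sdfa unfolding is_sdfa_def is_dfa_def by blast+
  have run_Qs: "s \<in> Qs \<Longrightarrow> dfa_run \<delta> s w = Some t \<Longrightarrow> t \<in> Qs \<and> set w \<subseteq> Sigma_io k" for s w t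
  proof (induction w arbitrary: s)
    case (Cons a w)
    then obtain s' where "\<delta> s a = Some s'" "dfa_run \<delta> s' w = Some t"
      by (auto simp: dfa_run_Cons bind_eq_Some_conv)
    then show ?case using \<delta>[of s a s'] Cons.IH[of s'] by auto
  qed simp
  have Q_out_I: "s \<in> Q_out k Qs \<delta>" if "dfa_run \<delta> s (map (Pair 2) z) \<noteq> None" "z \<noteq> []" for s z
  proof -
    from that(2) obtain c z' where z: "z = c # z'" by (cases z) auto
    with that(1) obtain s' where "\<delta> s (2, c) = Some s'" by (auto simp: dfa_run_Cons bind_eq_Some_conv)
    then show ?thesis using \<delta>[of s "(2, c)" s']
      by (auto simp: Q_out_def Sigma_io_def Sigma_o_def intro!: bexI[of _ "(2, c)"])
  qed
  have Q_in_I: "s \<in> Q_in k Qs \<delta>" if "\<delta> s (1, c) \<noteq> None" for s c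
    using that \<delta>[of s "(1, c)"] by (auto simp: Q_in_def Sigma_io_def Sigma_i_def intro!: bexI[of _ "(1, c)"])
  define stops where "stops s z \<longleftrightarrow> (\<exists>t\<in>Q_in k Qs \<delta>. dfa_run \<delta> s (map (Pair 2) z) = Some t)" for s z
  define ends where "ends s z \<longleftrightarrow> (\<exists>t\<in>F. dfa_run \<delta> s (map (Pair 2) z) = Some t)" for s z
  \<comment> \<open>The output path from a state is unique. If it reaches an input state, it is
    followed that far, and acceptance on the way happens at a prefix. Otherwise it may continue
    forever, and it is followed only to some final state, if there is one.\<close>
  define out where "out s = (if \<exists>z. stops s z then SOME z. stops s z else if \<exists>z. ends s z then SOME z. ends s z else [])" for s
  have out_stops: "stops s (out s)" if "stops s z" for s z
    using that unfolding out_def by (auto intro: someI)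
  have out_ends: "ends s (out s)" if "ends s z" "\<not> (\<exists>z. stops s z)" for s z
    using that unfolding out_def by (auto intro: someI)
  have comparable: "\<exists>z'. z2 = z @ z' \<or> z = z2 @ z'"
    if "dfa_run \<delta> s (map (Pair 2) z) \<noteq> None" "dfa_run \<delta> s (map (Pair 2) z2) \<noteq> None" for s z z2
  proof -
    have "prefix (map (Pair (2::nat)) z) (map (Pair 2) z2) \<or> (\<exists>z'. map (Pair 2) z = map (Pair 2) z2 @ map (Pair (2::nat)) z')"
      by (rule sdfa_comparable[OF sdfa that]) (simp add: pr_map_Pair_other)
    then show ?thesis
    proof
      assume "prefix (map (Pair (2::nat)) z) (map (Pair 2) z2)"
      from map_mono_prefix[OF this, of snd] show ?thesis by (auto simp: comp_def prefix_def)
    next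
      assume "\<exists>z'. map (Pair 2) z = map (Pair 2) z2 @ map (Pair (2::nat)) z'"
      then obtain z' where "map (Pair 2) z = map (Pair 2) z2 @ map (Pair (2::nat)) z'" by blast
      from arg_cong[OF this, of "map snd"] show ?thesis by (auto simp: comp_def)
    qed
  qed
  have stops_max: "z' = []" if "stops s z" "dfa_run \<delta> s (map (Pair 2) (z @ z')) \<noteq> None" for s z z'
  proof (rule ccontr)
    assume "z' \<noteq> []"
    from that(1) obtain t where t: "t \<in> Q_in k Qs \<delta>" "dfa_run \<delta> s (map (Pair 2) z) = Some t" by (auto simp: stops_def)
    then have "dfa_run \<delta> t (map (Pair 2) z') \<noteq> None" using that(2) by (simp add: dfa_run_append)
    then show False using Q_out_I \<open>z' \<noteq> []\<close> t(1) disj by blast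
  qed
  have stops_run: "dfa_run \<delta> s (map (Pair 2) z) \<noteq> None" if "stops s z" for s z
    using that by (auto simp: stops_def)
  have ends_prefix: "prefix z (out s)" if "ends s z" "\<exists>z. stops s z" for s z
  proof -
    have stops: "stops s (out s)" using that(2) out_stops by blast
    have run_z: "dfa_run \<delta> s (map (Pair 2) z) \<noteq> None" using that(1) by (auto simp: ends_def)
    from comparable[OF run_z stops_run[OF stops]] obtain z' where z': "out s = z @ z' \<or> z = out s @ z'" by blast
    then show ?thesis using stops_max[OF stops, of z'] run_z by auto
  qed
  have stops_unique: "z = out s" if "stops s z" for s z
  proof -
    note o = out_stops[OF that]
    from comparable[OF stops_run[OF that] stops_run[OF o]] obtain z' where z': "out s = z @ z' \<or> z = out s @ z'" by blast
    then have "z' = []" using stops_max[OF that, of z'] stops_max[OF o, of z'] stops_run[OF that] stops_run[OF o] by metis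
    then show ?thesis using z' by auto
  qed
  have out_run: "dfa_run \<delta> s (map (Pair 2) (out s)) \<noteq> None" for s
    using out_stops[of s] out_ends[of s] unfolding stops_def ends_def out_def by fastforce
  define M where "M = Max (length ` out ` Qs)"
  \<comment> \<open>When no continuation of the input lies in the domain, the run may break off.
    Otherwise \<open>w\<close> ends with an input letter or is empty, so every accepted word whose
    input extends \<open>x\<close> also extends \<open>w\<close>.\<close>
  define I where "I x y q \<longleftrightarrow> (\<exists>w. set w \<subseteq> Sigma_io k \<and> pr 1 w = x \<and> pr 2 w = y \<and> foldl d q0 w = q \<and>
     ((\<exists>s. dfa_run \<delta> s0 w = Some s \<and> (w = [] \<or> fst (last w) = 1)) \<or> (\<forall>s. \<not> dm (x @ s))))" for x y q
  have "\<exists>z\<in>words. length z \<le> M \<and> accepts x y q z \<and> (\<forall>a<k. I (x @ [a]) (y @ z) (next_state q z a))"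
    if I: "I x y q" for x y q
  proof -
    from I obtain w where w: "set w \<subseteq> Sigma_io k" "pr 1 w = x" "pr 2 w = y" "foldl d q0 w = q"
      and alt: "(\<exists>s. dfa_run \<delta> s0 w = Some s \<and> (w = [] \<or> fst (last w) = 1)) \<or> (\<forall>s. \<not> dm (x @ s))"
      unfolding I_def by blast
    have I_I: "I (x @ [a]) (y @ z) (next_state q z a)"
      if "a < k" "z \<in> words" "(\<exists>s. dfa_run \<delta> s0 (w @ map (Pair 2) z @ [(1, a)]) = Some s) \<or> (\<forall>s. \<not> dm (x @ a # s))" for z a
      unfolding I_def
    proof (intro exI[of _ "w @ map (Pair 2) z @ [(1, a)]"] conjI)
      show "set (w @ map (Pair 2) z @ [(1, a)]) \<subseteq> Sigma_io k"
        using w(1) that(1,2) set_Pair[of 2 z] by (auto simp: Sigma_io_def Sigma_def)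
      show "pr 1 (w @ map (Pair 2) z @ [(1, a)]) = x @ [a]" using w(2) by (simp add: pr_map_Pair_other)
      show "pr 2 (w @ map (Pair 2) z @ [(1, a)]) = y @ z" using w(3) by simp
      show "foldl d q0 (w @ map (Pair 2) z @ [(1, a)]) = next_state q z a" using w(4) by (simp add: next_state_def)
      show "(\<exists>s. dfa_run \<delta> s0 (w @ map (Pair 2) z @ [(1, a)]) = Some s \<and>
          (w @ map (Pair 2) z @ [(1, a)] = [] \<or> fst (last (w @ map (Pair 2) z @ [(1, a)])) = 1)) \<or>
          (\<forall>s. \<not> dm ((x @ [a]) @ s))" using that(3) by simp
    qed
    show ?thesis
    proof (cases "\<forall>s. \<not> dm (x @ s)")
      case True
      have "accepts x y q []" using True[rule_format, of "[]"] by (simp add: accepts_def)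
      moreover have "I (x @ [a]) (y @ []) (next_state q [] a)" if "a < k" for a
        by (rule I_I) (use that True in auto)
      ultimately show ?thesis by (intro bexI[of _ "[]"]) auto
    next
      case False
      then obtain s where s: "dfa_run \<delta> s0 w = Some s" "w = [] \<or> fst (last w) = 1" using alt by blast
      have s_Qs: "s \<in> Qs" using run_Qs[OF s0 s(1)] by blast
      define z where "z = out s"
      obtain t where t: "dfa_run \<delta> s (map (Pair 2) z) = Some t" using out_run[of s] by (auto simp: z_def)
      have z: "z \<in> words"
      proof -
        have "set (map (Pair (2::nat)) z) \<subseteq> Sigma_io k" using run_Qs[OF s_Qs t] by blast
        then show ?thesis using set_pr[of "map (Pair 2) z" 2] by simp
      qed
      have z_len: "length z \<le> M" unfolding M_def z_def using fin s_Qs by (intro Max_ge) auto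
      have extend: "\<exists>v. w1 = w @ v" if w1: "w1 \<in> U" "prefix x (pr 1 w1)" for w1
      proof -
        have "dfa_run \<delta> s0 w1 \<noteq> None" using w1(1) by (auto simp: U_def dfa_lang_def)
        then have "prefix w w1 \<or> (\<exists>z. w = w1 @ map (Pair 2) z)"
          by (intro sdfa_comparable[OF sdfa, of s0]) (use s w1(2) w(2) in auto)
        then show ?thesis
        proof
          assume "\<exists>z. w = w1 @ map (Pair 2) z"
          then obtain z where wz: "w = w1 @ map (Pair 2) z" by blast
          then have "z = []" using s(2) by (cases z rule: rev_cases) auto
          then show ?thesis using wz by simp
        qed (auto simp: prefix_def)
      qed
      have U_letters: "set w1 \<subseteq> Sigma_io k" if "w1 \<in> U" for w1
        using that run_Qs[OF s0] by (auto simp: U_def dfa_lang_def)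
      have U_dom: "\<exists>w1\<in>U. pr 1 w1 = x'" if "dm x'" for x'
      proof -
        have "x' \<in> Domain (sem_lang U)" using that unif unfolding uniformization_def U_def dm_def R_def by blast
        then show ?thesis by (auto simp: sem_lang_def sem_pr)
      qed
      have U_R: "R (pr 1 w1) (pr 2 w1)" "foldl d q0 w1 \<in> FT" if "w1 \<in> U" for w1
      proof -
        have "(pr 1 w1, pr 2 w1) \<in> sem_lang U" using that by (auto simp: sem_lang_def sem_pr intro!: image_eqI[of _ _ w1])
        then show "R (pr 1 w1) (pr 2 w1)" using unif unfolding uniformization_def U_def R_def by blast
        show "foldl d q0 w1 \<in> FT" using that U_T T_iff[OF U_letters[OF that]] by (auto simp: U_def)
      qed
      have acc: "accepts x y q z"
        unfolding accepts_def
      proof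
        assume "dm x"
        then obtain w1 where w1: "w1 \<in> U" "pr 1 w1 = x" using U_dom by blast
        then obtain v where v: "w1 = w @ v" using extend by auto
        define z1 where "z1 = pr 2 v"
        have "v = map (Pair 2) z1"
        proof -
          have "fst c = 2" if "c \<in> set v" for c
          proof -
            have "fst c \<noteq> 1" using w1(2) w(2) that by (auto simp: v pr_def filter_empty_conv)
            moreover have "c \<in> Sigma_io k" using U_letters[OF w1(1)] that by (auto simp: v)
            ultimately show ?thesis by (auto simp: Sigma_io_def)
          qed
          then show ?thesis unfolding z1_def pr_def by (induction v) (auto simp: prod_eq_iff)
        qed
        then have "ends s z1" using w1(1) s(1) by (auto simp: ends_def U_def dfa_lang_def v dfa_run_append)
        show "\<exists>z1. prefix z1 z \<and> R x (y @ z1) \<and> after 2 q z1 \<in> FT"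
        proof (cases "\<exists>z. stops s z")
          case True
          have "prefix z1 z" unfolding z_def by (rule ends_prefix[OF \<open>ends s z1\<close> True])
          moreover have "R x (y @ z1)" using U_R(1)[OF w1(1)] w1(2) w(3) by (simp add: v z1_def)
          moreover have "after 2 q z1 \<in> FT" using U_R(2)[OF w1(1)] w(4) \<open>v = _\<close> by (simp add: v)
          ultimately show ?thesis by blast
        next
          case False
          then have "ends s z" using out_ends \<open>ends s z1\<close> by (simp add: z_def)
          then have u: "w @ map (Pair 2) z \<in> U" using s(1) by (auto simp: ends_def U_def dfa_lang_def dfa_run_append)
          show ?thesis using U_R[OF u] w by (intro exI[of _ z]) (simp add: pr_map_Pair_other)
        qed
      qed
      have "I (x @ [a]) (y @ z) (next_state q z a)" if a: "a < k" for a
      proof (rule I_I[OF a z])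
        have "\<exists>s. dfa_run \<delta> s0 (w @ map (Pair 2) z @ [(1, a)]) = Some s" if dm: "dm (x @ a # x')" for x'
        proof -
          obtain w1 where w1: "w1 \<in> U" "pr 1 w1 = x @ a # x'" using U_dom[OF dm] by blast
          have "prefix x (pr 1 w1)" using w1(2) by simp
          from extend[OF w1(1) this] obtain v where v: "w1 = w @ v" by blast
          have "pr 1 v = a # x'" "set v \<subseteq> Sigma_io k" using w1 w(2) U_letters[OF w1(1)] by (auto simp: v)
          then obtain z2 v' where v2: "v = map (Pair 2) z2 @ (1, a) # v'" using split_first_input by metis
          obtain t2 t3 where t2: "dfa_run \<delta> s (map (Pair 2) z2) = Some t2" "\<delta> t2 (1, a) = Some t3"
            using w1(1) s(1) by (auto simp: U_def dfa_lang_def v v2 dfa_run_append dfa_run_Cons bind_eq_Some_conv)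
          then have "stops s z2" using Q_in_I[of t2 a] by (auto simp: stops_def)
          then have "z2 = z" using stops_unique by (simp add: z_def)
          then show ?thesis using s(1) t2 by (simp add: dfa_run_append)
        qed
        then show "(\<exists>s. dfa_run \<delta> s0 (w @ map (Pair 2) z @ [(1, a)]) = Some s) \<or> (\<forall>s. \<not> dm (x @ a # s))" by blast
      qed
      then show ?thesis using z z_len acc by blast
    qed
  qed
  moreover have "I [] [] q0" unfolding I_def by (intro exI[of _ "[]"]) auto
  ultimately have "plays M [] [] q0" unfolding plays_def by blast
  then show ?thesis ..
qed

theorem resync_iff_safe: "resync_unif k S T \<longleftrightarrow> safe rounds (Suc b0) [] [] q0"
proof
  assume "resync_unif k S T"
  then obtain M where "plays M [] [] q0" using resync_plays by blast
  moreover have "reachable [] [] q0" unfolding reachable_def by (intro exI[of _ "[]"]) auto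
  ultimately show "safe rounds (Suc b0) [] [] q0" by (rule plays_safe) simp
qed (rule safe_resync)

end

subsection \<open>Certificates\<close>

context game
begin

text \<open>\<open>accepts\<close> restated with membership in \<open>T\<close> instead of a target
  state: the procedure can then test words on the given automaton and never computes the
  determinized one.\<close>

definition legal :: "(nat \<times> nat) list \<Rightarrow> nat list \<Rightarrow> bool" where
  "legal w z \<longleftrightarrow> (dm (pr 1 w) \<longrightarrow>
     (\<exists>z1 z2. z = z1 @ z2 \<and> R (pr 1 w) (pr 2 w @ z1) \<and> w @ map (Pair 2) z1 \<in> T))"

lemma legal_accepts:
  assumes "set w \<subseteq> Sigma_io k" "z \<in> words"
  shows "legal w z \<longleftrightarrow> accepts (pr 1 w) (pr 2 w) (foldl d q0 w) z"
proof -
  have "w @ map (Pair 2) z1 \<in> T \<longleftrightarrow> after 2 (foldl d q0 w) z1 \<in> FT" if "z = z1 @ z2" for z1 z2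
    using T_iff[of "w @ map (Pair 2) z1"] set_Pair[of 2 z1] assms that by simp
  then show ?thesis unfolding legal_def accepts_def prefix_def by blast
qed

text \<open>\<open>X\<close> is the set of nodes of a strategy tree of depth \<open>rounds\<close>,
  labelled by budgets. Searching for such a finite set replaces the nested quantifiers of
  \<open>safe\<close>.\<close>

definition continues :: "(nat \<times> (nat \<times> nat) list) set \<Rightarrow> nat \<Rightarrow> (nat \<times> nat) list \<Rightarrow> bool" where
  "continues X b w \<longleftrightarrow> rounds \<le> length (pr 1 w) \<or>
     (\<exists>z\<in>words. length z \<le> block_len \<and> (\<exists>b'\<le>Suc b0. move b (pr 1 w) (pr 2 w) z b' \<and> legal w z \<and>
        (\<forall>a<k. (b', w @ map (Pair 2) z @ [(1, a)]) \<in> X)))"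

lemma safe_certificate:
  assumes "safe rounds (Suc b0) [] [] q0"
  shows "\<exists>X \<subseteq> {..Suc b0} \<times> {w. set w \<subseteq> Sigma_io k \<and> length w \<le> word_len}.
    (Suc b0, []) \<in> X \<and> (\<forall>(b, w)\<in>X. continues X b w)"
proof -
  define X where "X = {(b, w). b \<le> Suc b0 \<and> set w \<subseteq> Sigma_io k \<and> length (pr 1 w) \<le> rounds \<and>
    length w \<le> length (pr 1 w) * Suc block_len \<and>
    safe (rounds - length (pr 1 w)) b (pr 1 w) (pr 2 w) (foldl d q0 w)}"
  have "length w \<le> word_len" if "length (pr 1 w) \<le> rounds" "length w \<le> length (pr 1 w) * Suc block_len" for w
    using that mult_le_mono1[OF that(1), of "Suc block_len"] unfolding word_len_def by linarith
  then have "X \<subseteq> {..Suc b0} \<times> {w. set w \<subseteq> Sigma_io k \<and> length w \<le> word_len}"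
    unfolding X_def by blast
  moreover have "(Suc b0, []) \<in> X" using assms by (simp add: X_def)
  moreover have "continues X b w" if "(b, w) \<in> X" for b w
  proof (cases "rounds \<le> length (pr 1 w)")
    case False
    from that have w: "b \<le> Suc b0" "set w \<subseteq> Sigma_io k" "length w \<le> length (pr 1 w) * Suc block_len"
      "safe (rounds - length (pr 1 w)) b (pr 1 w) (pr 2 w) (foldl d q0 w)" by (auto simp: X_def)
    define n where "n = rounds - Suc (length (pr 1 w))"
    have n: "rounds - length (pr 1 w) = Suc n" using False by (simp add: n_def)
    from w(4)[unfolded n safe.simps] obtain z b' where z: "z \<in> words" "move b (pr 1 w) (pr 2 w) z b'"
      "accepts (pr 1 w) (pr 2 w) (foldl d q0 w) z"
      "\<And>a. a < k \<Longrightarrow> safe n b' (pr 1 w @ [a]) (pr 2 w @ z) (next_state (foldl d q0 w) z a)" by blast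
    have b': "b' \<le> Suc b0" using z(2) by (auto simp: move_def)
    have len: "length z \<le> block_len" using z(2) False by (auto simp: move_def block_len_def)
    have "(b', w @ map (Pair 2) z @ [(1, a)]) \<in> X" if a: "a < k" for a
    proof -
      have pr: "pr 1 (w @ map (Pair 2) z @ [(1, a)]) = pr 1 w @ [a]"
        "pr 2 (w @ map (Pair 2) z @ [(1, a)]) = pr 2 w @ z" by (simp_all add: pr_map_Pair_other)
      have "set (w @ map (Pair 2) z @ [(1, a)]) \<subseteq> Sigma_io k"
        using w(2) a z(1) set_Pair[of 2 z] by (auto simp: Sigma_io_def Sigma_def)
      moreover have "length (w @ map (Pair 2) z @ [(1, a)]) \<le> length (pr 1 w @ [a]) * Suc block_len"
        using w(3) len by simp
      moreover have "foldl d q0 (w @ map (Pair 2) z @ [(1, a)]) = next_state (foldl d q0 w) z a"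
        by (simp add: next_state_def)
      moreover have "rounds - length (pr 1 w @ [a]) = n" "length (pr 1 w @ [a]) \<le> rounds"
        using False by (simp_all add: n_def)
      ultimately show ?thesis using z(4)[OF a] b' unfolding X_def pr mem_Collect_eq prod.case by simp
    qed
    then show ?thesis unfolding continues_def legal_accepts[OF w(2) z(1)]
      using z(1,2,3) b' len legal_accepts[OF w(2) z(1)] by blast
  qed (simp add: continues_def)
  ultimately show ?thesis by blast
qed

lemma certificate_safe:
  assumes X: "\<And>b w. (b, w) \<in> X \<Longrightarrow> set w \<subseteq> Sigma_io k \<and> continues X b w"
  shows "(b, w) \<in> X \<Longrightarrow> L + length (pr 1 w) \<le> rounds \<Longrightarrow> safe L b (pr 1 w) (pr 2 w) (foldl d q0 w)"
proof (induction L arbitrary: b w)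
  case (Suc L)
  have w: "set w \<subseteq> Sigma_io k" "\<not> rounds \<le> length (pr 1 w)" using X[OF Suc.prems(1)] Suc.prems(2) by auto
  with X[OF Suc.prems(1)] obtain z b' where z: "z \<in> words" "move b (pr 1 w) (pr 2 w) z b'" "legal w z"
    "\<And>a. a < k \<Longrightarrow> (b', w @ map (Pair 2) z @ [(1, a)]) \<in> X" unfolding continues_def by blast
  have "safe L b' (pr 1 w @ [a]) (pr 2 w @ z) (next_state (foldl d q0 w) z a)" if a: "a < k" for a
    using Suc.IH[OF z(4)[OF a]] Suc.prems(2) by (simp add: pr_map_Pair_other next_state_def)
  then show ?case unfolding safe.simps
    using z(1,2,3) legal_accepts[OF w(1) z(1)] by blast
qed simp

end

section \<open>Determinization\<close>

text \<open>Subset construction with subsets coded as binary numbers, so that states below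
  \<open>N\<close> become states below \<open>2 ^ N\<close>.\<close>

definition det_step :: "nfa \<Rightarrow> nat \<Rightarrow> nat \<times> nat \<Rightarrow> nat" where
  "det_step A q a = set_encode {r. \<exists>p\<in>set_decode q. (p, a, r) \<in> set (fst A)}"

lemma set_encode_less: "X \<subseteq> {..<N} \<Longrightarrow> set_encode X < 2 ^ N"
proof -
  assume "X \<subseteq> {..<N}"
  then have "set_encode X \<le> (\<Sum>i<N. 2 ^ i)"
    unfolding set_encode_def by (intro sum_mono2) auto
  also have "\<dots> < 2 ^ N" by (induction N) auto
  finally show ?thesis .
qed

lemma det_step_less:
  assumes "states_below N A" shows "det_step A q a < 2 ^ N"
  unfolding det_step_def by (rule set_encode_less) (use assms in \<open>auto simp: states_below_def\<close>)

lemma set_decode_det_step: "set_decode (det_step A q a) = {r. \<exists>p\<in>set_decode q. (p, a, r) \<in> set (fst A)}"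
  unfolding det_step_def
proof (rule set_encode_inverse, rule finite_subset)
  show "{r. \<exists>p\<in>set_decode q. (p, a, r) \<in> set (fst A)} \<subseteq> (\<lambda>(p, a, r). r) ` set (fst A)" by force
qed simp

lemma det_run: "set_decode (foldl (det_step A) q w) = {r. \<exists>p\<in>set_decode q. nfa_reach A p w r}"
  by (induction w arbitrary: q) (auto simp: set_decode_det_step)

lemma game_nfa:
  assumes "states_below N A" "states_below N B" "0 < N" "0 < k"
    and fin: "shiftlag_lang (nfa_lang k A) < \<infinity>" "shiftlag_lang (nfa_lang k B) < \<infinity>"
  shows "game k N (2 ^ N) (nfa_rank N) (set_encode (set (fst (snd B)))) (nfa_lang k A) (nfa_lang k B)
    (det_step B) {q. set_decode q \<inter> set (snd (snd B)) \<noteq> {}}"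
proof
  show "set_encode (set (fst (snd B))) < 2 ^ N"
    by (rule set_encode_less) (use assms(2) in \<open>auto simp: states_below_def\<close>)
  show "w \<in> nfa_lang k B \<longleftrightarrow> foldl (det_step B) (set_encode (set (fst (snd B)))) w \<in>
      {q. set_decode q \<inter> set (snd (snd B)) \<noteq> {}}" if "set w \<subseteq> Sigma_io k" for w
    using that by (auto simp: det_run nfa_lang_def)
  show "rank (nfa_rank N) (\<lambda>\<rho>. (\<rho> 1, \<rho> 2) \<in> sem_lang (nfa_lang k A))"
    by (rule rank_nfa) fact+
  show "chg (map fst v) \<le> 2 * N" if "u @ v \<in> nfa_lang k B" "int N \<le> \<bar>balance u\<bar>" for u v
    by (rule shift_bound[OF assms(2) fin(2) that])
  show "det_step B q a < 2 ^ N" for q a by (rule det_step_less[OF assms(2)])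
  show "0 < k" by fact
  show "set w \<subseteq> Sigma_io k" if "w \<in> nfa_lang k A" for w using that by (auto simp: nfa_lang_def)
  show "set w \<subseteq> Sigma_io k" if "w \<in> nfa_lang k B" for w using that by (auto simp: nfa_lang_def)
qed

section \<open>The decision procedure\<close>

definition next_states :: "nat \<Rightarrow> nat \<Rightarrow> nat list \<Rightarrow> nat list" where
  "next_states c e s = map (\<lambda>t. psnd (psnd t)) (filter (\<lambda>t. pfst t \<in> set s \<and> pfst (psnd t) = e) (list_decode (pfst c)))"

definition in_lang :: "nat \<Rightarrow> nat \<Rightarrow> nat list \<Rightarrow> bool" where
  "in_lang k c v \<longleftrightarrow> (\<forall>e\<in>set v. (pfst e = 1 \<or> pfst e = 2) \<and> psnd e < k) \<and>
     (\<exists>q\<in>set (list_decode (psnd (psnd c))). q \<in> set (fold (next_states c) v (list_decode (pfst (psnd c)))))"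

definition proj :: "nat \<Rightarrow> nat list \<Rightarrow> nat list" where
  "proj d v = map psnd (filter (\<lambda>e. pfst e = d) v)"

definition in_rel :: "nat \<Rightarrow> nat \<Rightarrow> nat list \<Rightarrow> nat list \<Rightarrow> bool" where
  "in_rel k c x y \<longleftrightarrow> (\<exists>u. length u \<le> length x + length y \<and> set u \<subseteq> {..pair 2 k} \<and>
     (in_lang k c u \<and> proj 1 u = x \<and> proj 2 u = y))"

text \<open>If any output fits \<open>x\<close>, then by \<open>rank_shorten\<close> one of length
  at most \<open>length x + K\<close> does, which bounds the words to be searched.\<close>

definition in_dom :: "nat \<Rightarrow> nat \<Rightarrow> nat \<Rightarrow> nat list \<Rightarrow> bool" where
  "in_dom k K c x \<longleftrightarrow> (\<exists>u. length u \<le> length x + (length x + K) \<and> set u \<subseteq> {..pair 2 k} \<and>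
     (in_lang k c u \<and> proj 1 u = x))"

lemma proj_encode: "proj d (map prod_encode w) = pr d w"
  by (induction w) (auto simp: proj_def pr_def pfst_def psnd_def)

lemma encode_decode: "map prod_encode (map prod_decode v) = v"
  by (simp add: comp_def)

lemma set_fold_next_states:
  "set (fold (next_states (encode_nfa A)) (map prod_encode w) s) = {r. \<exists>p\<in>set s. nfa_reach A p w r}"
proof (induction w arbitrary: s)
  case (Cons a w)
  have "set (next_states (encode_nfa A) (prod_encode a) s) = {r. \<exists>p\<in>set s. (p, a, r) \<in> set (fst A)}"
    by (force simp: next_states_def encode_nfa_def pfst_def psnd_def)
  then show ?case using Cons by auto
qed simp

lemma in_lang_encode: "in_lang k (encode_nfa A) (map prod_encode w) \<longleftrightarrow> w \<in> nfa_lang k A"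
proof -
  have "(\<forall>e\<in>set (map prod_encode w). (pfst e = 1 \<or> pfst e = 2) \<and> psnd e < k) \<longleftrightarrow> w \<in> lists (Sigma_io k)"
    by (auto simp: pfst_def psnd_def Sigma_io_def Sigma_def in_lists_conv_set)
  moreover have "list_decode (pfst (psnd (encode_nfa A))) = fst (snd A)"
    "list_decode (psnd (psnd (encode_nfa A))) = snd (snd A)"
    by (simp_all add: encode_nfa_def pfst_def psnd_def)
  ultimately show ?thesis unfolding in_lang_def set_fold_next_states nfa_lang_def by auto
qed

lemma encode_word_bounded:
  assumes "set w \<subseteq> Sigma_io k" shows "set (map prod_encode w) \<subseteq> {..pair 2 k}"
proof -
  have "prod_encode (i, a) \<le> pair 2 k" if "(i, a) \<in> set w" for i a
    using assms that unfolding pair_def[symmetric] by (intro pair_mono) (auto simp: Sigma_io_def Sigma_def)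
  then show ?thesis by auto
qed

lemma length_pr: "set w \<subseteq> Sigma_io k \<Longrightarrow> length w = length (pr 1 w) + length (pr 2 w)"
  by (induction w) (auto simp: Sigma_io_def)

lemma in_rel_iff: "in_rel k (encode_nfa A) x y \<longleftrightarrow> (x, y) \<in> sem_lang (nfa_lang k A)"
proof
  assume "in_rel k (encode_nfa A) x y"
  then obtain u where u: "in_lang k (encode_nfa A) u" "proj 1 u = x" "proj 2 u = y" unfolding in_rel_def by blast
  define w where "w = map prod_decode u"
  have uw: "u = map prod_encode w" unfolding w_def encode_decode ..
  show "(x, y) \<in> sem_lang (nfa_lang k A)"
    using u unfolding uw in_lang_encode proj_encode sem_lang_def sem_pr by blast
next
  assume "(x, y) \<in> sem_lang (nfa_lang k A)"
  then obtain w where w: "w \<in> nfa_lang k A" "pr 1 w = x" "pr 2 w = y" unfolding sem_lang_def sem_pr by blast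
  then have letters: "set w \<subseteq> Sigma_io k" by (auto simp: nfa_lang_def)
  show "in_rel k (encode_nfa A) x y"
    unfolding in_rel_def
    using w encode_word_bounded[OF letters] length_pr[OF letters]
    by (intro exI[of _ "map prod_encode w"] conjI) (simp_all only: in_lang_encode proj_encode length_map order_refl)
qed

lemma in_dom_iff:
  assumes "rank K (\<lambda>\<rho>. (\<rho> 1, \<rho> 2) \<in> sem_lang (nfa_lang k A))"
  shows "in_dom k K (encode_nfa A) x \<longleftrightarrow> (\<exists>y. (x, y) \<in> sem_lang (nfa_lang k A))"
proof
  assume "in_dom k K (encode_nfa A) x"
  then obtain u where u: "in_lang k (encode_nfa A) u" "proj 1 u = x" unfolding in_dom_def by blast
  define w where "w = map prod_decode u"
  have uw: "u = map prod_encode w" unfolding w_def encode_decode ..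
  show "\<exists>y. (x, y) \<in> sem_lang (nfa_lang k A)"
    using u unfolding uw in_lang_encode proj_encode sem_lang_def sem_pr by blast
next
  assume "\<exists>y. (x, y) \<in> sem_lang (nfa_lang k A)"
  then obtain y where y: "(x, y) \<in> sem_lang (nfa_lang k A)" by blast
  define \<rho> where "\<rho> = (\<lambda>t::nat. if t = 1 then x else if t = 2 then y else [])"
  have "(\<rho> 1, \<rho> 2) \<in> sem_lang (nfa_lang k A)" using y by (simp add: \<rho>_def)
  moreover have "length (\<rho> s) \<le> length x" if "s \<noteq> 2" for s using that by (simp add: \<rho>_def)
  ultimately obtain z where "length z \<le> length x + K" "((\<rho>(2 := z)) 1, (\<rho>(2 := z)) 2) \<in> sem_lang (nfa_lang k A)"
    using rank_shorten[OF assms, of \<rho> 2 "length x"] by blast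
  then have z: "length z \<le> length x + K" "(x, z) \<in> sem_lang (nfa_lang k A)" by (simp_all add: \<rho>_def)
  then obtain w where w: "w \<in> nfa_lang k A" "pr 1 w = x" "pr 2 w = z" unfolding sem_lang_def sem_pr by blast
  then have letters: "set w \<subseteq> Sigma_io k" by (auto simp: nfa_lang_def)
  have "length w \<le> length x + (length x + K)" using length_pr[OF letters] w z(1) by simp
  then show "in_dom k K (encode_nfa A) x"
    unfolding in_dom_def
    using w(1,2) encode_word_bounded[OF letters]
    by (intro exI[of _ "map prod_encode w"] conjI) (simp_all only: in_lang_encode proj_encode length_map)
qed

definition code_move :: "nat \<Rightarrow> nat \<Rightarrow> nat \<Rightarrow> nat list \<Rightarrow> nat list \<Rightarrow> nat list \<Rightarrow> nat \<Rightarrow> bool" where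
  "code_move N c b x y z b' \<longleftrightarrow> (b \<le> c \<and> length z + b' = b) \<or> (b = Suc c \<and> length z + b' = c) \<or>
     (b = Suc c \<and> b' = Suc c \<and> length x < length y + length z + N \<and> length y + length z < length x + N)"

definition code_legal :: "nat \<Rightarrow> nat \<Rightarrow> nat \<Rightarrow> nat list \<Rightarrow> nat list \<Rightarrow> bool" where
  "code_legal k K p v z \<longleftrightarrow> (in_dom k K (pfst p) (proj 1 v) \<longrightarrow>
     (\<exists>z1. length z1 \<le> length z \<and> set z1 \<subseteq> {..k} \<and> (\<exists>z2. length z2 \<le> length z \<and> set z2 \<subseteq> {..k} \<and>
       (z = z1 @ z2 \<and> in_rel k (pfst p) (proj 1 v) (proj 2 v @ z1) \<and>
        in_lang k (psnd p) (v @ map (pair 2) z1)))))"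

text \<open>The code \<open>p\<close> of the pair of automata exceeds or equals every state name in
  transitions and initial states of both, so \<open>Suc p\<close> serves as \<open>N\<close>,
  \<open>2 ^ Suc p\<close> as \<open>Q\<close> and \<open>nfa_rank (Suc p)\<close> as
  \<open>KR\<close>.\<close>

definition code_continues :: "nat \<Rightarrow> nat \<Rightarrow> nat list \<Rightarrow> nat \<Rightarrow> bool" where
  "code_continues k p xs e \<longleftrightarrow> game_bounds.rounds k (Suc p) (2 ^ Suc p) (nfa_rank (Suc p)) \<le> length (proj 1 (list_decode (psnd e))) \<or>
     (\<exists>z. length z \<le> game_bounds.block_len k (Suc p) (2 ^ Suc p) (nfa_rank (Suc p)) \<and> set z \<subseteq> {..k} \<and>
       ((\<forall>a\<in>set z. a < k) \<and> code_legal k (nfa_rank (Suc p)) p (list_decode (psnd e)) z \<and>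
       (\<exists>b'<Suc (Suc (game_bounds.b0 (Suc p) (2 ^ Suc p) (nfa_rank (Suc p)))).
         code_move (Suc p) (game_bounds.b0 (Suc p) (2 ^ Suc p) (nfa_rank (Suc p))) (pfst e)
           (proj 1 (list_decode (psnd e))) (proj 2 (list_decode (psnd e))) z b' \<and>
         (\<forall>a<k. pair b' (list_encode (list_decode (psnd e) @ map (pair 2) z @ [pair 1 a])) \<in> set xs))))"

definition code_bound :: "nat \<Rightarrow> nat \<Rightarrow> nat" where
  "code_bound k p = pair (Suc (game_bounds.b0 (Suc p) (2 ^ Suc p) (nfa_rank (Suc p))))
     (list_bound (game_bounds.word_len k (Suc p) (2 ^ Suc p) (nfa_rank (Suc p))) (pair 2 k))"

text \<open>The list enumerates the coded nodes of a strategy tree. Without repetitions it has at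
  most \<open>Suc (code_bound k p)\<close> entries, the number of admissible codes.\<close>

definition decide :: "nat \<Rightarrow> nat \<Rightarrow> bool" where
  "decide k p \<longleftrightarrow> (\<exists>xs. length xs \<le> Suc (code_bound k p) \<and> set xs \<subseteq> {..code_bound k p} \<and>
     (pair (Suc (game_bounds.b0 (Suc p) (2 ^ Suc p) (nfa_rank (Suc p)))) (list_encode []) \<in> set xs \<and>
      (\<forall>e\<in>set xs. code_continues k p xs e)))"

lemma states_below_code:
  assumes "encode_nfa A \<le> p" shows "states_below (Suc p) A"
proof -
  define ts where "ts = map (\<lambda>(p, (i, a), q). prod_encode (p, prod_encode (prod_encode (i, a), q))) (fst A)"
  have code: "encode_nfa A = pair (list_encode ts) (pair (list_encode (fst (snd A))) (list_encode (snd (snd A))))"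
    by (simp add: encode_nfa_def ts_def pair_def)
  have "list_encode ts \<le> p" "list_encode (fst (snd A)) \<le> p"
    using assms le_pair1 le_pair2 unfolding code by (meson le_trans)+
  moreover have "s \<le> list_encode ts \<and> t \<le> list_encode ts" if "(s, (i, a), t) \<in> set (fst A)" for s i a t
  proof -
    have "pair s (pair (pair i a) t) \<in> set ts"
      using that unfolding ts_def pair_def by force
    then have "pair s (pair (pair i a) t) \<le> list_encode ts" by (rule le_list_encode)
    then show ?thesis using le_pair1[of s] le_pair2[of t] le_pair2[of "pair (pair i a) t" s] by (meson le_trans)
  qed
  ultimately show ?thesis
    unfolding states_below_def using le_list_encode[of _ "fst (snd A)"]
    by (fastforce simp: less_Suc_eq_le intro: le_trans)
qed

lemma decide_iff:
  assumes k: "0 < k" and p: "p = prod_encode (encode_nfa A, encode_nfa B)"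
    and fin: "shiftlag_lang (nfa_lang k A) < \<infinity>" "shiftlag_lang (nfa_lang k B) < \<infinity>"
  shows "decide k p \<longleftrightarrow> resync_unif k (nfa_lang k A) (nfa_lang k B)"
proof -
  have pA: "pfst p = encode_nfa A" and pB: "psnd p = encode_nfa B" by (simp_all add: p pfst_def psnd_def)
  have "encode_nfa A \<le> p" "encode_nfa B \<le> p" by (simp_all add: p le_prod_encode_1 le_prod_encode_2)
  then have below: "states_below (Suc p) A" "states_below (Suc p) B" by (simp_all add: states_below_code)
  interpret game k "Suc p" "2 ^ Suc p" "nfa_rank (Suc p)" "set_encode (set (fst (snd B)))" "nfa_lang k A" "nfa_lang k B"
    "det_step B" "{q. set_decode q \<inter> set (snd (snd B)) \<noteq> {}}"
    by (rule game_nfa[OF below _ k fin]) simp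
  let ?q0 = "set_encode (set (fst (snd B)))"
  have move_iff: "code_move (Suc p) b0 b x y z b' \<longleftrightarrow> move b x y z b'" for b x y z b'
    unfolding code_move_def move_def by auto
  have dom: "in_dom k (nfa_rank (Suc p)) (pfst p) x \<longleftrightarrow> dm x" for x
    unfolding pA in_dom_iff[OF rank_S] dm_def R_def ..
  have rel: "in_rel k (pfst p) x y \<longleftrightarrow> R x y" for x y
    unfolding pA in_rel_iff R_def ..
  have out: "map prod_encode w @ map (pair 2) z = map prod_encode (w @ map (Pair 2) z)" for w z
    by (simp add: pair_def comp_def)
  have next_word: "map prod_encode w @ map (pair 2) z @ [pair 1 a] = map prod_encode (w @ map (Pair 2) z @ [(1, a)])" for w z a
    by (simp add: pair_def comp_def)
  have legal_iff: "code_legal k (nfa_rank (Suc p)) p (map prod_encode w) z \<longleftrightarrow> legal w z" if z: "z \<in> words" for w z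
  proof -
    have ex: "(\<exists>z1. length z1 \<le> length z \<and> set z1 \<subseteq> {..k} \<and> (\<exists>z2. length z2 \<le> length z \<and> set z2 \<subseteq> {..k} \<and>
        (z = z1 @ z2 \<and> C z1 \<and> D z1))) \<longleftrightarrow> (\<exists>z1 z2. z = z1 @ z2 \<and> C z1 \<and> D z1)" for C D
    proof
      assume "\<exists>z1 z2. z = z1 @ z2 \<and> C z1 \<and> D z1"
      then obtain z1 z2 where z12: "z = z1 @ z2" "C z1" "D z1" by blast
      have "set z1 \<subseteq> {..k}" "set z2 \<subseteq> {..k}" using z z12(1) by auto
      then show "\<exists>z1. length z1 \<le> length z \<and> set z1 \<subseteq> {..k} \<and> (\<exists>z2. length z2 \<le> length z \<and> set z2 \<subseteq> {..k} \<and>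
        (z = z1 @ z2 \<and> C z1 \<and> D z1))"
        using z12 by - (rule exI[of _ z1], intro conjI exI[of _ z2], simp_all)
    qed blast
    show ?thesis
      unfolding code_legal_def legal_def dom rel proj_encode out pB in_lang_encode ex ..
  qed
  have words_iff: "set z \<subseteq> {..k} \<and> (\<forall>a\<in>set z. a < k) \<longleftrightarrow> z \<in> words" for z by auto
  have continues_iff: "code_continues k p xs (pair b (list_encode (map prod_encode w))) \<longleftrightarrow>
      continues {(b, w). pair b (list_encode (map prod_encode w)) \<in> set xs} b w" for xs b w
  proof -
    have "code_continues k p xs (pair b (list_encode (map prod_encode w))) \<longleftrightarrow> rounds \<le> length (pr 1 w) \<or>
      (\<exists>z. length z \<le> block_len \<and> z \<in> words \<and> code_legal k (nfa_rank (Suc p)) p (map prod_encode w) z \<and>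
        (\<exists>b'<Suc (Suc b0). move b (pr 1 w) (pr 2 w) z b' \<and>
           (\<forall>a<k. pair b' (list_encode (map prod_encode (w @ map (Pair 2) z @ [(1, a)]))) \<in> set xs)))"
      unfolding code_continues_def pfst_pair psnd_pair list_encode_inverse proj_encode move_iff next_word words_iff[symmetric]
      by blast
    also have "\<dots> \<longleftrightarrow> continues {(b, w). pair b (list_encode (map prod_encode w)) \<in> set xs} b w"
      unfolding continues_def less_Suc_eq_le mem_Collect_eq prod.case using legal_iff by blast
    finally show ?thesis .
  qed
  show ?thesis
    unfolding resync_iff_safe
  proof
    assume "decide k p"
    then obtain xs where xs: "pair (Suc b0) (list_encode []) \<in> set xs" "\<forall>e\<in>set xs. code_continues k p xs e"
      unfolding decide_def by blast
    \<comment> \<open>The list found may contain codes of words with letters outside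
      \<open>Sigma_io k\<close>. They are dropped, and the remaining set is still closed because a
      move appends admissible letters only.\<close>
    define X where "X = {(b, w). pair b (list_encode (map prod_encode w)) \<in> set xs \<and> set w \<subseteq> Sigma_io k}"
    have "set w \<subseteq> Sigma_io k \<and> continues X b w" if "(b, w) \<in> X" for b w
    proof -
      have w: "pair b (list_encode (map prod_encode w)) \<in> set xs" "set w \<subseteq> Sigma_io k" using that by (auto simp: X_def)
      then have "continues {(b, w). pair b (list_encode (map prod_encode w)) \<in> set xs} b w"
        using xs(2) continues_iff by blast
      moreover have "set (w @ map (Pair 2) z @ [(1, a)]) \<subseteq> Sigma_io k" if "z \<in> words" "a < k" for z a
        using w(2) set_Pair[of 2 z] that by (auto simp: Sigma_io_def Sigma_def)
      ultimately have "continues X b w" unfolding continues_def X_def mem_Collect_eq prod.case by blast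
      then show ?thesis using w(2) by blast
    qed
    moreover have "(Suc b0, []) \<in> X" using xs(1) by (simp add: X_def)
    ultimately show "safe rounds (Suc b0) [] [] ?q0"
      using certificate_safe[of X "Suc b0" "[]" rounds] by simp
  next
    assume "safe rounds (Suc b0) [] [] ?q0"
    from safe_certificate[OF this] obtain X where
      X: "X \<subseteq> {..Suc b0} \<times> {w. set w \<subseteq> Sigma_io k \<and> length w \<le> word_len}"
      "(Suc b0, []) \<in> X" "\<forall>(b, w)\<in>X. continues X b w" by blast
    define C where "C = (\<lambda>(b, w). pair b (list_encode (map prod_encode w))) ` X"
    have C_le: "C \<subseteq> {..code_bound k p}"
    proof
      fix e assume "e \<in> C"
      then obtain b w where e: "e = pair b (list_encode (map prod_encode w))" "(b, w) \<in> X" unfolding C_def by auto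
      then have w: "b \<le> Suc b0" "set w \<subseteq> Sigma_io k" "length w \<le> word_len" using X(1) by auto
      have "list_encode (map prod_encode w) \<le> list_bound word_len (pair 2 k)"
        by (rule list_encode_le_bound) (use w encode_word_bounded[OF w(2)] in simp_all)
      then show "e \<in> {..code_bound k p}" unfolding e code_bound_def using w(1) by (simp add: pair_mono)
    qed
    then have fin_C: "finite C" by (rule finite_subset) simp
    define xs where "xs = sorted_list_of_set C"
    have set_xs: "set xs = C" using fin_C by (simp add: xs_def)
    have "length xs = card C" by (simp add: xs_def)
    also have "\<dots> \<le> card {..code_bound k p}" by (rule card_mono[OF _ C_le]) simp
    finally have len: "length xs \<le> Suc (code_bound k p)" by simp
    have inj: "pair b (list_encode (map prod_encode w)) \<in> C \<longleftrightarrow> (b, w) \<in> X" for b w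
    proof
      assume "pair b (list_encode (map prod_encode w)) \<in> C"
      then obtain b' w' where "(b', w') \<in> X" "b = b'" "list_encode (map prod_encode w) = list_encode (map prod_encode w')"
        unfolding C_def by auto
      moreover from this(3) have "map prod_decode (map prod_encode w) = map prod_decode (map prod_encode w')"
        unfolding list_encode_eq by simp
      then have "w = w'" by (simp add: comp_def)
      ultimately show "(b, w) \<in> X" by simp
    qed (force simp: C_def)
    have "{(b, w). pair b (list_encode (map prod_encode w)) \<in> set xs} = X"
      unfolding set_xs inj by blast
    then have "code_continues k p xs e" if "e \<in> set xs" for e
      using that X(3) continues_iff[of xs] unfolding set_xs C_def by auto
    moreover have "pair (Suc b0) (list_encode []) \<in> set xs"
      using inj[of "Suc b0" "[]"] X(2) unfolding set_xs by simp
    ultimately show "decide k p"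
      unfolding decide_def using len C_le set_xs by blast
  qed
qed

subsection \<open>Computability of the decision procedure\<close>

lemma computable_nfa_rank [computable]: "computable f \<Longrightarrow> computable (\<lambda>n. nfa_rank (f n))"
  unfolding nfa_rank_def by (intro computable)

text \<open>An explicit \<open>rec_nat\<close>, so that \<open>computable_rec_nat\<close>
  applies.\<close>

lemma await_rank_rec: "game_bounds.await_rank Q K j =
    rec_nat (2 * 2 ^ (2 * (game_bounds.KX Q * (2 * game_bounds.KD K))))
      (\<lambda>_ e. 2 * 2 ^ (2 * (game_bounds.KX Q * (2 * (game_bounds.KD K * ((K * game_bounds.KX Q) *
        2 ^ (2 * (2 * (2 * (Suc Q * game_bounds.emit_rank Q K e) ^ Q)))))))))
      j"
  by (induction j) (simp_all add: game_bounds.await_rank.simps)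

lemma computable_bounds:
  assumes "computable N" "computable Q" "computable K"
  shows computable_b0: "computable (\<lambda>n. game_bounds.b0 (N n) (Q n) (K n))"
    and computable_rounds: "computable (\<lambda>n. game_bounds.rounds k (N n) (Q n) (K n))"
    and computable_block_len: "computable (\<lambda>n. game_bounds.block_len k (N n) (Q n) (K n))"
    and computable_word_len: "computable (\<lambda>n. game_bounds.word_len k (N n) (Q n) (K n))"
proof -
  have KD: "computable (\<lambda>n. game_bounds.KD (f n))" if "computable f" for f
    unfolding game_bounds.KD_def by (intro computable that)
  have KX: "computable (\<lambda>n. game_bounds.KX (f n))" if "computable f" for f
    unfolding game_bounds.KX_def by (intro computable that)
  have emit: "computable (\<lambda>n. game_bounds.emit_rank (f n) (g n) (h n))"
    if "computable f" "computable g" "computable h" for f g h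
    unfolding game_bounds.emit_rank_def by (intro computable KD KX that)
  have await: "computable (\<lambda>n. game_bounds.await_rank (f n) (g n) (h n))"
    if "computable f" "computable g" "computable h" for f g h
    unfolding await_rank_rec
    by (intro computable KD KX emit that computable_compose[OF that(1)] computable_compose[OF that(2)])
  show b0: "computable (\<lambda>n. game_bounds.b0 (N n) (Q n) (K n))"
    unfolding game_bounds.b0_def game_bounds.KP_def by (intro computable emit await KD assms)
  have "computable (\<lambda>n. game_bounds.short_len k (N n) (Q n) (K n))"
    unfolding game_bounds.short_len_def game_bounds.KP_def game_bounds.KB_def
    by (intro computable b0 KD assms)
  then show rounds: "computable (\<lambda>n. game_bounds.rounds k (N n) (Q n) (K n))"
    unfolding game_bounds.rounds_def by (intro computable b0 assms)
  show block: "computable (\<lambda>n. game_bounds.block_len k (N n) (Q n) (K n))"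
    unfolding game_bounds.block_len_def by (intro computable b0 rounds assms)
  show "computable (\<lambda>n. game_bounds.word_len k (N n) (Q n) (K n))"
    unfolding game_bounds.word_len_def by (intro computable block rounds)
qed

declare computable_bounds [computable]

lemma computable_next_states [computable]:
  assumes "computable c" "computable e" "computable_list s"
  shows "computable_list (\<lambda>n. next_states (c n) (e n) (s n))"
  unfolding next_states_def
  by (intro computable assms computable_compose[OF assms(2)] computable_list_compose[OF assms(3)])

lemma decidable_in_lang [computable]:
  assumes "computable c" "computable_list v"
  shows "decidable (\<lambda>n. in_lang k (c n) (v n))"
  unfolding in_lang_def
  by (intro computable assms computable_compose[OF assms(1)] computable_list_compose[OF assms(2)])

lemma computable_proj [computable]:
  assumes "computable_list v" shows "computable_list (\<lambda>n. proj d (v n))"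
  unfolding proj_def by (intro computable assms)

lemma decidable_in_rel [computable]:
  assumes "computable c" "computable_list x" "computable_list y"
  shows "decidable (\<lambda>n. in_rel k (c n) (x n) (y n))"
  unfolding in_rel_def
  by (intro computable assms computable_compose[OF assms(1)] computable_list_compose[OF assms(2)]
      computable_list_compose[OF assms(3)])

lemma decidable_in_dom [computable]:
  assumes "computable K" "computable c" "computable_list x"
  shows "decidable (\<lambda>n. in_dom k (K n) (c n) (x n))"
  unfolding in_dom_def
  by (intro computable assms computable_compose[OF assms(2)] computable_list_compose[OF assms(3)])

lemma decidable_code_move [computable]:
  assumes "computable N" "computable c" "computable b" "computable_list x" "computable_list y"
    "computable_list z" "computable b'"
  shows "decidable (\<lambda>n. code_move (N n) (c n) (b n) (x n) (y n) (z n) (b' n))"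
  unfolding code_move_def by (intro computable assms)

lemma decidable_code_legal [computable]:
  assumes "computable K" "computable p" "computable_list v" "computable_list z"
  shows "decidable (\<lambda>n. code_legal k (K n) (p n) (v n) (z n))"
  unfolding code_legal_def
  by (intro computable assms computable_compose[OF assms(2)] computable_list_compose[OF assms(3)]
      computable_list_compose[OF assms(4)])

lemma decidable_code_continues [computable]:
  assumes "computable p" "computable_list xs" "computable e"
  shows "decidable (\<lambda>n. code_continues k (p n) (xs n) (e n))"
  unfolding code_continues_def
  by (intro computable assms computable_compose[OF assms(1)] computable_list_compose[OF assms(2)]
      computable_compose[OF assms(3)])

lemma decidable_decide: "decidable (decide k)"
  unfolding decide_def code_bound_def by (intro computable)

text \<open>Over the empty alphabet there are no transitions, so the initial state is neither an
  input nor an output state and no sequential automaton exists.\<close>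

lemma not_resync_unif_0: "\<not> resync_unif 0 S T"
  by (auto simp: resync_unif_def is_sdfa_def is_dfa_def Q_in_def Q_out_def Sigma_i_def Sigma_o_def Sigma_def)

theorem theorem4p1:
  fixes k :: nat
  shows "\<exists>f :: recf. \<forall>A B :: nfa.
           shiftlag_lang (nfa_lang k A) < \<infinity> \<and> shiftlag_lang (nfa_lang k B) < \<infinity> \<longrightarrow>
           rf_eval f [prod_encode (encode_nfa A, encode_nfa B)]
             (if resync_unif k (nfa_lang k A) (nfa_lang k B) then 1 else 0)"
proof (cases "k = 0")
  case True
  then show ?thesis using not_resync_unif_0 rf_eval.zero by (intro exI[of _ RZ]) simp
next
  case False
  obtain f where "\<And>n. rf_eval f [n] (if decide k n then 1 else 0)"
    using computable_recf[OF decidable_decide[unfolded decidable_def]] by blast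
  then show ?thesis using False decide_iff by (metis neq0_conv)
qed

end
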